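(* Let $a=(a_n)_{n\ge0}$ with $a_n>0$ and $b=(b_n)_{n\ge0}$ real, let $(p_n)$ be the associated orthonormal polynomials with orthogonality measure $\mu$, let $N\ge2$ be an integer and let \[ q\in\Big\{2\cos\tfrac{\pi}{N},2\cos\tfrac{2\pi}{N},\dots,2\cos\tfrac{(N-1)\pi}{N}\Big\}. \] Suppose that \[ \mathcal{V}_N\Big(\tfrac{1}{a_n}\Big)+\mathcal{V}_N\big(a_n-a_{n-1}\big)+\mathcal{V}_N\big(b_n-qa_n\big)<\infty, \] and that (a) $\lim_{n\to\infty}\frac1{a_n}=0$, for each $i\in\{0,\dots,N-1\}$ the limit $s_i=\lim_{k\to\infty}(a_{Nk+i}-a_{Nk+i-1})$ exists, and $\lim_{n\to\infty}(b_n-qa_n)=0$; (b) $\lim_{n\to\infty}(a_{n+N}-a_n)=0$. Let \[ h(x)=x^2\frac{4N^2}{4-q^2}-4\sum_{i,j=1}^{N-1}s_is_j\,w_{i-1}(q)\,w_{j-1}(q)\,w_{i-j}(q), \] and suppose $h$ has real roots $x_-\le x_+$. Then for each $x\in\mathbb{R}\setminus[x_-,x_+]$ the limit \[ \widetilde g(x)=\lim_{n\to\infty}a_{n+N-1}^2D^N_n(x) \] exists and defines a continuous function without zeros on $\mathbb{R}\setminus[x_-,x_+]$. Moreover, $\mu$ is absolutely continuous on $\mathbb{R}\setminus[x_-,x_+]$ with density \[ \mu'(x)=\frac{\sqrt{h(x)}}{2\pi|\widetilde g(x)|},\qquad x\in\mathbb{R}\setminus[x_-,x_+]. \]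
   Context: Given sequences $a_n>0$, $b_n\in\mathbb{R}$ ($n\ge0$), the orthonormal polynomials are defined by $p_{-1}=0$, $p_0=1$, and $a_{n-1}p_{n-1}(x)+b_np_n(x)+a_np_{n+1}(x)=xp_n(x)$ for $n\ge0$; they are orthonormal in $L^2(\mu)$ for a Borel probability measure $\mu$ on $\mathbb{R}$ (under the hypotheses, this measure is unique). The $N$-shifted Turán determinant is $D^N_n(x)=p_n(x)p_{n+N-1}(x)-p_{n-1}(x)p_{n+N}(x)$. The total $N$-variation of a sequence $(x_n)$ is $\mathcal{V}_N(x_n)=\sum_{n}|x_{n+N}-x_n|$. The polynomials $w_n$ are rescaled Chebyshev polynomials of the second kind: $w_n(x)=U_n(x/2)$, i.e. for $x=2\cos\theta$, $w_n(x)=\frac{\sin((n+1)\theta)}{\sin\theta}$ (this formula also defines $w_n$ for negative integers $n$, e.g. $w_{-1}=0$). *)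

theory Defs
  imports "HOL-Probability.Probability"
begin

fun opoly :: "(nat \<Rightarrow> real) \<Rightarrow> (nat \<Rightarrow> real) \<Rightarrow> nat \<Rightarrow> real \<Rightarrow> real" where
  "opoly a b 0 x = 1"
| "opoly a b (Suc 0) x = (x - b 0) / a 0"
| "opoly a b (Suc (Suc n)) x =
     ((x - b (Suc n)) * opoly a b (Suc n) x - a n * opoly a b n x) / a (Suc n)"

definition opoly_pred :: "(nat \<Rightarrow> real) \<Rightarrow> (nat \<Rightarrow> real) \<Rightarrow> nat \<Rightarrow> real \<Rightarrow> real" where
  "opoly_pred a b n x = (if n = 0 then 0 else opoly a b (n - 1) x)"

definition turan :: "(nat \<Rightarrow> real) \<Rightarrow> (nat \<Rightarrow> real) \<Rightarrow> nat \<Rightarrow> nat \<Rightarrow> real \<Rightarrow> real" where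
  "turan a b N n x = opoly a b n x * opoly a b (n + N - 1) x
                     - opoly_pred a b n x * opoly a b (n + N) x"

definition finite_Nvar :: "nat \<Rightarrow> (nat \<Rightarrow> real) \<Rightarrow> bool" where
  "finite_Nvar N x \<longleftrightarrow> summable (\<lambda>n. \<bar>x (n + N) - x n\<bar>)"

text \<open>Chebyshev polynomials of the second kind, rescaled: w_n(x) = U_n(x/2).\<close>
fun chebw_nat :: "nat \<Rightarrow> real \<Rightarrow> real" where
  "chebw_nat 0 x = 1"
| "chebw_nat (Suc 0) x = x"
| "chebw_nat (Suc (Suc n)) x = x * chebw_nat (Suc n) x - chebw_nat n x"

text \<open>Extension to integer indices consistent with sin((n+1)t)/sin t:
  w_{-1} = 0 and w_{-n-2} = - w_n.\<close>
definition chebw :: "int \<Rightarrow> real \<Rightarrow> real" where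
  "chebw k x = (if k \<ge> 0 then chebw_nat (nat k) x
                else if k = -1 then 0 else - chebw_nat (nat (- k - 2)) x)"

definition hfun :: "nat \<Rightarrow> real \<Rightarrow> (nat \<Rightarrow> real) \<Rightarrow> real \<Rightarrow> real" where
  "hfun N q s x = x\<^sup>2 * (4 * (real N)\<^sup>2 / (4 - q\<^sup>2))
     - 4 * (\<Sum>i = 1..N - 1. \<Sum>j = 1..N - 1.
              s i * s j * chebw (int i - 1) q * chebw (int j - 1) q * chebw (int i - int j) q)"

end

theory Submission
  imports Defs "HOL-Complex_Analysis.Cauchy_Integral_Theorem"
begin

text \<open>
  Write the shifted Turan determinant as a quadratic form in two consecutive polynomials. Since
  the limiting one-step transfer matrix has \<open>N\<close>-th power plus or minus the identity, the
  coefficients of this form, multiplied by \<open>a (n + N - 1)\<close>, converge with bounded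
  \<open>N\<close>-variation, and \<open>h\<close> is minus the discriminant of the limit.
  The form is thus eventually definite where \<open>h > 0\<close>, and it is invariant under its own transfer
  matrix up to the determinant, so consecutive scaled Turan determinants in a residue class differ by a
  summable relative error.

  For the density, freeze the limiting form at a point \<open>x0\<close>. A definite form evaluated at
  two consecutive polynomials is \<open>\<bar>p (n + 1) - \<tau> * p n\<bar>\<^sup>2\<close> up to a constant, and its
  reciprocal, suitably normalised, is the density of a measure with the same first
  moments as \<open>\<mu>\<close>. These measures converge to \<open>\<mu>\<close> by Carleman's condition, while near \<open>x0\<close> their
  densities are uniformly close to the claimed value.
  Hence the distribution function of \<open>\<mu>\<close> is differentiable there.
\<close>

section \<open>Contour integrals and complex orthogonal polynomials\<close>

text \<open>The \<open>N\<close>-step transfer matrix tends to a scalar matrix. The Turan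
  determinant pairs a vector with its image under that matrix, so its leading term cancels and the
  correction of order \<open>1 / a\<close> decides everything; hence one factor \<open>a\<close> in
  the coefficients of the form and a second one in \<open>scaled_turan\<close>. This correction has
  a limit only along residue classes modulo \<open>N\<close>, so convergence over all indices needs
  an extra argument: consecutive scaled determinants approach each other. Freezing the form makes
  contour integration possible: \<tau> has to be a constant for
  \<open>P (Suc n) - \<tau> * P n\<close> to be holomorphic, and \<open>Im \<tau> < 0\<close> keeps
  its zeros out of the closed upper half-plane. The square root of \<open>h\<close> is, up to the
  factor \<open>1 / (2 * \<bar>A\<bar>)\<close> with A the leading coefficient of the form, the
  imaginary part of its root. Each approximating measure has only finitely many moments, so
  convergence is proved for Stieltjes transforms and carried over to Lipschitz functions by Poisson
  smoothing.\<close>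

lemma half_plane_integral_tendsto:
  fixes f :: "complex \<Rightarrow> complex"
  assumes cont: "continuous_on {z. Im z \<ge> 0} f"
    and diff: "\<And>z. Im z > 0 \<Longrightarrow> f field_differentiable at z"
    and lim: "((\<lambda>z. z * f z) \<longlongrightarrow> L) at_infinity"
  shows "((\<lambda>R. integral {-R..R} (\<lambda>x. f (of_real x))) \<longlongrightarrow> - (\<i> * pi * L)) at_top"
proof (rule tendstoI)
  fix e :: real assume e: "e > 0"
  \<comment> \<open>The arc has parameter length pi, so an error below \<open>e'\<close> on it costs
    at most \<open>e / 2\<close>.\<close>
  define e' where "e' = e / (2 * pi)"
  have e': "e' > 0" using e by (simp add: e'_def)
  from tendstoD[OF lim e'] obtain B where B: "\<And>z. norm z \<ge> B \<Longrightarrow> dist (z * f z) L < e'"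
    unfolding eventually_at_infinity by auto
  show "\<forall>\<^sub>F R in at_top. dist (integral {-R..R} (\<lambda>x. f (of_real x))) (- (\<i> * pi * L)) < e"
    using eventually_ge_at_top[of "max B 1"]
  proof eventually_elim
    case (elim R)
    hence R: "R > 0" "R \<ge> B" by auto
    let ?S = "{z. Im z \<ge> 0}"
    let ?l = "linepath (complex_of_real (-R)) (complex_of_real R)"
    let ?c = "part_circlepath 0 R 0 pi"
    have conv: "convex ?S" by (rule convex_halfspace_Im_ge)
    have int: "interior ?S = {z. Im z > 0}"
      using interior_halfspace_ge[of "\<i>" 0] by simp
    have imc: "path_image ?c \<subseteq> ?S"
      using R by (auto simp: path_image_part_circlepath' closed_segment_eq_real_ivl intro!: mult_nonneg_nonneg sin_ge_zero)
    have iml: "path_image ?l \<subseteq> ?S"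
      by (simp add: closed_segment_subset conv)
    have pf: "pathfinish ?l = pathstart ?c" "pathfinish ?c = pathstart ?l"
      by (simp_all add: exp_Euler)
    \<comment> \<open>Continuity up to the boundary and differentiability in the open half-plane
      suffice for Cauchy's theorem on this convex set.\<close>
    have "(f has_contour_integral 0) (?l +++ ?c)"
      by (rule Cauchy_theorem_convex[OF cont conv, of "{}"])
         (use diff int imc iml pf in \<open>auto simp: path_image_join\<close>)
    moreover have il: "f contour_integrable_on ?l"
      by (intro contour_integrable_continuous_linepath continuous_on_subset[OF cont])
         (use iml in auto)
    moreover have ic: "f contour_integrable_on ?c"
      by (intro contour_integrable_continuous_part_circlepath continuous_on_subset[OF cont])
         (use imc in auto)
    ultimately have "contour_integral ?l f + contour_integral ?c f = 0"
      using pf by (metis contour_integral_join contour_integral_unique valid_path_linepath valid_path_part_circlepath)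
    moreover have "contour_integral ?l f = integral {-R..R} (\<lambda>x. f (of_real x))"
      using R by (subst contour_integral_linepath_Reals_eq) auto
    ultimately have eq: "integral {-R..R} (\<lambda>x. f (of_real x)) = - contour_integral ?c f"
      by (simp add: add_eq_0_iff)
    let ?h = "\<lambda>t. f (0 + R * cis t) * R * \<i> * cis t"
    have hi: "?h integrable_on {0..pi}"
      using ic contour_integrable_part_circlepath_iff[of 0 pi f 0 R] by simp
    have ch: "contour_integral ?c f = integral {0..pi} ?h"
      using contour_integral_part_circlepath_eq[of 0 pi 0 R f] by simp
    have ci: "integral {0..pi} (\<lambda>t. \<i> * L) = \<i> * pi * L"
      by (simp add: scaleR_conv_of_real)
    \<comment> \<open>On the arc, f(z) dz equals i z f(z) dt, so the limit of z f(z) compares the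
      integrand with the constant i L.\<close>
    have "contour_integral ?c f - \<i> * pi * L = integral {0..pi} (\<lambda>t. ?h t - \<i> * L)"
      using hi by (subst Henstock_Kurzweil_Integration.integral_diff) (auto simp: ch scaleR_conv_of_real)
    also have "norm \<dots> \<le> e' * (pi - 0)"
    proof (rule integral_bound)
      have hc: "continuous_on {0..pi} (\<lambda>t. f (0 + R * cis t))"
        by (rule continuous_on_compose2[OF cont]) (use R in \<open>auto intro!: continuous_intros mult_nonneg_nonneg sin_ge_zero\<close>)
      show "continuous_on {0..pi} (\<lambda>t. ?h t - \<i> * L)"
        using hc by (intro continuous_intros)
      fix t assume t: "t \<in> {0..pi}"
      have "?h t - \<i> * L = \<i> * (complex_of_real R * cis t * f (complex_of_real R * cis t) - L)"
        by (simp add: algebra_simps)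
      also have "norm \<dots> = dist (complex_of_real R * cis t * f (complex_of_real R * cis t)) L"
        by (simp add: norm_mult dist_norm)
      also have "\<dots> < e'"
        using R by (intro B) (simp add: norm_mult)
      finally show "norm (?h t - \<i> * L) \<le> e'" by simp
    qed simp
    also have "\<dots> < e" using e by (simp add: e'_def)
    finally have "norm (contour_integral ?c f - \<i> * pi * L) < e" .
    thus ?case unfolding eq by (simp add: dist_norm norm_minus_commute)
  qed
qed

section \<open>Orthogonal polynomials at complex arguments\<close>

fun cpoly :: "(nat \<Rightarrow> real) \<Rightarrow> (nat \<Rightarrow> real) \<Rightarrow> nat \<Rightarrow> complex \<Rightarrow> complex" where
  "cpoly a b 0 z = 1"
| "cpoly a b (Suc 0) z = (z - of_real (b 0)) / of_real (a 0)"
| "cpoly a b (Suc (Suc n)) z =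
     ((z - of_real (b (Suc n))) * cpoly a b (Suc n) z - of_real (a n) * cpoly a b n z) / of_real (a (Suc n))"

locale jacobi =
  fixes a b :: "nat \<Rightarrow> real"
  assumes a_pos: "\<And>n. a n > 0"
begin

abbreviation p :: "nat \<Rightarrow> real \<Rightarrow> real" where "p \<equiv> opoly a b"
abbreviation P :: "nat \<Rightarrow> complex \<Rightarrow> complex" where "P \<equiv> cpoly a b"

lemma a_nz [simp]: "a n \<noteq> 0"
  using a_pos[of n] by simp

lemma cpoly_of_real: "P n (of_real x) = of_real (p n x)"
  by (induction n rule: induct_nat_012) auto

lemma recurrence_0: "x * p 0 x = b 0 * p 0 x + a 0 * p 1 x"
  by simp

lemma recurrence_Suc: "x * p (Suc n) x = a n * p n x + b (Suc n) * p (Suc n) x + a (Suc n) * p (Suc (Suc n)) x"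
  by (simp add: field_simps)

lemma cpoly_recurrence_Suc:
  "z * P (Suc n) z = a n * P n z + b (Suc n) * P (Suc n) z + a (Suc n) * P (Suc (Suc n)) z"
  by (simp add: field_simps)

text \<open>The Christoffel-Darboux formula at z and its conjugate: multiply the recurrence by the
  conjugate of \<open>P (Suc n) z\<close> and take imaginary parts, where the real \<open>b\<close>
  drops out. It says that \<open>P (Suc n) / P n\<close> maps the upper half-plane to
  itself.\<close>

lemma Im_cpoly_cnj:
  "a n * Im (P (Suc n) z * cnj (P n z)) = Im z * (\<Sum>j\<le>n. (norm (P j z))\<^sup>2)"
proof (induction n)
  case 0
  show ?case by simp
next
  case (Suc n)
  have "a (Suc n) * P (Suc (Suc n)) z * cnj (P (Suc n) z)
      = (z - b (Suc n)) * (P (Suc n) z * cnj (P (Suc n) z)) - a n * (P n z * cnj (P (Suc n) z))"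
    by (simp add: field_simps)
  also have "P (Suc n) z * cnj (P (Suc n) z) = of_real ((norm (P (Suc n) z))\<^sup>2)"
    by (simp add: complex_norm_square[symmetric])
  finally have "a (Suc n) * Im (P (Suc (Suc n)) z * cnj (P (Suc n) z))
      = Im z * (norm (P (Suc n) z))\<^sup>2 - a n * Im (P n z * cnj (P (Suc n) z))"
    by (auto simp: complex_eq_iff algebra_simps simp del: cpoly.simps(3))
  also have "Im (P n z * cnj (P (Suc n) z)) = - Im (P (Suc n) z * cnj (P n z))"
    by (simp add: algebra_simps)
  finally show ?case using Suc.IH by (simp add: algebra_simps del: cpoly.simps(3))
qed

lemma cpoly_consecutive_nonzero: "P n z \<noteq> 0 \<or> P (Suc n) z \<noteq> 0"
proof (induction n)
  case 0 show ?case by simp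
next
  case (Suc n)
  show ?case
  proof (rule ccontr)
    assume "\<not> ?thesis"
    hence *: "P (Suc n) z = 0" "P (Suc (Suc n)) z = 0" by auto
    with cpoly_recurrence_Suc[of z n] have "P n z = 0" by simp
    with * Suc show False by auto
  qed
qed

lemma opoly_consecutive_nonzero: "p n x \<noteq> 0 \<or> p (Suc n) x \<noteq> 0"
  using cpoly_consecutive_nonzero[of n "of_real x"] unfolding cpoly_of_real by auto

lemma continuous_opoly [continuous_intros]: "continuous_on S (p n)"
proof (induction n rule: induct_nat_012)
  case 0 show ?case by simp
next
  case 1 show ?case by (auto intro!: continuous_intros)
next
  case (ge2 n)
  have "p (Suc (Suc n)) = (\<lambda>x. ((x - b (Suc n)) * p (Suc n) x - a n * p n x) / a (Suc n))" by auto
  then show ?case using ge2 by (auto intro!: continuous_intros)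
qed

lemma opoly_measurable [measurable]: "p n \<in> borel_measurable borel"
  using continuous_opoly[of UNIV n] by (rule borel_measurable_continuous_onI)

lemma cpoly_holomorphic: "P n holomorphic_on S"
proof (induction n rule: induct_nat_012)
  case 0 show ?case by simp
next
  case 1 
  have "P (Suc 0) = (\<lambda>z. (z - of_real (b 0)) / of_real (a 0))" by auto
  then show ?case by (auto intro!: holomorphic_intros)
next
  case (ge2 n)
  have "P (Suc (Suc n)) = (\<lambda>z. ((z - of_real (b (Suc n))) * P (Suc n) z - of_real (a n) * P n z) / of_real (a (Suc n)))" by auto
  then show ?case using ge2 by (auto intro!: holomorphic_intros)
qed

lemma cpoly_leading_coeff: "((\<lambda>z. P n z / z ^ n) \<longlongrightarrow> of_real (1 / (\<Prod>j<n. a j))) at_infinity"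
proof (induction n rule: induct_nat_012)
  case 0 show ?case by simp
next
  case 1
  have "((\<lambda>z. (1 - of_real (b 0) * inverse z) / of_real (a 0)) \<longlongrightarrow> (1 - of_real (b 0) * 0) / complex_of_real (a 0)) at_infinity"
    by (intro tendsto_intros tendsto_inverse_0) auto
  moreover have "eventually (\<lambda>z. (1 - of_real (b 0) * inverse z) / of_real (a 0) = P (Suc 0) z / z ^ Suc 0) at_infinity"
    using eventually_not_equal_at_infinity[of 0] by eventually_elim (auto simp: field_simps)
  ultimately show ?case by (simp add: tendsto_cong)
next
  case (ge2 n)
  let ?f = "\<lambda>z. ((1 - of_real (b (Suc n)) * inverse z) * (P (Suc n) z / z ^ Suc n)
              - of_real (a n) * (inverse z * inverse z) * (P n z / z ^ n)) / of_real (a (Suc n))"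
  have "(?f \<longlongrightarrow> ((1 - of_real (b (Suc n)) * 0) * of_real (1 / (\<Prod>j<Suc n. a j))
          - of_real (a n) * (0 * 0) * of_real (1 / (\<Prod>j<n. a j))) / complex_of_real (a (Suc n))) at_infinity"
    by (intro tendsto_intros tendsto_inverse_0 ge2.IH) auto
  moreover have "eventually (\<lambda>z. ?f z = P (Suc (Suc n)) z / z ^ Suc (Suc n)) at_infinity"
    using eventually_not_equal_at_infinity[of 0]
  proof eventually_elim
    case (elim z)
    have "complex_of_real (a (Suc n)) \<noteq> 0" by simp
    with elim show ?case by (simp add: field_simps)
  qed
  ultimately show ?case by (simp add: tendsto_cong)
qed

end

section \<open>Rational approximations of the orthogonality measure\<close>

lemma integrable_inverse_one_plus_square: "integrable lborel (\<lambda>x::real. inverse (1 + x\<^sup>2))"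
  using integrable_inverse_1_plus_square by (simp add: set_integrable_def)

text \<open>Contour integration yields limits over symmetric intervals; this identifies them with
  Lebesgue integrals.\<close>

lemma integral_symmetric_tendsto:
  fixes f :: "real \<Rightarrow> real"
  assumes f: "integrable lborel f"
  shows "((\<lambda>R. integral {-R..R} f) \<longlongrightarrow> (\<integral>x. f x \<partial>lborel)) at_top"
proof -
  have "((\<lambda>R. \<integral>x. indicator {-R..R} x *\<^sub>R f x \<partial>lborel) \<longlongrightarrow> (\<integral>x. f x \<partial>lborel)) at_top"
  proof (rule integral_dominated_convergence_at_top[where w = "\<lambda>x. norm (f x)"])
    show "AE x in lborel. ((\<lambda>R. indicator {-R..R} x *\<^sub>R f x) \<longlongrightarrow> f x) at_top"
    proof (rule AE_I2, rule tendsto_eventually)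
      fix x :: real
      show "\<forall>\<^sub>F R in at_top. indicator {-R..R} x *\<^sub>R f x = f x"
        using eventually_ge_at_top[of "\<bar>x\<bar>"] by eventually_elim (auto simp: indicator_def)
    qed
  qed (use f in \<open>auto simp: indicator_def\<close>)
  moreover have "(\<integral>x. indicator {-R..R} x *\<^sub>R f x \<partial>lborel) = integral {-R..R} f" for R
  proof -
    have "set_integrable lborel {-R..R} f"
      using f unfolding set_integrable_def by (intro integrable_mult_indicator) auto
    from set_borel_integral_eq_integral(2)[OF this] show ?thesis
      by (simp add: set_lebesgue_integral_def)
  qed
  ultimately show ?thesis by simp
qed

lemma bounded_of_continuous_tendsto_at_infinity:
  fixes f :: "real \<Rightarrow> real"
  assumes c: "continuous_on UNIV f" and lim: "(f \<longlongrightarrow> l) at_infinity"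
  shows "\<exists>C. \<forall>x. \<bar>f x\<bar> \<le> C"
proof -
  from tendstoD[OF lim zero_less_one] obtain B where B: "\<And>x. \<bar>x\<bar> \<ge> B \<Longrightarrow> dist (f x) l < 1"
    unfolding eventually_at_infinity by auto
  have "compact (f ` {-B..B})"
    by (intro compact_continuous_image continuous_on_subset[OF c]) auto
  then obtain C where C: "\<And>x. x \<in> {-B..B} \<Longrightarrow> \<bar>f x\<bar> \<le> C"
    using compact_imp_bounded[THEN bounded_iff[THEN iffD1]] by (metis image_eqI real_norm_def)
  have "\<bar>f x\<bar> \<le> max C (\<bar>l\<bar> + 1)" for x
  proof (cases "x \<in> {-B..B}")
    case False
    then have "dist (f x) l < 1" by (intro B) auto
    then show ?thesis by (auto simp: dist_real_def)
  qed (use C[of x] in auto)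
  then show ?thesis by blast
qed

context jacobi
begin

text \<open>One shape of the recurrence for all indices: at \<open>i = 0\<close> the truncated
  \<open>i - 1\<close> is 0 again and \<open>c\<close> is 0.\<close>

lemma times_opoly_expand:
  obtains c where "\<And>x. x * p i x = a i * p (Suc i) x + b i * p i x + c * p (i - 1) x"
proof (cases i)
  case 0
  then show ?thesis using that[of 0] by simp
next
  case (Suc j)
  then show ?thesis using that[of "a j"] recurrence_Suc[of _ j] by (simp del: opoly.simps(3))
qed

text \<open>The recurrence read backwards: the two top rows of the Gram matrix determine all lower
  ones. The pair \<open>p (Suc n)\<close>, \<open>p n\<close> is left out on purpose: under the
  measures defined below its product behaves like 1 / x at infinity.\<close>

lemma orthonormal_downward:
  fixes M :: "real measure"
  assumes int: "\<And>i j. i \<le> n \<Longrightarrow> j \<le> n \<Longrightarrow> integrable M (\<lambda>x. p i x * p j x)"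
    and int': "\<And>i. i < n \<Longrightarrow> integrable M (\<lambda>x. p (Suc n) x * p i x)"
    and top: "\<And>i. i < n \<Longrightarrow> (\<integral>x. p n x * p i x \<partial>M) = 0"
    and top': "\<And>i. i < n \<Longrightarrow> (\<integral>x. p (Suc n) x * p i x \<partial>M) = 0"
    and nrm: "(\<integral>x. p n x * p n x \<partial>M) = 1"
    and ij: "i \<le> n" "j \<le> n"
  shows "(\<integral>x. p i x * p j x \<partial>M) = (if i = j then 1 else 0)"
proof -
  have main: "(\<forall>i\<le>m. (\<integral>x. p m x * p i x \<partial>M) = (if i = m then 1 else 0)) \<and>
      (\<forall>i<m. integrable M (\<lambda>x. p (Suc m) x * p i x) \<and> (\<integral>x. p (Suc m) x * p i x \<partial>M) = 0)" if "m \<le> n" for m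
    using that
  proof (induction rule: inc_induct)
    case base
    show ?case using top top' nrm int' by (auto simp: le_less)
  next
    case (step m)
    then have mn: "Suc m \<le> n" by simp
    have 1: "(\<integral>x. p m x * p i x \<partial>M) = (if i = m then 1 else 0)" if i: "i \<le> m" for i
    proof -
      obtain c where c: "\<And>x. x * p i x = a i * p (Suc i) x + b i * p i x + c * p (i - 1) x"
        by (rule times_opoly_expand[of i]) blast
      \<comment> \<open>Solve the recurrence for \<open>p m\<close>, then move the factor x over to
        \<open>p i\<close>. For \<open>i = m\<close> the term with \<open>p (Suc i)\<close> supplies
        the norm of the row above.\<close>
      have eq: "a m * (p m x * p i x) = a i * (p (Suc m) x * p (Suc i) x) + b i * (p (Suc m) x * p i x)
           + c * (p (Suc m) x * p (i - 1) x) - b (Suc m) * (p (Suc m) x * p i x)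
           - a (Suc m) * (p (Suc (Suc m)) x * p i x)" for x
      proof -
        have "a m * (p m x * p i x) = p (Suc m) x * (x * p i x) - b (Suc m) * (p (Suc m) x * p i x)
           - a (Suc m) * (p (Suc (Suc m)) x * p i x)"
        proof -
          have "a m * p m x = x * p (Suc m) x - b (Suc m) * p (Suc m) x - a (Suc m) * p (Suc (Suc m)) x"
            using recurrence_Suc[of x m] by linarith
          then have "a m * p m x * p i x = (x * p (Suc m) x - b (Suc m) * p (Suc m) x - a (Suc m) * p (Suc (Suc m)) x) * p i x"
            by simp
          then show ?thesis by (simp add: algebra_simps del: opoly.simps(3))
        qed
        then show ?thesis unfolding c by (simp add: algebra_simps del: opoly.simps(3))
      qed
      have I: "integrable M (\<lambda>x. p (Suc m) x * p (Suc i) x)" "integrable M (\<lambda>x. p (Suc m) x * p i x)"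
        "integrable M (\<lambda>x. p (Suc m) x * p (i - 1) x)" "integrable M (\<lambda>x. p (Suc (Suc m)) x * p i x)"
        using int mn i step.IH by (auto simp del: opoly.simps(3))
      have z: "(\<integral>x. p (Suc m) x * p i x \<partial>M) = 0" "(\<integral>x. p (Suc m) x * p (i - 1) x \<partial>M) = 0"
           "(\<integral>x. p (Suc (Suc m)) x * p i x \<partial>M) = 0" "(\<integral>x. p (Suc m) x * p (Suc i) x \<partial>M) = (if i = m then 1 else 0)"
        using step.IH i by (auto simp del: opoly.simps(3))
      have "a m * (\<integral>x. p m x * p i x \<partial>M) = (\<integral>x. a m * (p m x * p i x) \<partial>M)" by simp
      also have "\<dots> = a i * (\<integral>x. p (Suc m) x * p (Suc i) x \<partial>M) + b i * (\<integral>x. p (Suc m) x * p i x \<partial>M)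
           + c * (\<integral>x. p (Suc m) x * p (i - 1) x \<partial>M) - b (Suc m) * (\<integral>x. p (Suc m) x * p i x \<partial>M)
           - a (Suc m) * (\<integral>x. p (Suc (Suc m)) x * p i x \<partial>M)"
        unfolding eq using I by (simp del: opoly.simps(3))
      also have "\<dots> = a m * (if i = m then 1 else 0)" unfolding z by simp
      finally show ?thesis by simp
    qed
    show ?case using 1 step.IH int mn by (auto simp del: opoly.simps(3))
  qed
  show ?thesis
  proof (cases "j \<le> i")
    case True
    then show ?thesis using main[of i] ij by auto
  next
    case False
    then have "(\<integral>x. p j x * p i x \<partial>M) = 0" using main[of j] ij by auto
    then show ?thesis using False by (simp add: mult.commute)
  qed
qed

text \<open>The denominator is \<open>\<bar>p (n + 1) - \<tau> * p n\<bar>\<^sup>2\<close> on the real line.\<close>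

definition carmona_den :: "nat \<Rightarrow> complex \<Rightarrow> real \<Rightarrow> real" where
  "carmona_den n \<tau> x = (p (Suc n) x - Re \<tau> * p n x)\<^sup>2 + (Im \<tau> * p n x)\<^sup>2"

text \<open>A measure of Bernstein-Szego type. The constant is dictated by
  \<open>integral_pn\<close>, which gives \<open>p n\<close> norm 1.\<close>

definition carmona_measure :: "nat \<Rightarrow> complex \<Rightarrow> real measure" where
  "carmona_measure n \<tau> = density lborel (\<lambda>x. - Im \<tau> / (pi * a n * carmona_den n \<tau> x))"

context
  fixes n :: nat and \<tau> :: complex
  assumes Im_neg: "Im \<tau> < 0"
begin

lemma carmona_den_pos: "carmona_den n \<tau> x > 0"
proof (cases "p n x = 0")
  case True
  then have "p (Suc n) x \<noteq> 0" using opoly_consecutive_nonzero[of n x] by auto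
  then show ?thesis using True by (simp add: carmona_den_def)
next
  case False
  then have "(Im \<tau> * p n x)\<^sup>2 > 0" using Im_neg by simp
  then show ?thesis unfolding carmona_den_def by (meson add_nonneg_pos zero_le_power2)
qed

private definition G where "G z = P (Suc n) z - \<tau> * P n z"

text \<open>A zero would make \<open>P (Suc n) z / P n z\<close> equal to \<tau>, which lies in the
  lower half-plane, against the sign in \<open>Im_cpoly_cnj\<close>.\<close>

private lemma G_nonzero: assumes "Im z \<ge> 0" shows "G z \<noteq> 0"
proof
  assume "G z = 0"
  then have eq: "P (Suc n) z = \<tau> * P n z" by (simp add: G_def)
  then have nz: "P n z \<noteq> 0" using cpoly_consecutive_nonzero[of n z] by auto
  have "P (Suc n) z * cnj (P n z) = \<tau> * of_real ((norm (P n z))\<^sup>2)"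
    unfolding eq complex_norm_square by simp
  then have "Im (P (Suc n) z * cnj (P n z)) = Im \<tau> * (norm (P n z))\<^sup>2" by simp
  also have "\<dots> < 0" using Im_neg nz by (simp add: mult_neg_pos)
  finally have "a n * Im (P (Suc n) z * cnj (P n z)) < 0" using a_pos[of n] by (simp add: mult_pos_neg)
  moreover have "a n * Im (P (Suc n) z * cnj (P n z)) \<ge> 0"
    unfolding Im_cpoly_cnj using assms by (intro mult_nonneg_nonneg sum_nonneg) auto
  ultimately show False by simp
qed

private lemma G_holo: "G holomorphic_on S"
  unfolding G_def by (intro holomorphic_intros cpoly_holomorphic)

text \<open>Degree count: the quotient decays like z to the power \<open>i - n - 1\<close>, and for
  \<open>i = n\<close> the leading coefficients leave exactly \<open>a n\<close>.\<close>

private lemma ratio_tendsto: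
  assumes i: "i \<le> n"
  shows "((\<lambda>z. z * (P i z / G z)) \<longlongrightarrow> (if i = n then of_real (a n) else 0)) at_infinity"
proof -
  have G: "((\<lambda>z. P (Suc n) z / z ^ Suc n - \<tau> * inverse z * (P n z / z ^ n)) \<longlongrightarrow>
      of_real (1 / (\<Prod>j<Suc n. a j)) - \<tau> * 0 * of_real (1 / (\<Prod>j<n. a j))) at_infinity"
    by (intro tendsto_intros tendsto_inverse_0 cpoly_leading_coeff)
  have "((\<lambda>z::complex. inverse z ^ (n - i)) \<longlongrightarrow> 0 ^ (n - i)) at_infinity"
    by (intro tendsto_intros tendsto_inverse_0)
  from tendsto_divide[OF tendsto_mult[OF this cpoly_leading_coeff[of i]] G]
  have "((\<lambda>z. inverse z ^ (n - i) * (P i z / z ^ i) / (P (Suc n) z / z ^ Suc n - \<tau> * inverse z * (P n z / z ^ n)))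
     \<longlongrightarrow> 0 ^ (n - i) * of_real (1 / (\<Prod>j<i. a j)) / of_real (1 / (\<Prod>j<Suc n. a j))) at_infinity"
    by simp
  also have "0 ^ (n - i) * complex_of_real (1 / (\<Prod>j<i. a j)) / of_real (1 / (\<Prod>j<Suc n. a j))
      = (if i = n then of_real (a n) else 0)"
    using i by (auto simp: power_0_left)
  finally have "((\<lambda>z. inverse z ^ (n - i) * (P i z / z ^ i) / (P (Suc n) z / z ^ Suc n - \<tau> * inverse z * (P n z / z ^ n)))
     \<longlongrightarrow> (if i = n then of_real (a n) else 0)) at_infinity" .
  moreover have "eventually (\<lambda>z. inverse z ^ (n - i) * (P i z / z ^ i) / (P (Suc n) z / z ^ Suc n - \<tau> * inverse z * (P n z / z ^ n))
      = z * (P i z / G z)) at_infinity"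
    using eventually_not_equal_at_infinity[of 0]
  proof eventually_elim
    case (elim z)
    have "P (Suc n) z / z ^ Suc n - \<tau> * inverse z * (P n z / z ^ n) = G z / z ^ Suc n"
      using elim by (simp add: G_def field_simps del: cpoly.simps)
    moreover have "inverse z ^ (n - i) * (P i z / z ^ i) = P i z / z ^ n"
    proof -
      have "z ^ n = z ^ (n - i) * z ^ i" using i by (simp flip: power_add)
      then show ?thesis using elim by (simp add: power_inverse field_simps)
    qed
    ultimately show ?case using elim by simp
  qed
  ultimately show ?thesis by (simp add: tendsto_cong)
qed

private definition f where "f i x = P i (of_real x) / G (of_real x)"

private lemma G_real: "G (of_real x) = Complex (p (Suc n) x - Re \<tau> * p n x) (- Im \<tau> * p n x)"
  unfolding G_def cpoly_of_real by (simp add: complex_eq_iff)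

private lemma norm_G: "(norm (G (of_real x)))\<^sup>2 = carmona_den n \<tau> x"
  unfolding G_real carmona_den_def by (simp add: cmod_power2)

private lemma Im_f: "Im (f i x) = Im \<tau> * (p n x * p i x / carmona_den n \<tau> x)"
  unfolding f_def cpoly_of_real Im_divide cmod_power2[symmetric] norm_G by (simp add: G_real)

private lemma Re_f: "Re (f i x) = p (Suc n) x * p i x / carmona_den n \<tau> x - Re \<tau> * (p n x * p i x / carmona_den n \<tau> x)"
  unfolding f_def cpoly_of_real Re_divide cmod_power2[symmetric] norm_G
  by (simp add: G_real diff_divide_distrib right_diff_distrib mult_ac del: opoly.simps)

private lemma f_cont: "continuous_on UNIV (f i)"
  unfolding f_def
  by (intro continuous_intros continuous_on_compose2[OF holomorphic_on_imp_continuous_on[OF cpoly_holomorphic[of i UNIV]]]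
      continuous_on_compose2[OF holomorphic_on_imp_continuous_on[OF G_holo[of UNIV]]])
     (auto simp: G_nonzero)

private lemma f_integral:
  assumes i: "i \<le> n"
  shows "((\<lambda>R. integral {-R..R} (f i)) \<longlongrightarrow> - (\<i> * pi * (if i = n then of_real (a n) else 0))) at_top"
  unfolding f_def
proof (rule half_plane_integral_tendsto)
  show "continuous_on {z. 0 \<le> Im z} (\<lambda>z. P i z / G z)"
    by (intro continuous_intros holomorphic_on_imp_continuous_on cpoly_holomorphic G_holo) (auto simp: G_nonzero)
  show "(\<lambda>z. P i z / G z) field_differentiable at z" if "0 < Im z" for z
    using that cpoly_holomorphic[of i UNIV] G_holo[of UNIV] G_nonzero[of z]
    by (intro field_differentiable_divide) (auto simp: holomorphic_on_def)
qed (rule ratio_tendsto[OF i])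

text \<open>Decay like 1 / |x|, phrased with a square root so that the product of two such bounds is
  a multiple of the integrable \<open>inverse (1 + x\<^sup>2)\<close>.\<close>

private lemma f_bound:
  assumes i: "i \<le> n"
  shows "\<exists>C\<ge>0. \<forall>x. norm (f i x) \<le> C * sqrt (inverse (1 + x\<^sup>2))"
proof -
  have inf: "filterlim complex_of_real at_infinity at_infinity"
    using filterlim_norm_at_top[where 'a = real]
      by (simp add: filterlim_at_infinity_conv_norm_at_top real_norm_def[abs_def])
  let ?l = "norm (if i = n then complex_of_real (a n) else 0)"
  have "((\<lambda>x. norm (of_real x * f i x)) \<longlongrightarrow> ?l) at_infinity"
    using filterlim_compose[OF tendsto_norm[OF ratio_tendsto[OF i]] inf]
    by (simp add: f_def)
  moreover have "continuous_on UNIV (\<lambda>x. norm (of_real x * f i x))"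
    by (intro continuous_intros f_cont)
  ultimately obtain C1 where C1: "\<And>x. \<bar>norm (of_real x * f i x)\<bar> \<le> C1"
    using bounded_of_continuous_tendsto_at_infinity by blast
  have "bounded (f i ` {-1..1})"
    by (intro compact_imp_bounded compact_continuous_image continuous_on_subset[OF f_cont]) auto
  then obtain C0 where C0: "\<And>x. x \<in> {-1..1} \<Longrightarrow> norm (f i x) \<le> C0"
    unfolding bounded_iff by blast
  define C where "C = max C0 C1"
  have C_nn: "C \<ge> 0" unfolding C_def using C1[of 0] by (simp add: le_max_iff_disj)
  have *: "max 1 \<bar>x\<bar> * norm (f i x) \<le> C" for x
  proof (cases "\<bar>x\<bar> \<le> 1")
    case True
    then have "norm (f i x) \<le> C0" by (intro C0) auto
    then show ?thesis using True by (simp add: C_def)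
  next
    case False then show ?thesis using C1[of x] by (simp add: C_def norm_mult)
  qed
  have "norm (f i x) \<le> (2 * C) * sqrt (inverse (1 + x\<^sup>2))" for x
  proof -
    have "sqrt (1 + x\<^sup>2) \<le> 1 + \<bar>x\<bar>" by (rule real_le_lsqrt) (auto simp: power2_sum)
    also have "\<dots> \<le> 2 * max 1 \<bar>x\<bar>" by (simp add: max_def)
    finally have "sqrt (1 + x\<^sup>2) * norm (f i x) \<le> 2 * max 1 \<bar>x\<bar> * norm (f i x)"
      by (intro mult_right_mono) auto
    also have "\<dots> \<le> 2 * C" using *[of x] by simp
    finally have "norm (f i x) * sqrt (1 + x\<^sup>2) \<le> 2 * C" by (simp add: mult.commute)
    moreover have "sqrt (1 + x\<^sup>2) > 0" by (simp add: add_pos_nonneg)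
    ultimately have "norm (f i x) \<le> 2 * C / sqrt (1 + x\<^sup>2)" by (simp add: pos_le_divide_eq)
    then show ?thesis by (simp add: real_sqrt_inverse divide_inverse)
  qed
  then show ?thesis using C_nn by (intro exI[of _ "2 * C"]) auto
qed

private lemma den_cont: "continuous_on UNIV (carmona_den n \<tau>)"
  unfolding carmona_den_def[abs_def] by (intro continuous_intros)

lemma carmona_den_measurable [measurable]: "carmona_den n \<tau> \<in> borel_measurable borel"
  by (rule borel_measurable_continuous_onI[OF den_cont])

private lemma int_pp:
  assumes ij: "i \<le> n" "j \<le> n"
  shows "integrable lborel (\<lambda>x. p i x * p j x / carmona_den n \<tau> x)"
proof -
  obtain C D where C: "C \<ge> 0" "\<And>x. norm (f i x) \<le> C * sqrt (inverse (1 + x\<^sup>2))"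
    and D: "D \<ge> 0" "\<And>x. norm (f j x) \<le> D * sqrt (inverse (1 + x\<^sup>2))"
    using f_bound[OF ij(1)] f_bound[OF ij(2)] by blast
  have "integrable lborel (\<lambda>x. C * D * inverse (1 + x\<^sup>2))"
    by (intro integrable_mult_right integrable_inverse_one_plus_square)
  then show ?thesis
  proof (rule Bochner_Integration.integrable_bound)
    show "AE x in lborel. norm (p i x * p j x / carmona_den n \<tau> x) \<le> norm (C * D * inverse (1 + x\<^sup>2))"
    proof (rule AE_I2)
      fix x :: real
      have "norm (p i x * p j x / carmona_den n \<tau> x) = norm (f i x) * norm (f j x)"
        using carmona_den_pos[of x]
        by (simp add: f_def norm_divide cpoly_of_real abs_mult norm_G[symmetric] power2_eq_square)
      also have "\<dots> \<le> (C * sqrt (inverse (1 + x\<^sup>2))) * (D * sqrt (inverse (1 + x\<^sup>2)))"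
        using C D by (intro mult_mono) auto
      also have "\<dots> = C * D * (sqrt (inverse (1 + x\<^sup>2)))\<^sup>2" by (simp add: power2_eq_square)
      also have "\<dots> = C * D * inverse (1 + x\<^sup>2)" by (subst real_sqrt_pow2) auto
      also have "\<dots> \<le> norm (C * D * inverse (1 + x\<^sup>2))" unfolding real_norm_def by (rule abs_ge_self)
      finally show "norm (p i x * p j x / carmona_den n \<tau> x) \<le> norm (C * D * inverse (1 + x\<^sup>2))" .
    qed
  qed measurable
qed

text \<open>\<open>p (Suc n)\<close> is traded for x times \<open>p n\<close>, and x is absorbed by
  \<open>p i\<close>, raising its index to \<open>Suc i\<close>; \<open>i < n\<close> keeps all
  resulting indices at most \<open>n\<close>.\<close>

private lemma int_p_Suc:
  assumes i: "i < n"
  shows "integrable lborel (\<lambda>x. p (Suc n) x * p i x / carmona_den n \<tau> x)"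
proof -
  obtain c where c: "\<And>x. x * p i x = a i * p (Suc i) x + b i * p i x + c * p (i - 1) x"
    by (rule times_opoly_expand[of i]) blast
  obtain d where d: "\<And>x. x * p n x = a n * p (Suc n) x + b n * p n x + d * p (n - 1) x"
    by (rule times_opoly_expand[of n]) blast
  have eq: "p (Suc n) x * p i x / carmona_den n \<tau> x =
     (1 / a n) * (a i * (p n x * p (Suc i) x / carmona_den n \<tau> x) + b i * (p n x * p i x / carmona_den n \<tau> x)
       + c * (p n x * p (i - 1) x / carmona_den n \<tau> x) - b n * (p n x * p i x / carmona_den n \<tau> x)
       - d * (p (n - 1) x * p i x / carmona_den n \<tau> x))" for x
  proof -
    have "a n * (p (Suc n) x * p i x) = p n x * (x * p i x) - b n * (p n x * p i x) - d * (p (n - 1) x * p i x)"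
    proof -
      have "a n * p (Suc n) x = x * p n x - b n * p n x - d * p (n - 1) x"
        using d[of x] by linarith
      then have "a n * p (Suc n) x * p i x = (x * p n x - b n * p n x - d * p (n - 1) x) * p i x"
        by simp
      then show ?thesis by (simp add: algebra_simps)
    qed
    then have "p (Suc n) x * p i x = (1 / a n) * (a i * (p n x * p (Suc i) x) + b i * (p n x * p i x)
       + c * (p n x * p (i - 1) x) - b n * (p n x * p i x) - d * (p (n - 1) x * p i x))"
      unfolding c by (simp add: field_simps)
    then show ?thesis
      by (simp only: times_divide_eq_right add_divide_distrib[symmetric] diff_divide_distrib[symmetric])
  qed
  show ?thesis unfolding eq
    using i by (intro integrable_mult_right Bochner_Integration.integrable_add
         Bochner_Integration.integrable_diff int_pp) auto
qed

private lemma f_integrable_on: "f i integrable_on {-R..R}"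
  by (intro integrable_continuous_real continuous_on_subset[OF f_cont]) auto

private lemma integral_pn:
  assumes i: "i \<le> n"
  shows "(\<integral>x. p n x * p i x / carmona_den n \<tau> x \<partial>lborel) = (if i = n then - (pi * a n / Im \<tau>) else 0)"
proof -
  let ?g = "\<lambda>x. p n x * p i x / carmona_den n \<tau> x"
  have "((\<lambda>R. integral {-R..R} (\<lambda>x. Im \<tau> * ?g x)) \<longlongrightarrow> (\<integral>x. Im \<tau> * ?g x \<partial>lborel)) at_top"
    using int_pp[OF order.refl i] by (intro integral_symmetric_tendsto integrable_mult_right)
  moreover have "((\<lambda>R. Im (integral {-R..R} (f i))) \<longlongrightarrow> Im (- (\<i> * pi * (if i = n then of_real (a n) else 0)))) at_top"
    by (intro tendsto_Im f_integral i)
  moreover have "Im (integral {-R..R} (f i)) = integral {-R..R} (\<lambda>x. Im \<tau> * ?g x)" for R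
    using integral_linear[OF f_integrable_on[of i R] bounded_linear_Im] by (simp add: o_def Im_f)
  ultimately have "(\<integral>x. Im \<tau> * ?g x \<partial>lborel) = Im (- (\<i> * pi * (if i = n then of_real (a n) else 0)))"
    using tendsto_unique[OF trivial_limit_at_top_linorder] by force
  then have "Im \<tau> * (\<integral>x. ?g x \<partial>lborel) = (if i = n then - (pi * a n) else 0)"
    by (auto split: if_splits simp del: times_divide_eq_right)
  then show ?thesis using Im_neg by (auto simp: field_simps split: if_splits)
qed

text \<open>The real part also contains \<open>Re \<tau>\<close> times the products with
  \<open>p n\<close>, whose integral vanishes for \<open>i < n\<close> by
  \<open>integral_pn\<close>.\<close>

private lemma integral_p_Suc:
  assumes i: "i < n"
  shows "(\<integral>x. p (Suc n) x * p i x / carmona_den n \<tau> x \<partial>lborel) = 0"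
proof -
  let ?g = "\<lambda>x. p (Suc n) x * p i x / carmona_den n \<tau> x"
  let ?k = "\<lambda>x. p n x * p i x / carmona_den n \<tau> x"
  have int: "integrable lborel ?g" "integrable lborel (\<lambda>x. Re \<tau> * ?k x)"
    using int_pp[of n i] int_p_Suc[OF i] i by (auto simp del: times_divide_eq_right)
  have "((\<lambda>R. integral {-R..R} (\<lambda>x. ?g x - Re \<tau> * ?k x)) \<longlongrightarrow> (\<integral>x. ?g x - Re \<tau> * ?k x \<partial>lborel)) at_top"
    using int by (intro integral_symmetric_tendsto Bochner_Integration.integrable_diff)
  moreover have "((\<lambda>R. Re (integral {-R..R} (f i))) \<longlongrightarrow> Re (- (\<i> * pi * (if i = n then of_real (a n) else 0)))) at_top"
    using i by (intro tendsto_Re f_integral) auto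
  moreover have "Re (integral {-R..R} (f i)) = integral {-R..R} (\<lambda>x. ?g x - Re \<tau> * ?k x)" for R
    using integral_linear[OF f_integrable_on[of i R] bounded_linear_Re] by (simp add: o_def Re_f)
  ultimately have "(\<integral>x. ?g x - Re \<tau> * ?k x \<partial>lborel) = Re (- (\<i> * pi * (if i = n then of_real (a n) else 0)))"
    using tendsto_unique[OF trivial_limit_at_top_linorder] by force
  also have "\<dots> = 0" using i by simp
  finally have "(\<integral>x. ?g x \<partial>lborel) - Re \<tau> * (\<integral>x. ?k x \<partial>lborel) = 0"
    using int by (simp del: times_divide_eq_right)
  then show ?thesis using integral_pn[of i] i by simp
qed

lemma carmona_density_nonneg: "- Im \<tau> / (pi * a n * carmona_den n \<tau> x) \<ge> 0"
  using Im_neg a_pos[of n] carmona_den_pos[of x] by (intro divide_nonneg_nonneg mult_nonneg_nonneg) auto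

lemma
  fixes g :: "real \<Rightarrow> real"
  assumes [measurable]: "g \<in> borel_measurable borel"
  shows integrable_carmona: "integrable (carmona_measure n \<tau>) g \<longleftrightarrow>
        integrable lborel (\<lambda>x. - Im \<tau> / (pi * a n * carmona_den n \<tau> x) * g x)"
    and integral_carmona: "(\<integral>x. g x \<partial>carmona_measure n \<tau>) =
        (\<integral>x. - Im \<tau> / (pi * a n * carmona_den n \<tau> x) * g x \<partial>lborel)"
proof -
  let ?d = "\<lambda>x. - Im \<tau> / (pi * a n * carmona_den n \<tau> x)"
  have nn: "AE x in lborel. 0 \<le> ?d x" using carmona_density_nonneg by simp
  have d: "?d \<in> borel_measurable lborel" and g: "g \<in> borel_measurable lborel" by measurable
  show "integrable (carmona_measure n \<tau>) g \<longleftrightarrow> integrable lborel (\<lambda>x. ?d x * g x)"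
    unfolding carmona_measure_def using integrable_density[OF g d nn] by (simp only: real_scaleR_def)
  show "(\<integral>x. g x \<partial>carmona_measure n \<tau>) = (\<integral>x. ?d x * g x \<partial>lborel)"
    unfolding carmona_measure_def using integral_density[OF g d nn] by (simp only: real_scaleR_def)
qed

text \<open>Contour integration supplies the rows \<open>n\<close> and \<open>Suc n\<close>;
  \<open>orthonormal_downward\<close> does the rest.\<close>

lemma carmona_orthonormal:
  assumes ij: "i \<le> n" "j \<le> n"
  shows "integrable (carmona_measure n \<tau>) (\<lambda>x. p i x * p j x)"
    and "(\<integral>x. p i x * p j x \<partial>carmona_measure n \<tau>) = (if i = j then 1 else 0)"
proof -
  let ?M = "carmona_measure n \<tau>" and ?c = "- Im \<tau> / (pi * a n)"
  have r: "- Im \<tau> / (pi * a n * carmona_den n \<tau> x) * g = ?c * (g / carmona_den n \<tau> x)" for x g by simp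
  have m [measurable]: "(\<lambda>x. p i x * p j x) \<in> borel_measurable borel" for i j by measurable
  have I: "integrable ?M (\<lambda>x. p i x * p j x)" if "i \<le> n" "j \<le> n" for i j
    unfolding integrable_carmona[OF m] r by (intro integrable_mult_right int_pp that)
  show "integrable ?M (\<lambda>x. p i x * p j x)" by (rule I[OF ij])
  have eq: "(\<integral>x. p i x * p j x \<partial>?M) = ?c * (\<integral>x. p i x * p j x / carmona_den n \<tau> x \<partial>lborel)" for i j
    unfolding integral_carmona[OF m] r by (rule integral_mult_right_zero)
  show "(\<integral>x. p i x * p j x \<partial>?M) = (if i = j then 1 else 0)"
  proof (rule orthonormal_downward[OF _ _ _ _ _ ij])
    show "integrable ?M (\<lambda>x. p i x * p j x)" if "i \<le> n" "j \<le> n" for i j by (rule I[OF that])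
    show "integrable ?M (\<lambda>x. p (Suc n) x * p i x)" if "i < n" for i
      unfolding integrable_carmona[OF m] r by (intro integrable_mult_right int_p_Suc that)
    show "(\<integral>x. p n x * p i x \<partial>?M) = 0" if "i < n" for i
      using that integral_pn[of i] unfolding eq by simp
    show "(\<integral>x. p (Suc n) x * p i x \<partial>?M) = 0" if "i < n" for i
      using integral_p_Suc[OF that] unfolding eq by simp
    show "(\<integral>x. p n x * p n x \<partial>?M) = 1"
      using integral_pn[of n] Im_neg unfolding eq by simp
  qed
qed

lemma carmona_sets [simp]: "sets (carmona_measure n \<tau>) = sets borel"
  by (simp add: carmona_measure_def)

lemma carmona_prob_space: "prob_space (carmona_measure n \<tau>)"
proof
  let ?M = "carmona_measure n \<tau>"
  have I: "integrable ?M (\<lambda>x. 1::real)" "(\<integral>x. 1 \<partial>?M) = (1::real)"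
    using carmona_orthonormal[of 0 0] by auto
  have "emeasure ?M (space ?M) = (\<integral>\<^sup>+x. ennreal 1 \<partial>?M)" by simp
  also have "\<dots> = ennreal (\<integral>x. 1 \<partial>?M)" by (rule nn_integral_eq_integral[OF I(1)]) simp
  finally show "emeasure ?M (space ?M) = 1" using I(2) by simp
qed

end

end

section \<open>Resolvent coefficients and weak convergence\<close>

lemma complex_shift_nonzero: "Im z \<noteq> 0 \<Longrightarrow> complex_of_real x - z \<noteq> 0"
  by (auto simp: complex_eq_iff)

lemma norm_inverse_shift_le:
  assumes "Im z \<noteq> 0"
  shows "norm (1 / (complex_of_real x - z)) \<le> 1 / \<bar>Im z\<bar>"
proof -
  have "\<bar>Im z\<bar> \<le> norm (complex_of_real x - z)"
    using abs_Im_le_cmod[of "complex_of_real x - z"] by simp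
  then show ?thesis using assms by (simp add: norm_divide frac_le)
qed

context jacobi
begin

definition orthonormal_upto :: "nat \<Rightarrow> real measure \<Rightarrow> bool" where
  "orthonormal_upto n M \<longleftrightarrow> prob_space M \<and> sets M = sets borel \<and>
     (\<forall>i\<le>n. \<forall>j\<le>n. integrable M (\<lambda>x. p i x * p j x) \<and>
        (\<integral>x. p i x * p j x \<partial>M) = (if i = j then 1 else 0))"

text \<open>The Fourier coefficients of the kernel 1 / (x - z), also called functions of the second
  kind; coefficient 0 is the Stieltjes transform of \<open>M\<close>.\<close>

definition resolvent_coeff :: "real measure \<Rightarrow> complex \<Rightarrow> nat \<Rightarrow> complex" where
  "resolvent_coeff M z m = (\<integral>x. of_real (p m x) / (of_real x - z) \<partial>M)"

context
  fixes n :: nat and M :: "real measure"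
  assumes orth: "orthonormal_upto n M"
begin

private lemma M_prob: "prob_space M" and M_sets [measurable_cong]: "sets M = sets borel"
  using orth by (auto simp: orthonormal_upto_def)

private lemma p_int: "m \<le> n \<Longrightarrow> integrable M (p m)"
  using orth[unfolded orthonormal_upto_def] by (metis (no_types, lifting) Bochner_Integration.integrable_cong le0 mult.right_neutral opoly.simps(1))

private lemma p_integral: "m \<le> n \<Longrightarrow> (\<integral>x. p m x \<partial>M) = (if m = 0 then 1 else 0)"
  using orth[unfolded orthonormal_upto_def, THEN conjunct2, THEN conjunct2, rule_format, of m 0] by simp

text \<open>Expand the nonnegative integral of the squared distance of \<open>u\<close> to its
  partial Fourier sum.\<close>

lemma bessel_inequality:
  fixes u :: "real \<Rightarrow> real"
  assumes [measurable]: "u \<in> borel_measurable borel" and bd: "\<And>x. \<bar>u x\<bar> \<le> C"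
  shows "(\<Sum>m\<le>n. (\<integral>x. p m x * u x \<partial>M)\<^sup>2) \<le> (\<integral>x. (u x)\<^sup>2 \<partial>M)"
proof -
  interpret M: prob_space M by (rule M_prob)
  define c where "c m = (\<integral>x. p m x * u x \<partial>M)" for m
  have Ipp: "integrable M (\<lambda>x. p i x * p j x)" "(\<integral>x. p i x * p j x \<partial>M) = (if i = j then 1 else 0)"
    if "i \<le> n" "j \<le> n" for i j
    using orth that by (auto simp: orthonormal_upto_def)
  have Iu: "integrable M (\<lambda>x. p m x * u x)" if "m \<le> n" for m
  proof (rule Bochner_Integration.integrable_bound[OF integrable_mult_right[OF p_int[OF that], of C]])
    show "AE x in M. norm (p m x * u x) \<le> norm (C * p m x)"
      using bd by (intro AE_I2) (metis abs_ge_zero abs_mult abs_of_nonneg mult.commute mult_right_mono order_trans real_norm_def)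
  qed measurable
  have Iuu: "integrable M (\<lambda>x. (u x)\<^sup>2)"
  proof (rule M.integrable_const_bound[where B = "C\<^sup>2"])
    show "AE x in M. norm ((u x)\<^sup>2) \<le> C\<^sup>2"
      using bd by (intro AE_I2) (simp add: abs_le_square_iff[symmetric] order_trans[OF bd abs_ge_self])
  qed measurable
  have expand: "(u x - (\<Sum>m\<le>n. c m * p m x))\<^sup>2 = (u x)\<^sup>2 - 2 * (\<Sum>m\<le>n. c m * (p m x * u x))
      + (\<Sum>i\<le>n. \<Sum>j\<le>n. c i * c j * (p i x * p j x))" for x
    by (simp add: power2_diff power2_eq_square[of "sum _ _"] sum_product sum_distrib_left algebra_simps)
  have I1: "integrable M (\<lambda>x. \<Sum>m\<le>n. c m * (p m x * u x))"
    and I2: "integrable M (\<lambda>x. \<Sum>i\<le>n. \<Sum>j\<le>n. c i * c j * (p i x * p j x))"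
    by (auto intro!: Bochner_Integration.integrable_sum integrable_mult_right Iu Ipp(1))
  have E1: "(\<integral>x. (\<Sum>m\<le>n. c m * (p m x * u x)) \<partial>M) = (\<Sum>m\<le>n. c m * (\<integral>x. p m x * u x \<partial>M))"
    by (subst Bochner_Integration.integral_sum) (auto intro!: integrable_mult_right Iu)
  have E2: "(\<integral>x. (\<Sum>i\<le>n. \<Sum>j\<le>n. c i * c j * (p i x * p j x)) \<partial>M)
      = (\<Sum>i\<le>n. \<Sum>j\<le>n. c i * c j * (\<integral>x. p i x * p j x \<partial>M))"
    by (subst Bochner_Integration.integral_sum, auto intro!: Bochner_Integration.integrable_sum integrable_mult_right Ipp(1),
        intro sum.cong refl, subst Bochner_Integration.integral_sum, auto intro!: integrable_mult_right Ipp(1))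
  have "0 \<le> (\<integral>x. (u x - (\<Sum>m\<le>n. c m * p m x))\<^sup>2 \<partial>M)" by (intro Bochner_Integration.integral_nonneg) auto
  also have "\<dots> = (\<integral>x. (u x)\<^sup>2 \<partial>M) - 2 * (\<Sum>m\<le>n. c m * (\<integral>x. p m x * u x \<partial>M))
      + (\<Sum>i\<le>n. \<Sum>j\<le>n. c i * c j * (\<integral>x. p i x * p j x \<partial>M))"
    unfolding expand using I1 I2 Iuu E1 E2 by simp
  also have "(\<Sum>i\<le>n. \<Sum>j\<le>n. c i * c j * (\<integral>x. p i x * p j x \<partial>M)) = (\<Sum>i\<le>n. (c i)\<^sup>2)"
  proof (rule sum.cong[OF refl])
    fix i assume "i \<in> {..n}"
    then have "(\<Sum>j\<le>n. c i * c j * (\<integral>x. p i x * p j x \<partial>M)) = (\<Sum>j\<le>n. if i = j then c i * c j else 0)"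
      by (intro sum.cong) (auto simp: Ipp(2))
    also have "\<dots> = (c i)\<^sup>2" using \<open>i \<in> {..n}\<close> by (simp add: power2_eq_square)
    finally show "(\<Sum>j\<le>n. c i * c j * (\<integral>x. p i x * p j x \<partial>M)) = (c i)\<^sup>2" .
  qed
  finally show ?thesis by (simp add: c_def power2_eq_square)
qed

private lemma kernel_int:
  assumes m: "m \<le> n" and z: "Im z \<noteq> 0"
  shows "integrable M (\<lambda>x. complex_of_real (p m x) / (of_real x - z))"
proof (rule Bochner_Integration.integrable_bound)
  show "integrable M (\<lambda>x. 1 / \<bar>Im z\<bar> * p m x)" using p_int[OF m] by (rule integrable_mult_right)
  show "AE x in M. norm (complex_of_real (p m x) / (of_real x - z)) \<le> norm (1 / \<bar>Im z\<bar> * p m x)"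
  proof (rule AE_I2)
    fix x
    have "norm (complex_of_real (p m x) / (of_real x - z)) = norm (1 / (complex_of_real x - z)) * \<bar>p m x\<bar>"
      by (simp add: norm_divide)
    also have "\<dots> \<le> (1 / \<bar>Im z\<bar>) * \<bar>p m x\<bar>"
      by (intro mult_right_mono norm_inverse_shift_le z) auto
    finally show "norm (complex_of_real (p m x) / (of_real x - z)) \<le> norm (1 / \<bar>Im z\<bar> * p m x)"
      by (simp add: abs_mult)
  qed
qed measurable

text \<open>Bessel's inequality for the real and the imaginary part of the kernel; the two squares
  add up to its modulus squared, at most 1 / (Im z)^2.\<close>

lemma resolvent_coeff_bessel:
  assumes z: "Im z \<noteq> 0"
  shows "(\<Sum>m\<le>n. (norm (resolvent_coeff M z m))\<^sup>2) \<le> 1 / (Im z)\<^sup>2"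
proof -
  interpret M: prob_space M by (rule M_prob)
  define k where "k x = 1 / (complex_of_real x - z)" for x
  have km [measurable]: "k \<in> borel_measurable borel" unfolding k_def by measurable
  have kb: "norm (k x) \<le> 1 / \<bar>Im z\<bar>" for x unfolding k_def by (rule norm_inverse_shift_le[OF z])
  have R: "\<bar>Re (k x)\<bar> \<le> 1 / \<bar>Im z\<bar>" and I: "\<bar>Im (k x)\<bar> \<le> 1 / \<bar>Im z\<bar>" for x
    using order_trans[OF abs_Re_le_cmod kb] order_trans[OF abs_Im_le_cmod kb] by auto
  have sq: "\<bar>t\<bar> \<le> 1 / \<bar>Im z\<bar> \<Longrightarrow> t\<^sup>2 \<le> (1 / \<bar>Im z\<bar>)\<^sup>2" for t
    by (metis abs_ge_zero power2_abs power_mono)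
  have IR: "integrable M (\<lambda>x. (Re (k x))\<^sup>2)" and II: "integrable M (\<lambda>x. (Im (k x))\<^sup>2)"
    using sq[OF R] sq[OF I] by (auto intro!: M.integrable_const_bound[where B = "(1 / \<bar>Im z\<bar>)\<^sup>2"] AE_I2)
  have coeff: "(norm (resolvent_coeff M z m))\<^sup>2 = (\<integral>x. p m x * Re (k x) \<partial>M)\<^sup>2 + (\<integral>x. p m x * Im (k x) \<partial>M)\<^sup>2"
    if "m \<le> n" for m
  proof -
    have eq: "complex_of_real (p m x) / (of_real x - z) = of_real (p m x) * k x" for x by (simp add: k_def)
    have int: "integrable M (\<lambda>x. of_real (p m x) * k x)" using kernel_int[OF that z] by (simp add: eq)
    have "Re (resolvent_coeff M z m) = (\<integral>x. p m x * Re (k x) \<partial>M)"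
      unfolding resolvent_coeff_def eq using int by (subst integral_Re[symmetric]) auto
    moreover have "Im (resolvent_coeff M z m) = (\<integral>x. p m x * Im (k x) \<partial>M)"
      unfolding resolvent_coeff_def eq using int by (subst integral_Im[symmetric]) auto
    ultimately show ?thesis by (simp add: cmod_power2)
  qed
  have "(\<Sum>m\<le>n. (norm (resolvent_coeff M z m))\<^sup>2)
      = (\<Sum>m\<le>n. (\<integral>x. p m x * Re (k x) \<partial>M)\<^sup>2) + (\<Sum>m\<le>n. (\<integral>x. p m x * Im (k x) \<partial>M)\<^sup>2)"
    by (simp add: coeff sum.distrib)
  also have "\<dots> \<le> (\<integral>x. (Re (k x))\<^sup>2 \<partial>M) + (\<integral>x. (Im (k x))\<^sup>2 \<partial>M)"
    by (intro add_mono bessel_inequality) (use R I in auto)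
  also have "\<dots> = (\<integral>x. (norm (k x))\<^sup>2 \<partial>M)"
    using IR II by (simp add: cmod_power2)
  also have "\<dots> \<le> (\<integral>x. (1 / \<bar>Im z\<bar>)\<^sup>2 \<partial>M)"
  proof (rule integral_mono)
    show "integrable M (\<lambda>x. (norm (k x))\<^sup>2)" using IR II by (simp add: cmod_power2)
    show "(norm (k x))\<^sup>2 \<le> (1 / \<bar>Im z\<bar>)\<^sup>2" for x using kb[of x] by (intro power_mono) auto
  qed simp
  also have "\<dots> = 1 / (Im z)\<^sup>2" by (simp add: power_divide M.prob_space)
  finally show ?thesis .
qed

text \<open>From x / (x - z) = 1 + z / (x - z): the constant 1 is orthogonal to \<open>p m\<close>
  unless \<open>m = 0\<close>. So the coefficients obey the recurrence of the polynomials, with an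
  inhomogeneous term at index 0 only.\<close>

private lemma kernel_times:
  assumes m: "m \<le> n" and z: "Im z \<noteq> 0"
  shows "integrable M (\<lambda>x. complex_of_real (x * p m x) / (of_real x - z))"
    and "(\<integral>x. complex_of_real (x * p m x) / (of_real x - z) \<partial>M) = (if m = 0 then 1 else 0) + z * resolvent_coeff M z m"
proof -
  have eq: "complex_of_real (x * p m x) / (of_real x - z) = of_real (p m x) + z * (of_real (p m x) / (of_real x - z))" for x
    using complex_shift_nonzero[OF z, of x] by (simp add: field_simps)
  have i: "integrable M (\<lambda>x. complex_of_real (p m x))" using p_int[OF m] by simp
  show "integrable M (\<lambda>x. complex_of_real (x * p m x) / (of_real x - z))"
    unfolding eq by (intro Bochner_Integration.integrable_add integrable_mult_right kernel_int i m z)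
  show "(\<integral>x. complex_of_real (x * p m x) / (of_real x - z) \<partial>M) = (if m = 0 then 1 else 0) + z * resolvent_coeff M z m"
    unfolding eq using kernel_int[OF m z] i p_integral[OF m]
    by (subst Bochner_Integration.integral_add) (auto simp: resolvent_coeff_def simp del: times_divide_eq_right)
qed

lemma resolvent_coeff_recurrence_0:
  assumes n: "1 \<le> n" and z: "Im z \<noteq> 0"
  shows "1 + z * resolvent_coeff M z 0 = b 0 * resolvent_coeff M z 0 + a 0 * resolvent_coeff M z 1"
proof -
  have eq: "complex_of_real (x * p 0 x) / (of_real x - z)
      = of_real (b 0) * (of_real (p 0 x) / (of_real x - z)) + of_real (a 0) * (of_real (p 1 x) / (of_real x - z))" for x
    unfolding recurrence_0 by (simp add: add_divide_distrib del: opoly.simps)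
  have "1 + z * resolvent_coeff M z 0 = (\<integral>x. complex_of_real (x * p 0 x) / (of_real x - z) \<partial>M)"
    using kernel_times(2)[OF le0 z] by simp
  also have "\<dots> = b 0 * resolvent_coeff M z 0 + a 0 * resolvent_coeff M z 1"
    unfolding eq using kernel_int[OF le0 z] kernel_int[OF n z]
    by (subst Bochner_Integration.integral_add) (simp_all add: resolvent_coeff_def del: opoly.simps times_divide_eq_right)
  finally show ?thesis .
qed

lemma resolvent_coeff_recurrence_Suc:
  assumes m: "Suc (Suc m) \<le> n" and z: "Im z \<noteq> 0"
  shows "z * resolvent_coeff M z (Suc m) = a m * resolvent_coeff M z m
     + b (Suc m) * resolvent_coeff M z (Suc m) + a (Suc m) * resolvent_coeff M z (Suc (Suc m))"
proof -
  let ?k = "\<lambda>i x. complex_of_real (p i x) / (of_real x - z)"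
  have eq: "complex_of_real (x * p (Suc m) x) / (of_real x - z)
      = of_real (a m) * ?k m x + of_real (b (Suc m)) * ?k (Suc m) x + of_real (a (Suc m)) * ?k (Suc (Suc m)) x" for x
    unfolding recurrence_Suc by (simp add: add_divide_distrib del: opoly.simps)
  have I: "integrable M (?k m)" "integrable M (?k (Suc m))" "integrable M (?k (Suc (Suc m)))"
    using m by (auto intro!: kernel_int z simp del: opoly.simps)
  have "z * resolvent_coeff M z (Suc m) = (\<integral>x. complex_of_real (x * p (Suc m) x) / (of_real x - z) \<partial>M)"
    using kernel_times(2)[OF _ z, of "Suc m"] m by simp
  also have "\<dots> = a m * resolvent_coeff M z m
     + b (Suc m) * resolvent_coeff M z (Suc m) + a (Suc m) * resolvent_coeff M z (Suc (Suc m))"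
    unfolding eq using I
    by (simp add: resolvent_coeff_def del: opoly.simps times_divide_eq_right)
  finally show ?thesis .
qed

text \<open>The recurrence makes the expression constant in \<open>m\<close>; the value 1 is the
  inhomogeneous term of \<open>resolvent_coeff_recurrence_0\<close>.\<close>

lemma resolvent_coeff_wronskian:
  assumes z: "Im z \<noteq> 0"
  shows "Suc m \<le> n \<Longrightarrow> a m * (resolvent_coeff M z (Suc m) * P m z - resolvent_coeff M z m * P (Suc m) z) = 1"
proof (induction m)
  case 0
  then have "1 + z * resolvent_coeff M z 0 = b 0 * resolvent_coeff M z 0 + a 0 * resolvent_coeff M z 1"
    by (intro resolvent_coeff_recurrence_0 z) auto
  then have "a 0 * resolvent_coeff M z 1 = 1 + z * resolvent_coeff M z 0 - b 0 * resolvent_coeff M z 0"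
    by simp
  then have "a 0 * (resolvent_coeff M z 1 * P 0 z - resolvent_coeff M z 0 * P 1 z)
      = 1 + z * resolvent_coeff M z 0 - b 0 * resolvent_coeff M z 0 - resolvent_coeff M z 0 * (a 0 * P 1 z)"
    by (simp add: right_diff_distrib mult.left_commute del: cpoly.simps(2))
  also have "a 0 * P 1 z = z - b 0" by simp
  finally show ?case unfolding One_nat_def by (simp only:) (simp add: algebra_simps)
next
  case (Suc m)
  let ?c = "resolvent_coeff M z"
  have "a (Suc m) * (?c (Suc (Suc m)) * P (Suc m) z - ?c (Suc m) * P (Suc (Suc m)) z)
     = (a (Suc m) * ?c (Suc (Suc m))) * P (Suc m) z - ?c (Suc m) * (a (Suc m) * P (Suc (Suc m)) z)"
    by (simp add: algebra_simps del: cpoly.simps)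
  also have "a (Suc m) * ?c (Suc (Suc m)) = z * ?c (Suc m) - a m * ?c m - b (Suc m) * ?c (Suc m)"
    using resolvent_coeff_recurrence_Suc[OF Suc.prems z] by simp
  also have "a (Suc m) * P (Suc (Suc m)) z = z * P (Suc m) z - a m * P m z - b (Suc m) * P (Suc m) z"
    using cpoly_recurrence_Suc[of z m] by simp
  also have "(z * ?c (Suc m) - a m * ?c m - b (Suc m) * ?c (Suc m)) * P (Suc m) z
      - ?c (Suc m) * (z * P (Suc m) z - a m * P m z - b (Suc m) * P (Suc m) z)
      = a m * (?c (Suc m) * P m z - ?c m * P (Suc m) z)"
    by (simp add: algebra_simps del: cpoly.simps)
  finally show ?case using Suc by (simp del: cpoly.simps)
qed

text \<open>A quantitative Carleman criterion: the Wronskian is 1, and the resolvent coefficients are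
  square summable by Bessel, so the divergence of the left-hand side forces that of the right-hand one.\<close>

lemma sum_inverse_le_cpoly_norm:
  assumes z: "Im z \<noteq> 0"
  shows "(\<Sum>m<n. 1 / a m) \<le> 2 / \<bar>Im z\<bar> * sqrt (\<Sum>m\<le>n. (norm (P m z))\<^sup>2)"
proof -
  let ?c = "resolvent_coeff M z" and ?K = "sqrt (\<Sum>m\<le>n. (norm (P m z))\<^sup>2)"
  have "L2_set (\<lambda>m. norm (?c m)) {..n} \<le> 1 / \<bar>Im z\<bar>"
    unfolding L2_set_def using resolvent_coeff_bessel[OF z]
    by (intro real_le_lsqrt) (auto simp: power_divide intro: sum_nonneg)
  then have C: "L2_set (\<lambda>m. norm (?c m)) {..n} \<le> 1 / \<bar>Im z\<bar>" .
  have K: "L2_set (\<lambda>m. norm (P m z)) {..n} = ?K" by (simp add: L2_set_def)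
  have shift: "L2_set (\<lambda>m. f (Suc m)) {..<n} \<le> L2_set f {..n}" for f
  proof -
    have "(\<Sum>m<n. (f (Suc m))\<^sup>2) = (\<Sum>m\<in>Suc ` {..<n}. (f m)\<^sup>2)" by (simp add: sum.reindex)
    also have "\<dots> \<le> (\<Sum>m\<le>n. (f m)\<^sup>2)" by (intro sum_mono2) auto
    finally show ?thesis by (simp add: L2_set_def)
  qed
  have id: "L2_set f {..<n} \<le> L2_set f {..n}" for f
    unfolding L2_set_def by (intro real_sqrt_le_mono sum_mono2) auto
  have "1 / a m \<le> norm (?c (Suc m)) * norm (P m z) + norm (?c m) * norm (P (Suc m) z)" if "m < n" for m
  proof -
    have "a m * norm (?c (Suc m) * P m z - ?c m * P (Suc m) z) = norm (of_real (a m) * (?c (Suc m) * P m z - ?c m * P (Suc m) z))"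
      using a_pos[of m] by (simp add: norm_mult del: cpoly.simps)
    also have "\<dots> = 1" using resolvent_coeff_wronskian[OF z, of m] that by simp
    finally have "1 / a m = norm (?c (Suc m) * P m z - ?c m * P (Suc m) z)" by (simp add: field_simps)
    also have "\<dots> \<le> norm (?c (Suc m) * P m z) + norm (?c m * P (Suc m) z)" by (rule norm_triangle_ineq4)
    finally show ?thesis by (simp add: norm_mult)
  qed
  then have "(\<Sum>m<n. 1 / a m) \<le> (\<Sum>m<n. norm (?c (Suc m)) * norm (P m z)) + (\<Sum>m<n. norm (?c m) * norm (P (Suc m) z))"
    unfolding sum.distrib[symmetric] by (intro sum_mono) auto
  also have "(\<Sum>m<n. norm (?c (Suc m)) * norm (P m z)) \<le> L2_set (\<lambda>m. norm (?c (Suc m))) {..<n} * L2_set (\<lambda>m. norm (P m z)) {..<n}"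
    using L2_set_mult_ineq[of "\<lambda>m. norm (?c (Suc m))" "\<lambda>m. norm (P m z)" "{..<n}"] by simp
  also have "\<dots> \<le> L2_set (\<lambda>m. norm (?c m)) {..n} * L2_set (\<lambda>m. norm (P m z)) {..n}"
    by (intro mult_mono shift id L2_set_nonneg)
  also have "\<dots> \<le> 1 / \<bar>Im z\<bar> * ?K" unfolding K by (intro mult_right_mono C) (auto intro: sum_nonneg)
  also have "(\<Sum>m<n. norm (?c m) * norm (P (Suc m) z)) \<le> L2_set (\<lambda>m. norm (?c m)) {..<n} * L2_set (\<lambda>m. norm (P (Suc m) z)) {..<n}"
    using L2_set_mult_ineq[of "\<lambda>m. norm (?c m)" "\<lambda>m. norm (P (Suc m) z)" "{..<n}"] by (simp del: cpoly.simps)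
  also have "\<dots> \<le> L2_set (\<lambda>m. norm (?c m)) {..n} * L2_set (\<lambda>m. norm (P m z)) {..n}"
    by (intro mult_mono shift[of "\<lambda>m. norm (P m z)"] id L2_set_nonneg)
  also have "\<dots> \<le> 1 / \<bar>Im z\<bar> * ?K" unfolding K by (intro mult_right_mono C) (auto intro: sum_nonneg)
  finally show ?thesis by (simp add: field_simps)
qed

end

text \<open>In the difference of the two coefficient sequences the inhomogeneous term cancels, so it
  is a multiple of \<open>P m z\<close>, the factor being the difference of the Stieltjes
  transforms. Bessel bounds this difference in l2 by 2 / |Im z|;
  \<open>sum_inverse_le_cpoly_norm\<close> contributes the other factor 2 / |Im z|.\<close>

lemma stieltjes_transform_close:
  assumes M1: "orthonormal_upto n M1" and M2: "orthonormal_upto n M2" and z: "Im z \<noteq> 0" and n: "n \<ge> 1"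
  shows "norm (resolvent_coeff M1 z 0 - resolvent_coeff M2 z 0) * (\<Sum>m<n. 1 / a m) \<le> 4 / (Im z)\<^sup>2"
proof -
  let ?c = "resolvent_coeff M1 z" and ?d = "resolvent_coeff M2 z"
  let ?F = "?c 0 - ?d 0" and ?K = "sqrt (\<Sum>m\<le>n. (norm (P m z))\<^sup>2)"
  have diff: "m \<le> n \<Longrightarrow> ?c m - ?d m = ?F * P m z" for m
  proof (induction m rule: induct_nat_012)
    case 1
    have e: "a 0 * ?c 1 = 1 + z * ?c 0 - b 0 * ?c 0" "a 0 * ?d 1 = 1 + z * ?d 0 - b 0 * ?d 0"
      using resolvent_coeff_recurrence_0[OF M1 n z] resolvent_coeff_recurrence_0[OF M2 n z] by simp_all
    have "a 0 * (?c 1 - ?d 1) = (z - b 0) * ?F"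
      unfolding right_diff_distrib[of _ "?c 1"] e by (simp add: algebra_simps)
    then show ?case by (simp add: field_simps)
  next
    case (ge2 m)
    have e1: "?c m - ?d m = ?F * P m z" "?c (Suc m) - ?d (Suc m) = ?F * P (Suc m) z"
      using ge2 by auto
    have "a (Suc m) * ?c (Suc (Suc m)) = (z - b (Suc m)) * ?c (Suc m) - a m * ?c m"
      using resolvent_coeff_recurrence_Suc[OF M1 ge2.prems z] by (simp add: algebra_simps)
    moreover have "a (Suc m) * ?d (Suc (Suc m)) = (z - b (Suc m)) * ?d (Suc m) - a m * ?d m"
      using resolvent_coeff_recurrence_Suc[OF M2 ge2.prems z] by (simp add: algebra_simps)
    ultimately have "a (Suc m) * (?c (Suc (Suc m)) - ?d (Suc (Suc m)))
        = (z - b (Suc m)) * (?c (Suc m) - ?d (Suc m)) - a m * (?c m - ?d m)"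
      by (simp add: algebra_simps)
    also have "\<dots> = a (Suc m) * (?F * P (Suc (Suc m)) z)"
      unfolding e1 by (simp add: field_simps)
    finally show ?case by (simp del: cpoly.simps)
  qed simp
  have "L2_set (\<lambda>m. norm (?F * P m z)) {..n} \<le> L2_set (\<lambda>m. norm (?c m) + norm (?d m)) {..n}"
    by (intro L2_set_mono) (auto simp: diff[symmetric] norm_triangle_ineq4)
  also have "\<dots> \<le> L2_set (\<lambda>m. norm (?c m)) {..n} + L2_set (\<lambda>m. norm (?d m)) {..n}"
    by (rule L2_set_triangle_ineq)
  also have "\<dots> \<le> 1 / \<bar>Im z\<bar> + 1 / \<bar>Im z\<bar>"
    unfolding L2_set_def using resolvent_coeff_bessel[OF M1 z] resolvent_coeff_bessel[OF M2 z]
    by (intro add_mono real_le_lsqrt) (auto simp: power_divide intro: sum_nonneg)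
  also have "L2_set (\<lambda>m. norm (?F * P m z)) {..n} = norm ?F * ?K"
    by (simp add: L2_set_def norm_mult power_mult_distrib sum_distrib_left[symmetric] real_sqrt_mult)
  finally have FK: "norm ?F * ?K \<le> 2 / \<bar>Im z\<bar>" by simp
  have "norm ?F * (\<Sum>m<n. 1 / a m) \<le> norm ?F * (2 / \<bar>Im z\<bar> * ?K)"
    by (intro mult_left_mono sum_inverse_le_cpoly_norm[OF M1 z]) auto
  also have "\<dots> = 2 / \<bar>Im z\<bar> * (norm ?F * ?K)" by simp
  also have "\<dots> \<le> 2 / \<bar>Im z\<bar> * (2 / \<bar>Im z\<bar>)" by (intro mult_left_mono FK) auto
  finally show ?thesis by (simp add: power2_eq_square)
qed

lemma stieltjes_transform_tendsto:
  assumes M: "\<And>k. orthonormal_upto (r k) (M k)" and r: "filterlim r at_top sequentially"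
    and \<mu>: "\<And>n. orthonormal_upto n \<mu>" and ns: "\<not> summable (\<lambda>n. 1 / a n)" and z: "Im z \<noteq> 0"
  shows "(\<lambda>k. resolvent_coeff (M k) z 0) \<longlonglongrightarrow> resolvent_coeff \<mu> z 0"
proof -
  have "filterlim (\<lambda>n. \<Sum>m<n. 1 / a m) at_top sequentially"
    unfolding filterlim_at_top
  proof
    fix Z :: real
    have "\<exists>n. Z \<le> (\<Sum>m<n. 1 / a m)"
    proof (rule ccontr)
      assume "\<not> ?thesis"
      then have "summable (\<lambda>n. 1 / a n)"
        using a_pos by (intro summableI_nonneg_bounded[where x = Z]) (auto simp: less_imp_le not_le)
      with ns show False by simp
    qed
    then obtain n0 where "Z \<le> (\<Sum>m<n0. 1 / a m)" by blast
    moreover have "(\<Sum>m<n0. 1 / a m) \<le> (\<Sum>m<n. 1 / a m)" if "n \<ge> n0" for n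
      using that a_pos by (intro sum_mono2) (auto simp: less_imp_le)
    ultimately show "\<forall>\<^sub>F n in sequentially. Z \<le> (\<Sum>m<n. 1 / a m)"
      by (auto simp: eventually_sequentially intro: order_trans)
  qed
  then have S: "filterlim (\<lambda>k. \<Sum>m<r k. 1 / a m) at_top sequentially"
    using r by (rule filterlim_compose)
  have "(\<lambda>k. 4 / (Im z)\<^sup>2 / (\<Sum>m<r k. 1 / a m)) \<longlonglongrightarrow> 0"
    by (rule real_tendsto_divide_at_top[OF tendsto_const S])
  moreover have "\<forall>\<^sub>F k in sequentially. norm (resolvent_coeff (M k) z 0 - resolvent_coeff \<mu> z 0)
      \<le> 4 / (Im z)\<^sup>2 / (\<Sum>m<r k. 1 / a m)"
    using S[unfolded filterlim_at_top, rule_format, of 1] r[unfolded filterlim_at_top, rule_format, of 1]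
  proof eventually_elim
    case (elim k)
    then have "(\<Sum>m<r k. 1 / a m) > 0" by linarith
    then show ?case using stieltjes_transform_close[OF M[of k] \<mu>[of "r k"] z] elim
      by (simp only: pos_le_divide_eq)
  qed
  ultimately have "(\<lambda>k. resolvent_coeff (M k) z 0 - resolvent_coeff \<mu> z 0) \<longlonglongrightarrow> 0"
    by (rule Lim_null_comparison[rotated])
  then show ?thesis by (simp add: LIM_zero_iff)
qed

end

section \<open>Poisson smoothing of measures\<close>

definition poisson_transform :: "real measure \<Rightarrow> real \<Rightarrow> real \<Rightarrow> real" where
  "poisson_transform M y t = (\<integral>x. y / ((x - t)\<^sup>2 + y\<^sup>2) \<partial>M)"

lemma poisson_kernel_pos: "y > 0 \<Longrightarrow> y / ((x - t)\<^sup>2 + y\<^sup>2) > (0::real)"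
  by (simp add: add_nonneg_pos)

lemma poisson_kernel_le: "y > 0 \<Longrightarrow> y / ((x - t)\<^sup>2 + y\<^sup>2) \<le> 1 / (y::real)"
  by (simp add: divide_simps add_nonneg_pos power2_eq_square)

context
  fixes M :: "real measure"
  assumes prob: "prob_space M" and M_sets [measurable_cong]: "sets M = sets borel"
begin

lemma poisson_kernel_integrable: "y > 0 \<Longrightarrow> integrable M (\<lambda>x. y / ((x - t)\<^sup>2 + y\<^sup>2))"
  by (rule finite_measure.integrable_const_bound[OF prob_space.axioms(1)[OF prob], where B = "1 / y"])
     (auto simp: less_imp_le[OF poisson_kernel_pos] poisson_kernel_le)

lemma poisson_transform_bounds:
  assumes y: "y > 0"
  shows "0 \<le> poisson_transform M y t" and "poisson_transform M y t \<le> 1 / y"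
proof -
  interpret prob_space M by (rule prob)
  show "0 \<le> poisson_transform M y t" unfolding poisson_transform_def
    using poisson_kernel_pos[OF y] by (intro Bochner_Integration.integral_nonneg less_imp_le)
  have "poisson_transform M y t \<le> (\<integral>x. 1 / y \<partial>M)"
    unfolding poisson_transform_def
    by (intro integral_mono poisson_kernel_integrable y) (auto simp: poisson_kernel_le[OF y])
  then show "poisson_transform M y t \<le> 1 / y" by (simp add: prob_space)
qed

lemma poisson_transform_measurable [measurable]: "poisson_transform M y \<in> borel_measurable borel"
proof -
  interpret prob_space M by (rule prob)
  show ?thesis unfolding poisson_transform_def[abs_def] by measurable
qed

text \<open>Pointwise convergence of Stieltjes transforms thus passes to Poisson transforms. The
  usual factor 1 / pi is omitted, which is why pi accompanies the unsmoothed integrals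
  below.\<close>

lemma poisson_transform_eq_Im:
  assumes y: "y > 0"
  shows "poisson_transform M y t = Im (\<integral>x. 1 / (complex_of_real x - Complex t y) \<partial>M)"
proof -
  interpret prob_space M by (rule prob)
  have "integrable M (\<lambda>x. 1 / (complex_of_real x - Complex t y))"
    using norm_inverse_shift_le[of "Complex t y"] y
    by (intro integrable_const_bound[where B = "1 / y"]) auto
  then have "Im (\<integral>x. 1 / (complex_of_real x - Complex t y) \<partial>M) = (\<integral>x. Im (1 / (complex_of_real x - Complex t y)) \<partial>M)"
    by simp
  also have "\<dots> = poisson_transform M y t"
    unfolding poisson_transform_def by (intro Bochner_Integration.integral_cong) (auto simp: Im_divide)
  finally show ?thesis by simp
qed

text \<open>Smoothing the measure is the same as smoothing the test function.\<close>

lemma poisson_fubini: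
  assumes y: "y > 0" and f: "integrable lborel f"
  shows "(\<integral>x. (\<integral>t. f t * (y / ((x - t)\<^sup>2 + y\<^sup>2)) \<partial>lborel) \<partial>M) = (\<integral>t. f t * poisson_transform M y t \<partial>lborel)"
    and "integrable M (\<lambda>x. \<integral>t. f t * (y / ((x - t)\<^sup>2 + y\<^sup>2)) \<partial>lborel)"
proof -
  interpret M: prob_space M by (rule prob)
  interpret pair_sigma_finite lborel M ..
  have [measurable]: "f \<in> borel_measurable borel" using borel_measurable_integrable[OF f] by simp
  let ?g = "\<lambda>(t, x). f t * (y / ((x - t)\<^sup>2 + y\<^sup>2))"
  have inner: "(\<integral>x. norm (?g (t, x)) \<partial>M) = \<bar>f t\<bar> * poisson_transform M y t" for t
  proof -
    have "norm (?g (t, x)) = \<bar>f t\<bar> * (y / ((x - t)\<^sup>2 + y\<^sup>2))" for x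
      using poisson_kernel_pos[OF y, of x t] by (simp only: abs_mult prod.case real_norm_def abs_of_pos)
    then show ?thesis unfolding poisson_transform_def by (simp del: times_divide_eq_right)
  qed
  have int: "integrable (lborel \<Otimes>\<^sub>M M) ?g"
  proof (rule Fubini_integrable)
    show "integrable lborel (\<lambda>t. \<integral>x. norm (?g (t, x)) \<partial>M)"
      unfolding inner
    proof (rule Bochner_Integration.integrable_bound[OF integrable_mult_right[OF f, of "1 / y"]])
      show "AE t in lborel. norm (\<bar>f t\<bar> * poisson_transform M y t) \<le> norm (1 / y * f t)"
        using poisson_transform_bounds[OF y] y
        by (intro AE_I2) (simp add: abs_mult mult.commute[of _ "\<bar>f _\<bar>"] mult_left_mono divide_inverse)
    qed measurable
    show "AE t in lborel. integrable M (\<lambda>x. ?g (t, x))"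
      using poisson_kernel_integrable[OF y] by (intro AE_I2) (simp del: times_divide_eq_right)
  qed measurable
  have "(\<integral>t. f t * poisson_transform M y t \<partial>lborel) = (\<integral>t. (\<integral>x. f t * (y / ((x - t)\<^sup>2 + y\<^sup>2)) \<partial>M) \<partial>lborel)"
    unfolding poisson_transform_def by (simp del: times_divide_eq_right)
  also have "\<dots> = (\<integral>x. (\<integral>t. f t * (y / ((x - t)\<^sup>2 + y\<^sup>2)) \<partial>lborel) \<partial>M)"
    using Fubini_integral[OF int] by simp
  finally show "(\<integral>x. (\<integral>t. f t * (y / ((x - t)\<^sup>2 + y\<^sup>2)) \<partial>lborel) \<partial>M) = (\<integral>t. f t * poisson_transform M y t \<partial>lborel)"
    by simp
  show "integrable M (\<lambda>x. \<integral>t. f t * (y / ((x - t)\<^sup>2 + y\<^sup>2)) \<partial>lborel)"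
    using integrable_snd[OF int] by simp
qed

end

lemma integral_inverse_one_plus_square: "(\<integral>x. inverse (1 + x\<^sup>2) \<partial>lborel) = pi"
  using LBINT_inverse_1_plus_square
  by (simp add: interval_lebesgue_integral_def set_lebesgue_integral_def)

text \<open>The error of smoothing an \<open>L\<close>-Lipschitz function bounded by 1, after the
  substitution t = x + y s. The cutoff at 2 comes from boundedness and keeps the integral finite;
  \<open>L * y * \<bar>s\<bar>\<close> alone is not integrable against the kernel.\<close>

definition lip_error :: "real \<Rightarrow> real \<Rightarrow> real" where
  "lip_error L y = (\<integral>s. min (L * y * \<bar>s\<bar>) 2 * inverse (1 + s\<^sup>2) \<partial>lborel)"

lemma lip_error_integrable:
  assumes "L \<ge> 0" "y \<ge> 0"
  shows "integrable lborel (\<lambda>s::real. min (L * y * \<bar>s\<bar>) 2 * inverse (1 + s\<^sup>2))"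
proof (rule Bochner_Integration.integrable_bound[OF integrable_mult_right[OF integrable_inverse_one_plus_square, of 2]])
  show "AE s in lborel. norm (min (L * y * \<bar>s\<bar>) 2 * inverse (1 + s\<^sup>2)) \<le> norm (2 * inverse (1 + s\<^sup>2))"
    using assms by (intro AE_I2) (auto simp: abs_mult intro!: mult_right_mono)
qed measurable

lemma lip_error_tendsto:
  assumes L: "L \<ge> 0"
  shows "(\<lambda>j. lip_error L (1 / real (Suc j))) \<longlonglongrightarrow> 0"
proof -
  have "(\<lambda>j. lip_error L (1 / real (Suc j))) \<longlonglongrightarrow> (\<integral>s. 0 \<partial>(lborel :: real measure))"
    unfolding lip_error_def
  proof (rule integral_dominated_convergence[where w = "\<lambda>s. 2 * inverse (1 + s\<^sup>2)"])
    show "integrable lborel (\<lambda>s::real. 2 * inverse (1 + s\<^sup>2))"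
      by (intro integrable_mult_right integrable_inverse_one_plus_square)
    show "AE s in lborel. (\<lambda>j. min (L * (1 / real (Suc j)) * \<bar>s\<bar>) 2 * inverse (1 + s\<^sup>2)) \<longlonglongrightarrow> 0"
    proof (rule AE_I2)
      fix s :: real
      have "(\<lambda>j. min (L * (1 / real (Suc j)) * \<bar>s\<bar>) 2 * inverse (1 + s\<^sup>2)) \<longlonglongrightarrow> min (L * 0 * \<bar>s\<bar>) 2 * inverse (1 + s\<^sup>2)"
        using LIMSEQ_inverse_real_of_nat by (intro tendsto_intros tendsto_min) (simp add: inverse_eq_divide)
      then show "(\<lambda>j. min (L * (1 / real (Suc j)) * \<bar>s\<bar>) 2 * inverse (1 + s\<^sup>2)) \<longlonglongrightarrow> 0" by simp
    qed
    show "AE s in lborel. norm (min (L * (1 / real (Suc j)) * \<bar>s\<bar>) 2 * inverse (1 + s\<^sup>2)) \<le> 2 * inverse (1 + s\<^sup>2)" for j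
      using L by (intro AE_I2) (auto simp: abs_mult intro!: mult_right_mono)
  qed measurable
  then show ?thesis by simp
qed

text \<open>The substitution t = x + y s turns the kernel into the Cauchy density up to its factor
  pi, and both terms become integrals against it.\<close>

lemma poisson_kernel_approximates:
  fixes f :: "real \<Rightarrow> real"
  assumes [measurable]: "f \<in> borel_measurable borel" and y: "y > 0" and L: "L \<ge> 0"
    and bd: "\<And>x. \<bar>f x\<bar> \<le> 1" and lip: "\<And>s t. \<bar>f s - f t\<bar> \<le> L * \<bar>s - t\<bar>"
  shows "\<bar>(\<integral>t. f t * (y / ((x - t)\<^sup>2 + y\<^sup>2)) \<partial>lborel) - pi * f x\<bar> \<le> lip_error L y"
proof -
  have kern: "f (x + y * s) * (y / ((x - (x + y * s))\<^sup>2 + y\<^sup>2)) = (1 / y) * (f (x + y * s) * inverse (1 + s\<^sup>2))" for s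
  proof -
    have "(x - (x + y * s))\<^sup>2 + y\<^sup>2 = y * y * (1 + s\<^sup>2)" by (simp add: power2_eq_square algebra_simps)
    moreover have "1 + s\<^sup>2 > 0" by (simp add: add_pos_nonneg)
    ultimately show ?thesis using y by (simp only:) (simp add: divide_simps)
  qed
  have "(\<integral>t. f t * (y / ((x - t)\<^sup>2 + y\<^sup>2)) \<partial>lborel)
      = \<bar>y\<bar> *\<^sub>R (\<integral>s. f (x + y * s) * (y / ((x - (x + y * s))\<^sup>2 + y\<^sup>2)) \<partial>lborel)"
    using y by (intro lborel_integral_real_affine) auto
  also have "\<dots> = (\<integral>s. f (x + y * s) * inverse (1 + s\<^sup>2) \<partial>lborel)"
    unfolding kern using y by simp
  finally have 1: "(\<integral>t. f t * (y / ((x - t)\<^sup>2 + y\<^sup>2)) \<partial>lborel) = (\<integral>s. f (x + y * s) * inverse (1 + s\<^sup>2) \<partial>lborel)" .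
  have 2: "pi * f x = (\<integral>s. f x * inverse (1 + s\<^sup>2) \<partial>lborel)"
    by (simp add: integral_inverse_one_plus_square)
  have I1: "integrable lborel (\<lambda>s. f (x + y * s) * inverse (1 + s\<^sup>2))"
  proof (rule Bochner_Integration.integrable_bound[OF integrable_inverse_one_plus_square])
    show "AE s in lborel. norm (f (x + y * s) * inverse (1 + s\<^sup>2)) \<le> norm (inverse (1 + s\<^sup>2))"
      using bd by (intro AE_I2) (auto simp: abs_mult intro!: mult_left_le_one_le)
  qed measurable
  have I2: "integrable lborel (\<lambda>s. f x * inverse (1 + s\<^sup>2))"
    by (intro integrable_mult_right integrable_inverse_one_plus_square)
  have "\<bar>(\<integral>t. f t * (y / ((x - t)\<^sup>2 + y\<^sup>2)) \<partial>lborel) - pi * f x\<bar>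
     = \<bar>\<integral>s. f (x + y * s) * inverse (1 + s\<^sup>2) - f x * inverse (1 + s\<^sup>2) \<partial>lborel\<bar>"
    unfolding 1 2 using I1 I2 by simp
  also have "\<dots> \<le> (\<integral>s. \<bar>f (x + y * s) * inverse (1 + s\<^sup>2) - f x * inverse (1 + s\<^sup>2)\<bar> \<partial>lborel)"
    by (rule integral_abs_bound)
  also have "\<dots> \<le> lip_error L y" unfolding lip_error_def
  proof (rule integral_mono)
    show "integrable lborel (\<lambda>s. \<bar>f (x + y * s) * inverse (1 + s\<^sup>2) - f x * inverse (1 + s\<^sup>2)\<bar>)"
      using I1 I2 by auto
    show "integrable lborel (\<lambda>s. min (L * y * \<bar>s\<bar>) 2 * inverse (1 + s\<^sup>2))"
      using L y by (intro lip_error_integrable) auto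
    fix s :: real
    have "\<bar>f (x + y * s) * inverse (1 + s\<^sup>2) - f x * inverse (1 + s\<^sup>2)\<bar> = \<bar>f (x + y * s) - f x\<bar> * inverse (1 + s\<^sup>2)"
      by (simp add: left_diff_distrib[symmetric] abs_mult)
    also have "\<bar>f (x + y * s) - f x\<bar> \<le> min (L * y * \<bar>s\<bar>) 2"
      using lip[of "x + y * s" x] bd[of "x + y * s"] bd[of x] y by (auto simp: abs_mult mult.assoc)
    finally show "\<bar>f (x + y * s) * inverse (1 + s\<^sup>2) - f x * inverse (1 + s\<^sup>2)\<bar> \<le> min (L * y * \<bar>s\<bar>) 2 * inverse (1 + s\<^sup>2)"
      by (simp add: mult_right_mono)
  qed
  finally show ?thesis .
qed

text \<open>The bound depends only on \<open>L\<close> and \<open>y\<close>, hence is the same for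
  all probability measures; this uniformity replaces a tightness argument.\<close>

lemma integral_poisson_approx:
  fixes f :: "real \<Rightarrow> real"
  assumes M: "prob_space M" and sM [measurable_cong]: "sets M = sets borel"
    and f: "integrable lborel f" and y: "y > 0" and L: "L \<ge> 0"
    and bd: "\<And>x. \<bar>f x\<bar> \<le> 1" and lip: "\<And>s t. \<bar>f s - f t\<bar> \<le> L * \<bar>s - t\<bar>"
  shows "\<bar>(\<integral>t. f t * poisson_transform M y t \<partial>lborel) - pi * (\<integral>x. f x \<partial>M)\<bar> \<le> lip_error L y"
proof -
  interpret M: prob_space M by (rule M)
  have [measurable]: "f \<in> borel_measurable borel" using borel_measurable_integrable[OF f] by simp
  let ?g = "\<lambda>x. \<integral>t. f t * (y / ((x - t)\<^sup>2 + y\<^sup>2)) \<partial>lborel"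
  have I: "integrable M ?g" by (rule poisson_fubini(2)[OF M sM y f])
  have If: "integrable M f" using bd by (intro M.integrable_const_bound[where B = 1]) auto
  have "(\<integral>t. f t * poisson_transform M y t \<partial>lborel) - pi * (\<integral>x. f x \<partial>M) = (\<integral>x. ?g x - pi * f x \<partial>M)"
    using I If by (simp add: poisson_fubini(1)[OF M sM y f, symmetric] del: times_divide_eq_right)
  also have "\<bar>\<dots>\<bar> \<le> (\<integral>x. \<bar>?g x - pi * f x\<bar> \<partial>M)" by (rule integral_abs_bound)
  also have "\<dots> \<le> (\<integral>x. lip_error L y \<partial>M)"
    using I If by (intro integral_mono poisson_kernel_approximates y L bd lip) (auto simp del: times_divide_eq_right)
  finally show ?thesis by (simp add: M.prob_space)
qed

context jacobi
begin

lemma integral_tendsto_of_orthonormal: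
  fixes f :: "real \<Rightarrow> real"
  assumes M: "\<And>k. orthonormal_upto (r k) (M k)" and r: "filterlim r at_top sequentially"
    and \<mu>: "\<And>n. orthonormal_upto n \<mu>" and ns: "\<not> summable (\<lambda>n. 1 / a n)"
    and f: "integrable lborel f" and L: "L \<ge> 0"
    and bd: "\<And>x. \<bar>f x\<bar> \<le> 1" and lip: "\<And>s t. \<bar>f s - f t\<bar> \<le> L * \<bar>s - t\<bar>"
  shows "(\<lambda>k. \<integral>x. f x \<partial>M k) \<longlonglongrightarrow> (\<integral>x. f x \<partial>\<mu>)"
proof (rule tendstoI)
  fix e :: real assume e: "e > 0"
  have pM: "prob_space (M k)" "sets (M k) = sets borel" for k using M[of k] by (auto simp: orthonormal_upto_def)
  have p\<mu>: "prob_space \<mu>" "sets \<mu> = sets borel" using \<mu>[of 0] by (auto simp: orthonormal_upto_def)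
  have [measurable]: "f \<in> borel_measurable borel" using borel_measurable_integrable[OF f] by simp
  \<comment> \<open>The height \<open>y\<close> is chosen before \<open>k\<close>, which the uniform
    bound of \<open>integral_poisson_approx\<close> permits.\<close>
  from LIMSEQ_D[OF lip_error_tendsto[OF L], of e] e obtain j where j: "\<bar>lip_error L (1 / real (Suc j))\<bar> < e"
    by auto
  define y where "y = 1 / real (Suc j)"
  have y: "y > 0" and je: "lip_error L y < e" using j by (auto simp: y_def)
  have pt: "(\<lambda>k. poisson_transform (M k) y t) \<longlonglongrightarrow> poisson_transform \<mu> y t" for t
    using tendsto_Im[OF stieltjes_transform_tendsto[OF M r \<mu> ns, of "Complex t y"]] y
    by (simp add: poisson_transform_eq_Im[OF pM y] poisson_transform_eq_Im[OF p\<mu> y] resolvent_coeff_def)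
  have "(\<lambda>k. \<integral>t. f t * poisson_transform (M k) y t \<partial>lborel) \<longlonglongrightarrow> (\<integral>t. f t * poisson_transform \<mu> y t \<partial>lborel)"
  proof (rule integral_dominated_convergence[where w = "\<lambda>t. (1 / y) * norm (f t)"])
    show "integrable lborel (\<lambda>t. (1 / y) * norm (f t))" using f by (intro integrable_mult_right integrable_norm)
    show "AE t in lborel. (\<lambda>k. f t * poisson_transform (M k) y t) \<longlonglongrightarrow> f t * poisson_transform \<mu> y t"
      using pt by (intro AE_I2 tendsto_intros)
    show "AE t in lborel. norm (f t * poisson_transform (M k) y t) \<le> (1 / y) * norm (f t)" for k
    proof (rule AE_I2)
      fix t
      have "norm (f t * poisson_transform (M k) y t) = poisson_transform (M k) y t * \<bar>f t\<bar>"
        using poisson_transform_bounds(1)[OF pM y, of k t] by (simp add: abs_mult)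
      also have "\<dots> \<le> 1 / y * \<bar>f t\<bar>"
        by (intro mult_right_mono poisson_transform_bounds(2)[OF pM y]) auto
      finally show "norm (f t * poisson_transform (M k) y t) \<le> (1 / y) * norm (f t)" by simp
    qed
  qed (use poisson_transform_measurable[OF pM] poisson_transform_measurable[OF p\<mu>] in \<open>auto intro!: borel_measurable_times\<close>)
  from tendstoD[OF this e]
  show "\<forall>\<^sub>F k in sequentially. dist (\<integral>x. f x \<partial>M k) (\<integral>x. f x \<partial>\<mu>) < e"
  proof eventually_elim
    case (elim k)
    let ?A = "\<integral>t. f t * poisson_transform (M k) y t \<partial>lborel" and ?B = "\<integral>t. f t * poisson_transform \<mu> y t \<partial>lborel"
    have "\<bar>?A - pi * (\<integral>x. f x \<partial>M k)\<bar> < e" "\<bar>?B - pi * (\<integral>x. f x \<partial>\<mu>)\<bar> < e"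
      using integral_poisson_approx[OF pM f y L bd lip, of k] integral_poisson_approx[OF p\<mu> f y L bd lip] je by auto
    with elim have "\<bar>pi * (\<integral>x. f x \<partial>M k) - pi * (\<integral>x. f x \<partial>\<mu>)\<bar> < 3 * e"
      by (auto simp: dist_real_def)
    also have "\<bar>pi * (\<integral>x. f x \<partial>M k) - pi * (\<integral>x. f x \<partial>\<mu>)\<bar> = pi * \<bar>(\<integral>x. f x \<partial>M k) - (\<integral>x. f x \<partial>\<mu>)\<bar>"
      by (simp add: right_diff_distrib[symmetric] abs_mult)
    \<comment> \<open>Two smoothing errors and one convergence error, each below \<open>e\<close>,
      are compared with pi times the target, so pi > 3 absorbs them.\<close>
    also have "3 * e < pi * e" using pi_gt3 e by simp
    finally have "pi * \<bar>(\<integral>x. f x \<partial>M k) - (\<integral>x. f x \<partial>\<mu>)\<bar> < pi * e" .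
    then show ?case by (simp add: dist_real_def)
  qed
qed

end

section \<open>The limiting quadratic form\<close>

lemma sin_three_term: "sin (t + \<phi>) = 2 * cos \<phi> * sin t - sin (t - \<phi>)" for t \<phi> :: real
  by (simp add: sin_add sin_diff)

lemma chebw_nat_sin: "sin \<theta> \<noteq> 0 \<Longrightarrow> chebw_nat n (2 * cos \<theta>) = sin (real (Suc n) * \<theta>) / sin \<theta>"
proof (induction n rule: induct_nat_012)
  case 1
  then show ?case by (simp add: sin_double)
next
  case (ge2 n)
  have "sin (real (Suc (Suc (Suc n))) * \<theta>) = 2 * cos \<theta> * sin (real (Suc (Suc n)) * \<theta>) - sin (real (Suc n) * \<theta>)"
  proof -
    have "real (Suc (Suc (Suc n))) * \<theta> = real (Suc (Suc n)) * \<theta> + \<theta>" "real (Suc n) * \<theta> = real (Suc (Suc n)) * \<theta> - \<theta>"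
      by (simp_all add: algebra_simps)
    then show ?thesis by (simp only: sin_three_term)
  qed
  then show ?case using ge2 by (simp add: field_simps)
qed simp

lemma chebw_sin:
  assumes "sin \<theta> \<noteq> 0"
  shows "chebw k (2 * cos \<theta>) = sin ((of_int k + 1) * \<theta>) / sin \<theta>"
proof -
  consider "k \<ge> 0" | "k = -1" | "k \<le> -2" by linarith
  then show ?thesis
  proof cases
    case 1
    then show ?thesis using chebw_nat_sin[OF assms, of "nat k"] by (simp add: chebw_def algebra_simps)
  next
    case 3
    have "real (Suc (nat (- k - 2))) * \<theta> = - ((of_int k + 1) * \<theta>)"
      using 3 by (simp add: algebra_simps)
    then show ?thesis using 3 chebw_nat_sin[OF assms, of "nat (- k - 2)"] by (simp add: chebw_def)
  qed (simp add: chebw_def)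
qed

text \<open>exp(2 i \<phi>) is an \<open>N\<close>-th root of unity different from 1, so sums over
  the double angle vanish. In real form: multiply by \<open>2 * sin \<phi>\<close> and
  telescope.\<close>

lemma sum_root_of_unity:
  assumes S: "sin \<phi> \<noteq> 0" and N: "sin (real N * \<phi>) = 0"
  shows "(\<Sum>j<N. (sin (real j * \<phi>))\<^sup>2) = real N / 2"
    and "(\<Sum>j<N. (cos (real j * \<phi>))\<^sup>2) = real N / 2"
    and "(\<Sum>j<N. sin (real j * \<phi>) * cos (real j * \<phi>)) = 0"
proof -
  have c2: "(cos (real N * \<phi>))\<^sup>2 = 1" using N by (simp add: cos_squared_eq)
  have r: "2 * real N * \<phi> = 2 * (real N * \<phi>)" by simp
  have cN: "cos (2 * real N * \<phi>) = 1" and sN: "sin (2 * real N * \<phi>) = 0"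
    unfolding r cos_double sin_double using c2 N by auto
  have "2 * sin \<phi> * (\<Sum>j<N. cos (2 * real j * \<phi>)) = (\<Sum>j<N. sin (2 * real (Suc j) * \<phi> - \<phi>) - sin (2 * real j * \<phi> - \<phi>))"
    unfolding sum_distrib_left
  proof (rule sum.cong[OF refl])
    fix j
    have "2 * real (Suc j) * \<phi> - \<phi> = 2 * real j * \<phi> + \<phi>" by (simp add: algebra_simps)
    then show "2 * sin \<phi> * cos (2 * real j * \<phi>) = sin (2 * real (Suc j) * \<phi> - \<phi>) - sin (2 * real j * \<phi> - \<phi>)"
      by (simp only: sin_add sin_diff) simp
  qed
  also have "\<dots> = sin (2 * real N * \<phi> - \<phi>) - sin (2 * real 0 * \<phi> - \<phi>)"
    by (rule sum_lessThan_telescope)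
  also have "\<dots> = 0" by (simp add: sin_diff cN sN)
  finally have C0: "(\<Sum>j<N. cos (2 * real j * \<phi>)) = 0" using S by simp
  have "2 * sin \<phi> * (\<Sum>j<N. sin (2 * real j * \<phi>)) = (\<Sum>j<N. - cos (2 * real (Suc j) * \<phi> - \<phi>) - - cos (2 * real j * \<phi> - \<phi>))"
    unfolding sum_distrib_left
  proof (rule sum.cong[OF refl])
    fix j
    have "2 * real (Suc j) * \<phi> - \<phi> = 2 * real j * \<phi> + \<phi>" by (simp add: algebra_simps)
    then show "2 * sin \<phi> * sin (2 * real j * \<phi>) = - cos (2 * real (Suc j) * \<phi> - \<phi>) - - cos (2 * real j * \<phi> - \<phi>)"
      by (simp only: cos_add cos_diff) simp
  qed
  also have "\<dots> = - cos (2 * real N * \<phi> - \<phi>) - - cos (2 * real 0 * \<phi> - \<phi>)"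
    by (rule sum_lessThan_telescope[of "\<lambda>j. - cos (2 * real j * \<phi> - \<phi>)"])
  also have "\<dots> = 0" by (simp add: cos_diff cN sN)
  finally have S0: "(\<Sum>j<N. sin (2 * real j * \<phi>)) = 0" using S by simp
  have r': "2 * real j * \<phi> = 2 * (real j * \<phi>)" for j by simp
  have quad: "(sin (real j * \<phi>))\<^sup>2 = (1 - cos (2 * real j * \<phi>)) / 2" "(cos (real j * \<phi>))\<^sup>2 = (1 + cos (2 * real j * \<phi>)) / 2"
    "sin (real j * \<phi>) * cos (real j * \<phi>) = sin (2 * real j * \<phi>) / 2" for j
    unfolding r' by (simp_all add: cos_double sin_double cos_squared_eq)
  show "(\<Sum>j<N. (sin (real j * \<phi>))\<^sup>2) = real N / 2" "(\<Sum>j<N. (cos (real j * \<phi>))\<^sup>2) = real N / 2"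
     "(\<Sum>j<N. sin (real j * \<phi>) * cos (real j * \<phi>)) = 0"
    unfolding quad sum_divide_distrib[symmetric] sum_subtractf sum.distrib C0 S0 by simp_all
qed

section \<open>First-order expansion of the transfer matrix\<close>

fun limit_sol :: "real \<Rightarrow> real \<Rightarrow> real \<Rightarrow> nat \<Rightarrow> real" where
  "limit_sol q c0 c1 0 = c0"
| "limit_sol q c0 c1 (Suc 0) = c1"
| "limit_sol q c0 c1 (Suc (Suc l)) = - q * limit_sol q c0 c1 (Suc l) - limit_sol q c0 c1 l"

text \<open>The coefficient of \<open>1 / a\<close> in the perturbed recurrence: (x - b) / a is
  about -q + x / a and the ratio of consecutive \<open>a\<close> is about 1 - s / a, which yields
  the two source terms.\<close>

fun limit_pert :: "real \<Rightarrow> (nat \<Rightarrow> real) \<Rightarrow> real \<Rightarrow> real \<Rightarrow> nat \<Rightarrow> real \<Rightarrow> real" where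
  "limit_pert q s c0 c1 0 x = 0"
| "limit_pert q s c0 c1 (Suc 0) x = 0"
| "limit_pert q s c0 c1 (Suc (Suc l)) x = - q * limit_pert q s c0 c1 (Suc l) x - limit_pert q s c0 c1 l x
     + x * limit_sol q c0 c1 (Suc l) + s l * limit_sol q c0 c1 l"

lemma continuous_limit_pert [continuous_intros]: "continuous_on S (limit_pert q s c0 c1 l)"
proof (induction l rule: induct_nat_012)
  case (ge2 l)
  have "limit_pert q s c0 c1 (Suc (Suc l)) = (\<lambda>x. - q * limit_pert q s c0 c1 (Suc l) x - limit_pert q s c0 c1 l x
     + x * limit_sol q c0 c1 (Suc l) + s l * limit_sol q c0 c1 l)" by auto
  then show ?case using ge2 by (auto intro!: continuous_intros)
qed auto

context
  fixes \<phi> q :: real and N :: nat and s :: "nat \<Rightarrow> real"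
  assumes q: "q = - 2 * cos \<phi>" and S: "sin \<phi> \<noteq> 0" and N: "sin (real N * \<phi>) = 0"
    and s0: "(\<Sum>j<N. s j) = 0"
begin

lemma limit_sol_01: "limit_sol q 0 1 l = sin (real l * \<phi>) / sin \<phi>"
proof (induction l rule: induct_nat_012)
  case (ge2 l)
  have "real (Suc (Suc l)) * \<phi> = real (Suc l) * \<phi> + \<phi>" "real l * \<phi> = real (Suc l) * \<phi> - \<phi>"
    by (simp_all add: algebra_simps)
  then have "sin (real (Suc (Suc l)) * \<phi>) = - q * sin (real (Suc l) * \<phi>) - sin (real l * \<phi>)"
    unfolding q by (simp only: sin_three_term; simp)
  then show ?case using ge2 S by (simp add: field_simps)
qed (use S in auto)

lemma limit_sol_10: "limit_sol q 1 0 l = - (sin (real l * \<phi> - \<phi>) / sin \<phi>)"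
proof (induction l rule: induct_nat_012)
  case (ge2 l)
  have "real (Suc (Suc l)) * \<phi> - \<phi> = (real (Suc l) * \<phi> - \<phi>) + \<phi>" "real l * \<phi> - \<phi> = (real (Suc l) * \<phi> - \<phi>) - \<phi>"
    by (simp_all add: algebra_simps)
  then have "sin (real (Suc (Suc l)) * \<phi> - \<phi>) = - q * sin (real (Suc l) * \<phi> - \<phi>) - sin (real l * \<phi> - \<phi>)"
    unfolding q by (simp only: sin_three_term; simp)
  then show ?case using ge2 S by (simp add: field_simps)
qed (use S in auto)

text \<open>The \<open>N\<close>-th power of the limiting transfer matrix is scalar: both
  off-diagonal entries vanish and the diagonal entries agree.\<close>

lemma limit_sol_N:
  "limit_sol q 0 1 N = 0" "limit_sol q 1 0 (Suc N) = 0" "limit_sol q 1 0 N = limit_sol q 0 1 (Suc N)"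
  unfolding limit_sol_01 limit_sol_10 using N S
  by (simp_all add: ring_distribs sin_add sin_diff)

text \<open>Variation of constants with kernel \<open>limit_sol q 0 1\<close> at l - 1 - j. The
  subtraction is done inside the sine, on reals, so the last summand is simply 0.\<close>

lemma limit_pert_sum:
  "limit_pert q s c0 c1 l x = (\<Sum>j<l. sin (real l * \<phi> - \<phi> - real j * \<phi>) / sin \<phi> *
      (x * limit_sol q c0 c1 (Suc j) + s j * limit_sol q c0 c1 j))"
proof (induction l rule: induct_nat_012)
  case (ge2 l)
  let ?f = "\<lambda>j. x * limit_sol q c0 c1 (Suc j) + s j * limit_sol q c0 c1 j"
  have e1: "(\<Sum>j<Suc (Suc l). sin (real (Suc (Suc l)) * \<phi> - \<phi> - real j * \<phi>) / sin \<phi> * ?f j)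
      = (\<Sum>j<l. sin (real (Suc (Suc l)) * \<phi> - \<phi> - real j * \<phi>) / sin \<phi> * ?f j) + ?f l"
    using S by (simp add: algebra_simps)
  have e2: "(\<Sum>j<Suc l. sin (real (Suc l) * \<phi> - \<phi> - real j * \<phi>) / sin \<phi> * ?f j)
      = (\<Sum>j<l. sin (real (Suc l) * \<phi> - \<phi> - real j * \<phi>) / sin \<phi> * ?f j)"
    by (simp add: algebra_simps)
  have e3: "sin (real (Suc (Suc l)) * \<phi> - \<phi> - real j * \<phi>)
      = - q * sin (real (Suc l) * \<phi> - \<phi> - real j * \<phi>) - sin (real l * \<phi> - \<phi> - real j * \<phi>)" for j
  proof -
    have "real (Suc (Suc l)) * \<phi> - \<phi> - real j * \<phi> = (real (Suc l) * \<phi> - \<phi> - real j * \<phi>) + \<phi>"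
      "real l * \<phi> - \<phi> - real j * \<phi> = (real (Suc l) * \<phi> - \<phi> - real j * \<phi>) - \<phi>"
      by (simp_all add: algebra_simps)
    then show ?thesis unfolding q by (simp only: sin_three_term; simp)
  qed
  have gen: "(- q * A - B) / D * F = - q * (A / D * F) - B / D * F" for A B D F :: real
    by (simp add: diff_divide_distrib left_diff_distrib)
  have "(\<Sum>j<l. sin (real (Suc (Suc l)) * \<phi> - \<phi> - real j * \<phi>) / sin \<phi> * ?f j)
     = - q * (\<Sum>j<l. sin (real (Suc l) * \<phi> - \<phi> - real j * \<phi>) / sin \<phi> * ?f j)
       - (\<Sum>j<l. sin (real l * \<phi> - \<phi> - real j * \<phi>) / sin \<phi> * ?f j)"
    unfolding sum_distrib_left sum_subtractf[symmetric] e3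
    by (intro sum.cong refl gen)
  then show ?case unfolding e1 limit_pert.simps(3) ge2.IH e2 by simp
qed auto

text \<open>Since \<open>sin (real N * \<phi>)\<close> is 0, the kernel at \<open>N\<close>
  collapses to a sine of the summation index times the sign \<open>cos (real N * \<phi>)\<close>. At
  \<open>Suc N\<close> the extra summand vanishes for the same reason.\<close>

lemma limit_pert_N:
  "limit_pert q s c0 c1 N x = - cos (real N * \<phi>) * (\<Sum>j<N. sin (real j * \<phi> + \<phi>) / sin \<phi> *
      (x * limit_sol q c0 c1 (Suc j) + s j * limit_sol q c0 c1 j))"
  "limit_pert q s c0 c1 (Suc N) x = - cos (real N * \<phi>) * (\<Sum>j<N. sin (real j * \<phi>) / sin \<phi> *
      (x * limit_sol q c0 c1 (Suc j) + s j * limit_sol q c0 c1 j))"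
proof -
  have "sin (real N * \<phi> - \<phi> - real j * \<phi>) = - cos (real N * \<phi>) * sin (real j * \<phi> + \<phi>)" for j
    unfolding diff_diff_eq by (simp add: sin_diff N add.commute)
  then show "limit_pert q s c0 c1 N x = - cos (real N * \<phi>) * (\<Sum>j<N. sin (real j * \<phi> + \<phi>) / sin \<phi> *
      (x * limit_sol q c0 c1 (Suc j) + s j * limit_sol q c0 c1 j))"
    unfolding limit_pert_sum sum_distrib_left by (intro sum.cong refl) simp
  have e: "sin (real (Suc N) * \<phi> - \<phi> - real j * \<phi>) = - cos (real N * \<phi>) * sin (real j * \<phi>)" for j
    by (simp add: ring_distribs sin_diff N)
  show "limit_pert q s c0 c1 (Suc N) x = - cos (real N * \<phi>) * (\<Sum>j<N. sin (real j * \<phi>) / sin \<phi> *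
      (x * limit_sol q c0 c1 (Suc j) + s j * limit_sol q c0 c1 j))"
    unfolding limit_pert_sum sum_distrib_left sum.lessThan_Suc e by (simp add: N mult.assoc)
qed

text \<open>Because the \<open>s j\<close> sum to 0, \<open>2 * E1\<close> and
  \<open>- 2 * E2\<close> are the imaginary and real parts of the sum of s_j exp(2 i j \<phi>). Only
  the modulus of this Fourier coefficient enters \<open>hfun\<close>.\<close>

private definition "E1 = (\<Sum>j<N. s j * (sin (real j * \<phi>) * cos (real j * \<phi>)))"
private definition "E2 = (\<Sum>j<N. s j * (sin (real j * \<phi>))\<^sup>2)"

private lemma E2': "(\<Sum>j<N. s j * (cos (real j * \<phi>))\<^sup>2) = - E2"
proof -
  have "(\<Sum>j<N. s j * (cos (real j * \<phi>))\<^sup>2) + E2 = (\<Sum>j<N. s j * ((cos (real j * \<phi>))\<^sup>2 + (sin (real j * \<phi>))\<^sup>2))"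
    by (simp only: E2_def distrib_left sum.distrib)
  also have "\<dots> = 0" using s0 by simp
  finally show ?thesis by simp
qed

text \<open>Every entry of the perturbation is such a sum, with coefficients affine in
  \<open>s j\<close>; this evaluates them all at once.\<close>

private lemma quadratic_sum:
  "(\<Sum>j<N. (c1 + d1 * s j) * (sin (real j * \<phi>))\<^sup>2 + (c2 + d2 * s j) * (sin (real j * \<phi>) * cos (real j * \<phi>))
     + (c3 + d3 * s j) * (cos (real j * \<phi>))\<^sup>2)
   = c1 * (N / 2) + d1 * E2 + d2 * E1 + c3 * (N / 2) - d3 * E2"
proof -
  have "(\<Sum>j<N. (c1 + d1 * s j) * (sin (real j * \<phi>))\<^sup>2 + (c2 + d2 * s j) * (sin (real j * \<phi>) * cos (real j * \<phi>))
     + (c3 + d3 * s j) * (cos (real j * \<phi>))\<^sup>2)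
    = c1 * (\<Sum>j<N. (sin (real j * \<phi>))\<^sup>2) + d1 * E2 + (c2 * (\<Sum>j<N. sin (real j * \<phi>) * cos (real j * \<phi>)) + d2 * E1)
      + (c3 * (\<Sum>j<N. (cos (real j * \<phi>))\<^sup>2) + d3 * (\<Sum>j<N. s j * (cos (real j * \<phi>))\<^sup>2))"
    unfolding E1_def E2_def by (simp add: distrib_right sum.distrib sum_distrib_left mult.assoc)
  then show ?thesis unfolding sum_root_of_unity[OF S N] E2' by simp
qed

lemma limit_form_coeffs:
  defines "\<gamma> \<equiv> cos (real N * \<phi>)"
  shows "limit_pert q s 0 1 N x = - \<gamma> / (sin \<phi>)\<^sup>2 * (x * N / 2 + cos \<phi> * E2 + sin \<phi> * E1)"
    and "limit_pert q s 1 0 N x - limit_pert q s 0 1 (Suc N) x = \<gamma> / (sin \<phi>)\<^sup>2 * (x * cos \<phi> * N + 2 * E2)"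
    and "limit_pert q s 1 0 (Suc N) x = \<gamma> / (sin \<phi>)\<^sup>2 * (x * N / 2 + cos \<phi> * E2 - sin \<phi> * E1)"
proof -
  let ?s = "\<lambda>j. sin (real j * \<phi>)" and ?c = "\<lambda>j. cos (real j * \<phi>)" and ?S = "sin \<phi>" and ?C = "cos \<phi>"
  have SC: "?S\<^sup>2 + ?C\<^sup>2 = 1" by simp
  have shift: "real (Suc j) * \<phi> = real j * \<phi> + \<phi>" "real (Suc j) * \<phi> - \<phi> = real j * \<phi>" for j by (simp_all add: algebra_simps)
  have "(\<Sum>j<N. sin (real j * \<phi> + \<phi>) / ?S * (x * limit_sol q 0 1 (Suc j) + s j * limit_sol q 0 1 j))
    = (\<Sum>j<N. (x * ?C\<^sup>2 / ?S\<^sup>2 + ?C / ?S\<^sup>2 * s j) * (?s j)\<^sup>2 + (2 * x * ?C * ?S / ?S\<^sup>2 + ?S / ?S\<^sup>2 * s j) * (?s j * ?c j)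
     + (x * ?S\<^sup>2 / ?S\<^sup>2 + 0 * s j) * (?c j)\<^sup>2)"
    unfolding limit_sol_01 shift sin_add using S
    by (intro sum.cong refl) (simp add: field_simps power2_eq_square)
  also have "\<dots> = x * ?C\<^sup>2 / ?S\<^sup>2 * (N / 2) + ?C / ?S\<^sup>2 * E2 + ?S / ?S\<^sup>2 * E1 + x * ?S\<^sup>2 / ?S\<^sup>2 * (N / 2) - 0 * E2"
    by (rule quadratic_sum)
  also have "\<dots> = 1 / ?S\<^sup>2 * (x * (?S\<^sup>2 + ?C\<^sup>2) * N / 2 + ?C * E2 + ?S * E1)"
    by (simp only: add_divide_distrib distrib_left distrib_right) (simp del: sin_cos_squared_add sin_cos_squared_add2)
  finally show "limit_pert q s 0 1 N x = - \<gamma> / ?S\<^sup>2 * (x * N / 2 + ?C * E2 + ?S * E1)"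
    unfolding limit_pert_N \<gamma>_def SC by simp
  have "(\<Sum>j<N. sin (real j * \<phi>) / ?S * (x * limit_sol q 1 0 (Suc j) + s j * limit_sol q 1 0 j))
    = (\<Sum>j<N. (- x / ?S\<^sup>2 + - ?C / ?S\<^sup>2 * s j) * (?s j)\<^sup>2 + (0 + ?S / ?S\<^sup>2 * s j) * (?s j * ?c j)
     + (0 + 0 * s j) * (?c j)\<^sup>2)"
    unfolding limit_sol_10 shift(2) sin_diff using S
    by (intro sum.cong refl) (simp add: field_simps power2_eq_square)
  also have "\<dots> = - x / ?S\<^sup>2 * (N / 2) + - ?C / ?S\<^sup>2 * E2 + ?S / ?S\<^sup>2 * E1 + 0 * (N / 2) - 0 * E2"
    by (rule quadratic_sum)
  also have "\<dots> = - 1 / ?S\<^sup>2 * (x * N / 2 + ?C * E2 - ?S * E1)"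
    using S by (simp add: field_simps)
  finally show "limit_pert q s 1 0 (Suc N) x = \<gamma> / ?S\<^sup>2 * (x * N / 2 + ?C * E2 - ?S * E1)"
    unfolding limit_pert_N \<gamma>_def by simp
  have "(\<Sum>j<N. sin (real j * \<phi> + \<phi>) / ?S * (x * limit_sol q 1 0 (Suc j) + s j * limit_sol q 1 0 j))
    = (\<Sum>j<N. (- x * ?C / ?S\<^sup>2 + - ?C\<^sup>2 / ?S\<^sup>2 * s j) * (?s j)\<^sup>2 + (- x * ?S / ?S\<^sup>2 + 0 * s j) * (?s j * ?c j)
     + (0 + ?S\<^sup>2 / ?S\<^sup>2 * s j) * (?c j)\<^sup>2)"
    unfolding limit_sol_10 shift(2) sin_diff sin_add using S
    by (intro sum.cong refl) (simp add: field_simps power2_eq_square)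
  also have "\<dots> = - x * ?C / ?S\<^sup>2 * (N / 2) + - ?C\<^sup>2 / ?S\<^sup>2 * E2 + 0 * E1 + 0 * (N / 2) - ?S\<^sup>2 / ?S\<^sup>2 * E2"
    by (rule quadratic_sum)
  also have "\<dots> = - 1 / ?S\<^sup>2 * (x * ?C * N / 2 + (?S\<^sup>2 + ?C\<^sup>2) * E2)"
    by (simp only: add_divide_distrib distrib_left distrib_right) (simp del: sin_cos_squared_add sin_cos_squared_add2)
  finally have a: "limit_pert q s 1 0 N x = \<gamma> / ?S\<^sup>2 * (x * ?C * N / 2 + E2)"
    unfolding limit_pert_N \<gamma>_def SC by simp
  have "(\<Sum>j<N. sin (real j * \<phi>) / ?S * (x * limit_sol q 0 1 (Suc j) + s j * limit_sol q 0 1 j))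
    = (\<Sum>j<N. (x * ?C / ?S\<^sup>2 + 1 / ?S\<^sup>2 * s j) * (?s j)\<^sup>2 + (x * ?S / ?S\<^sup>2 + 0 * s j) * (?s j * ?c j)
     + (0 + 0 * s j) * (?c j)\<^sup>2)"
    unfolding limit_sol_01 shift sin_add using S
    by (intro sum.cong refl) (simp add: field_simps power2_eq_square)
  also have "\<dots> = x * ?C / ?S\<^sup>2 * (N / 2) + 1 / ?S\<^sup>2 * E2 + 0 * E1 + 0 * (N / 2) - 0 * E2"
    by (rule quadratic_sum)
  also have "\<dots> = 1 / ?S\<^sup>2 * (x * ?C * N / 2 + E2)"
    using S by (simp add: field_simps)
  finally have b: "limit_pert q s 0 1 (Suc N) x = - \<gamma> / ?S\<^sup>2 * (x * ?C * N / 2 + E2)"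
    unfolding limit_pert_N \<gamma>_def by simp
  show "limit_pert q s 1 0 N x - limit_pert q s 0 1 (Suc N) x = \<gamma> / ?S\<^sup>2 * (x * ?C * N + 2 * E2)"
    unfolding a b by (simp add: algebra_simps)
qed

text \<open>With \<open>q = 2 * cos \<theta>\<close>, the addition formula splits the factor with
  index \<open>i - j\<close> into a part symmetric in \<open>i\<close> and \<open>j\<close>, which
  factors into products of single sums, and an antisymmetric part, which cancels in the double
  sum.\<close>

lemma hfun_closed_form: "hfun N q s x = (x\<^sup>2 * (real N)\<^sup>2 - 4 * (E1\<^sup>2 + E2\<^sup>2)) / (sin \<phi>)\<^sup>2"
proof -
  define \<theta> where "\<theta> = pi - \<phi>"
  have q': "q = 2 * cos \<theta>" and S': "sin \<theta> = sin \<phi>" by (simp_all add: \<theta>_def q)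
  have sj: "sin (real j * \<theta>) = - ((-1) ^ j) * sin (real j * \<phi>)" and cj: "cos (real j * \<theta>) = (-1) ^ j * cos (real j * \<phi>)" for j
    by (simp_all add: \<theta>_def right_diff_distrib sin_diff cos_diff)
  let ?s = "\<lambda>j. sin (real j * \<theta>)" and ?c = "\<lambda>j. cos (real j * \<theta>)"
  let ?t = "\<lambda>i j. s i * s j * chebw (int i - 1) q * chebw (int j - 1) q * chebw (int i - int j) q"
  have pw: "((-1::real) ^ j * (-1) ^ j) = 1" for j by (simp flip: power_add)
  have e1: "(\<Sum>j<N. s j * (?s j * ?c j)) = - E1"
    unfolding E1_def sum_negf[symmetric] sj cj by (intro sum.cong refl) (simp add: algebra_simps pw[THEN arg_cong[of _ _ "\<lambda>u. u * _"]])
  have e2: "(\<Sum>j<N. s j * (?s j * ?s j)) = E2"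
    unfolding E2_def sj by (intro sum.cong refl) (simp add: power2_eq_square)
  have t: "?t i j = ((s i * (?s i * ?c i)) * (s j * (?s j * ?c j)) + (s i * (?s i * ?s i)) * (s j * (?s j * ?s j))
      + cos \<theta> / sin \<theta> * ((s i * (?s i * ?s i)) * (s j * (?s j * ?c j)) - (s i * (?s i * ?c i)) * (s j * (?s j * ?s j)))) / (sin \<phi>)\<^sup>2" for i j
  proof -
    have arg: "(of_int (int i - int j) + 1) * \<theta> = (real i * \<theta> - real j * \<theta>) + \<theta>" by (simp add: algebra_simps)
    have c1: "chebw (int i - int j) q = sin ((real i * \<theta> - real j * \<theta>) + \<theta>) / sin \<theta>"
      unfolding q' arg[symmetric] by (rule chebw_sin) (use S S' in simp)
    have c2: "chebw (int i - 1) q = ?s i / sin \<theta>" for i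
      unfolding q' using chebw_sin[of \<theta> "int i - 1"] S S' by simp
    have S0: "sin \<theta> \<noteq> 0" using S S' by simp
    show ?thesis unfolding S'[symmetric] c1 c2 sin_add sin_diff cos_diff
      using S0 by (simp add: divide_simps) (simp add: power2_eq_square algebra_simps)
  qed
  \<comment> \<open>Terms with index 0 contain \<open>chebw (- 1) q\<close>, which is 0, so the
    range can start at 0 as in \<open>E1\<close> and \<open>E2\<close>.\<close>
  have "(\<Sum>i = 1..N - 1. \<Sum>j = 1..N - 1. ?t i j) = (\<Sum>i<N. \<Sum>j<N. ?t i j)"
  proof -
    have z: "?t 0 j = 0" "?t i 0 = 0" for i j by (simp_all add: chebw_def[of "- 1"])
    have drop0: "(\<Sum>j = 1..N - 1. f j) = (\<Sum>j<N. f j)" if "f 0 = 0" for f :: "nat \<Rightarrow> real"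
    proof (rule sum.mono_neutral_left)
      have "j = 0" if "j \<in> {..<N} - {1..N - 1}" for j using that by (simp, arith)
      with that show "\<forall>j\<in>{..<N} - {1..N - 1}. f j = 0" by metis
    qed auto
    have "(\<Sum>i = 1..N - 1. \<Sum>j = 1..N - 1. ?t i j) = (\<Sum>i = 1..N - 1. \<Sum>j<N. ?t i j)"
      by (intro sum.cong refl drop0 z)
    also have "\<dots> = (\<Sum>i<N. \<Sum>j<N. ?t i j)"
      by (intro drop0 sum.neutral ballI z)
    finally show ?thesis .
  qed
  also have "\<dots> = ((- E1) * (- E1) + E2 * E2 + cos \<theta> / sin \<theta> * (E2 * (- E1) - (- E1) * E2)) / (sin \<phi>)\<^sup>2"
    unfolding t e1[symmetric] e2[symmetric] sum_product sum_divide_distrib[symmetric] sum.distrib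
      sum_distrib_left[symmetric] sum_subtractf ..
  finally have sum: "(\<Sum>i = 1..N - 1. \<Sum>j = 1..N - 1. ?t i j) = (E1\<^sup>2 + E2\<^sup>2) / (sin \<phi>)\<^sup>2"
    by (simp add: power2_eq_square)
  have q2: "4 - q\<^sup>2 = 4 * (sin \<phi>)\<^sup>2" unfolding q by (simp add: power_mult_distrib sin_squared_eq)
  show ?thesis unfolding hfun_def sum q2 using S by (simp add: field_simps)
qed

text \<open>The mixed terms in x and \<open>E2\<close> cancel, and everything else carries the
  factor \<open>(sin \<phi>)\<^sup>2\<close>, matching \<open>hfun_closed_form\<close>.\<close>

lemma limit_form_discriminant:
  "4 * limit_pert q s 0 1 N x * (- limit_pert q s 1 0 (Suc N) x)
     - (limit_pert q s 1 0 N x - limit_pert q s 0 1 (Suc N) x)\<^sup>2 = hfun N q s x"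
proof -
  define g where "g = cos (real N * \<phi>) / (sin \<phi>)\<^sup>2"
  have "(cos (real N * \<phi>))\<^sup>2 = 1" using N by (simp add: cos_squared_eq)
  then have g2: "g\<^sup>2 * ((sin \<phi>)\<^sup>2 * (sin \<phi>)\<^sup>2) = 1" using S by (simp add: g_def power_divide power2_eq_square)
  have C2: "(cos \<phi>)\<^sup>2 = 1 - (sin \<phi>)\<^sup>2" by (simp add: cos_squared_eq)
  have "4 * limit_pert q s 0 1 N x * (- limit_pert q s 1 0 (Suc N) x)
     - (limit_pert q s 1 0 N x - limit_pert q s 0 1 (Suc N) x)\<^sup>2
    = g\<^sup>2 * (4 * (x * N / 2 + cos \<phi> * E2 + sin \<phi> * E1) * (x * N / 2 + cos \<phi> * E2 - sin \<phi> * E1) - (x * cos \<phi> * N + 2 * E2)\<^sup>2)"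
    unfolding limit_form_coeffs g_def by (simp add: power_mult_distrib power_divide power2_eq_square algebra_simps)
  also have "4 * (x * N / 2 + cos \<phi> * E2 + sin \<phi> * E1) * (x * N / 2 + cos \<phi> * E2 - sin \<phi> * E1) - (x * cos \<phi> * N + 2 * E2)\<^sup>2
     = (1 - (cos \<phi>)\<^sup>2) * x\<^sup>2 * (real N)\<^sup>2 - 4 * (1 - (cos \<phi>)\<^sup>2) * E2\<^sup>2 - 4 * (sin \<phi>)\<^sup>2 * E1\<^sup>2"
    by (simp add: power2_eq_square algebra_simps)
  also have "\<dots> = (sin \<phi>)\<^sup>2 * (x\<^sup>2 * (real N)\<^sup>2 - 4 * (E1\<^sup>2 + E2\<^sup>2))"
    unfolding C2 by (simp add: algebra_simps)
  also have "g\<^sup>2 * \<dots> = (g\<^sup>2 * ((sin \<phi>)\<^sup>2 * (sin \<phi>)\<^sup>2)) * hfun N q s x"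
    unfolding hfun_closed_form using S by (simp add: power2_eq_square)
  finally show ?thesis unfolding g2 by simp
qed

end

section \<open>Uniformly bounded N-variation\<close>

text \<open>The majorant \<open>v\<close> may not depend on x. Boundedness is included so that the
  class is closed under products and every polynomial expression in such sequences can be handled
  structurally.\<close>

definition unif_bv :: "nat \<Rightarrow> real set \<Rightarrow> (nat \<Rightarrow> real \<Rightarrow> real) \<Rightarrow> bool" where
  "unif_bv N K f \<longleftrightarrow> (\<exists>C. \<forall>m. \<forall>x\<in>K. \<bar>f m x\<bar> \<le> C) \<and>
     (\<exists>v. summable v \<and> (\<forall>m. \<forall>x\<in>K. \<bar>f (m + N) x - f m x\<bar> \<le> v m))"

lemma unif_bvE:
  assumes "unif_bv N K f"
  obtains C v where "C \<ge> 0" "\<And>m x. x \<in> K \<Longrightarrow> \<bar>f m x\<bar> \<le> C" "summable v" "\<And>m. v m \<ge> 0"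
    "\<And>m x. x \<in> K \<Longrightarrow> \<bar>f (m + N) x - f m x\<bar> \<le> v m"
proof -
  from assms obtain C v where C: "\<And>m x. x \<in> K \<Longrightarrow> \<bar>f m x\<bar> \<le> C" and v: "summable v"
    "\<And>m x. x \<in> K \<Longrightarrow> \<bar>f (m + N) x - f m x\<bar> \<le> v m" unfolding unif_bv_def by blast
  show thesis
  proof (cases "K = {}")
    case True
    then show thesis by (intro that[of 0 "\<lambda>_. 0"]) auto
  next
    case False
    then obtain x where x: "x \<in> K" by auto
    show thesis
    proof (rule that[of C v])
      show "C \<ge> 0" using C[OF x, of 0] by linarith
      show "v m \<ge> 0" for m using v(2)[OF x, of m] by linarith
    qed (use C v in auto)
  qed
qed

lemma unif_bvI:
  assumes "\<And>m x. x \<in> K \<Longrightarrow> \<bar>f m x\<bar> \<le> C" "summable v"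
    "\<And>m x. x \<in> K \<Longrightarrow> \<bar>f (m + N) x - f m x\<bar> \<le> v m"
  shows "unif_bv N K f"
  using assms unfolding unif_bv_def by blast

lemma unif_bv_fun:
  assumes "\<And>x. x \<in> K \<Longrightarrow> \<bar>g x\<bar> \<le> C"
  shows "unif_bv N K (\<lambda>m. g)"
  using assms by (intro unif_bvI[where C = C and v = "\<lambda>_. 0"]) auto

lemma unif_bv_const [intro, simp]: "unif_bv N K (\<lambda>m x. c)"
  by (rule unif_bv_fun[of _ _ "\<bar>c\<bar>"]) simp

lemma unif_bv_add [intro]:
  assumes "unif_bv N K f" "unif_bv N K g"
  shows "unif_bv N K (\<lambda>m x. f m x + g m x)"
proof -
  obtain C v where f: "\<And>m x. x \<in> K \<Longrightarrow> \<bar>f m x\<bar> \<le> C" "summable v"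
    "\<And>m x. x \<in> K \<Longrightarrow> \<bar>f (m + N) x - f m x\<bar> \<le> v m"
    by (rule unif_bvE[OF assms(1)]) blast
  obtain D w where g: "\<And>m x. x \<in> K \<Longrightarrow> \<bar>g m x\<bar> \<le> D" "summable w"
    "\<And>m x. x \<in> K \<Longrightarrow> \<bar>g (m + N) x - g m x\<bar> \<le> w m"
    by (rule unif_bvE[OF assms(2)]) blast
  show ?thesis
  proof (rule unif_bvI)
    show "\<bar>f m x + g m x\<bar> \<le> C + D" if "x \<in> K" for m x
      using f(1)[OF that, of m] g(1)[OF that, of m] by linarith
    show "summable (\<lambda>m. v m + w m)" by (rule summable_add[OF f(2) g(2)])
    show "\<bar>f (m + N) x + g (m + N) x - (f m x + g m x)\<bar> \<le> v m + w m" if "x \<in> K" for m x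
      using f(3)[OF that, of m] g(3)[OF that, of m] by linarith
  qed
qed

lemma unif_bv_mult [intro]:
  assumes "unif_bv N K f" "unif_bv N K g"
  shows "unif_bv N K (\<lambda>m x. f m x * g m x)"
proof -
  obtain C v where f: "C \<ge> 0" "\<And>m x. x \<in> K \<Longrightarrow> \<bar>f m x\<bar> \<le> C" "summable v" "\<And>m. v m \<ge> 0"
    "\<And>m x. x \<in> K \<Longrightarrow> \<bar>f (m + N) x - f m x\<bar> \<le> v m"
    by (rule unif_bvE[OF assms(1)]) blast
  obtain D w where g: "D \<ge> 0" "\<And>m x. x \<in> K \<Longrightarrow> \<bar>g m x\<bar> \<le> D" "summable w" "\<And>m. w m \<ge> 0"
    "\<And>m x. x \<in> K \<Longrightarrow> \<bar>g (m + N) x - g m x\<bar> \<le> w m"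
    by (rule unif_bvE[OF assms(2)]) blast
  show ?thesis
  proof (rule unif_bvI)
    show "\<bar>f m x * g m x\<bar> \<le> C * D" if "x \<in> K" for m x
      unfolding abs_mult using f g that by (intro mult_mono) auto
    show "summable (\<lambda>m. C * w m + D * v m)"
      by (intro summable_add summable_mult f g)
    show "\<bar>f (m + N) x * g (m + N) x - f m x * g m x\<bar> \<le> C * w m + D * v m" if x: "x \<in> K" for m x
    proof -
      have "f (m + N) x * g (m + N) x - f m x * g m x
        = f (m + N) x * (g (m + N) x - g m x) + g m x * (f (m + N) x - f m x)" by (simp add: algebra_simps)
      also have "\<bar>\<dots>\<bar> \<le> \<bar>f (m + N) x\<bar> * \<bar>g (m + N) x - g m x\<bar> + \<bar>g m x\<bar> * \<bar>f (m + N) x - f m x\<bar>"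
        by (simp add: abs_mult[symmetric])
      also have "\<dots> \<le> C * w m + D * v m"
        using f g x by (intro add_mono mult_mono) auto
      finally show ?thesis .
    qed
  qed
qed

lemma unif_bv_uminus [intro]: "unif_bv N K f \<Longrightarrow> unif_bv N K (\<lambda>m x. - f m x)"
  using unif_bv_mult[OF unif_bv_const[of N K "-1"]] by fastforce

lemma unif_bv_diff [intro]: "unif_bv N K f \<Longrightarrow> unif_bv N K g \<Longrightarrow> unif_bv N K (\<lambda>m x. f m x - g m x)"
  using unif_bv_add[OF _ unif_bv_uminus] by fastforce

lemma unif_bv_sum [intro]:
  "(\<And>i. i \<in> I \<Longrightarrow> unif_bv N K (f i)) \<Longrightarrow> unif_bv N K (\<lambda>m x. \<Sum>i\<in>I. f i m x)"
  by (induction I rule: infinite_finite_induct) auto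

lemma unif_bv_shift:
  assumes "unif_bv N K f"
  shows "unif_bv N K (\<lambda>m. f (m + j))"
proof -
  obtain C v where f: "\<And>m x. x \<in> K \<Longrightarrow> \<bar>f m x\<bar> \<le> C" "summable v"
    "\<And>m x. x \<in> K \<Longrightarrow> \<bar>f (m + N) x - f m x\<bar> \<le> v m"
    by (rule unif_bvE[OF assms]) blast
  show ?thesis
  proof (rule unif_bvI)
    show "summable (\<lambda>m. v (m + j))" using f(2) by (simp add: summable_iff_shift)
    show "\<bar>f (m + N + j) x - f (m + j) x\<bar> \<le> v (m + j)" if "x \<in> K" for m x
      using f(3)[OF that, of "m + j"] by (simp add: algebra_simps)
  qed (use f in auto)
qed

text \<open>Descend from \<open>m\<close> in steps of \<open>N\<close> to an index below
  \<open>N\<close>, paying one variation term per step.\<close>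

lemma finite_Nvar_bounded:
  assumes N: "N > 0" and f: "finite_Nvar N f"
  shows "\<exists>C. \<forall>m. \<bar>f m\<bar> \<le> C"
proof -
  let ?v = "\<lambda>n. \<bar>f (n + N) - f n\<bar>"
  have b1: "\<bar>f m\<bar> \<le> (\<Sum>r<N. \<bar>f r\<bar>) + (\<Sum>j<m. ?v j)" for m
  proof (induction m rule: less_induct)
    case (less m)
    show ?case
    proof (cases "m < N")
      case True
      then have "\<bar>f m\<bar> \<le> (\<Sum>r<N. \<bar>f r\<bar>)" by (intro member_le_sum) auto
      moreover have "(\<Sum>j<m. ?v j) \<ge> 0" by (intro sum_nonneg) auto
      ultimately show ?thesis by linarith
    next
      case False
      define j where "j = m - N"
      have m: "m = j + N" and jm: "j < m" using False N by (auto simp: j_def)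
      have "\<bar>f m\<bar> \<le> \<bar>f j\<bar> + ?v j" unfolding m by linarith
      also have "\<dots> \<le> (\<Sum>r<N. \<bar>f r\<bar>) + (\<Sum>i<Suc j. ?v i)" using less[OF jm] by simp
      also have "(\<Sum>i<Suc j. ?v i) \<le> (\<Sum>i<m. ?v i)" using jm by (intro sum_mono2) auto
      finally show ?thesis by simp
    qed
  qed
  have b2: "(\<Sum>j<m. ?v j) \<le> suminf ?v" for m
    using f unfolding finite_Nvar_def by (intro sum_le_suminf) auto
  show ?thesis by (intro exI allI) (rule order_trans[OF b1 add_left_mono[OF b2]])
qed

lemma unif_bv_seq:
  assumes N: "N > 0" and f: "finite_Nvar N f"
  shows "unif_bv N K (\<lambda>m x. f m)"
proof -
  obtain C where "\<And>m. \<bar>f m\<bar> \<le> C" using finite_Nvar_bounded[OF assms] by blast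
  then show ?thesis
    using f unfolding finite_Nvar_def by (intro unif_bvI[where v = "\<lambda>m. \<bar>f (m + N) - f m\<bar>"]) auto
qed

text \<open>The tails of \<open>v\<close> make the subsequence uniformly Cauchy, so pointwise
  convergence is automatically uniform.\<close>

lemma unif_bv_uniform_limit:
  assumes f: "unif_bv N K f" and lim: "\<And>x. x \<in> K \<Longrightarrow> (\<lambda>k. f (N * k + r) x) \<longlonglongrightarrow> l x" and N: "N > 0"
  shows "uniform_limit K (\<lambda>k. f (N * k + r)) l sequentially"
proof (rule uniform_limitI)
  fix e :: real assume e: "e > 0"
  obtain C v where v: "summable v" "\<And>m. v m \<ge> 0"
    "\<And>m x. x \<in> K \<Longrightarrow> \<bar>f (m + N) x - f m x\<bar> \<le> v m"
    by (rule unif_bvE[OF f]) blast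
  from summable_Cauchy[THEN iffD1, OF v(1), rule_format, of "e/2"] e
  obtain M where M: "\<And>m n. m \<ge> M \<Longrightarrow> norm (sum v {m..<n}) < e / 2" by auto
  have step: "\<bar>f (m + N * i) x - f m x\<bar> \<le> sum v {m..<m + N * i}" if x: "x \<in> K" for m i x
  proof (induction i)
    case (Suc i)
    have "\<bar>f (m + N * i + N) x - f (m + N * i) x\<bar> \<le> v (m + N * i)" by (rule v(3)[OF x])
    \<comment> \<open>One term is enlarged to the whole block so that successive bounds concatenate
      to one interval sum.\<close>
    also have "\<dots> \<le> sum v {m + N * i..<m + N * i + N}" using N v(2) by (intro member_le_sum) auto
    finally have "\<bar>f (m + N * Suc i) x - f m x\<bar> \<le> sum v {m..<m + N * i} + sum v {m + N * i..<m + N * i + N}"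
      using Suc by (simp add: algebra_simps)
    also have "\<dots> = sum v {m..<m + N * Suc i}"
      using sum.atLeastLessThan_concat[of m "m + N * i" "m + N * i + N" v] by (simp add: algebra_simps)
    finally show ?case .
  qed simp
  have "\<forall>\<^sub>F k in sequentially. k \<ge> M" by (rule eventually_ge_at_top)
  then show "\<forall>\<^sub>F k in sequentially. \<forall>x\<in>K. dist (f (N * k + r) x) (l x) < e"
  proof eventually_elim
    case (elim k)
    have "N * k + r \<ge> M" using elim N by (metis One_nat_def Suc_leI le_add1 le_trans mult_le_mono1 nat_mult_1)
    have "dist (f (N * k + r) x) (l x) \<le> e / 2" if x: "x \<in> K" for x
    proof -
      have "(\<lambda>i. f (N * (i + k) + r) x) \<longlonglongrightarrow> l x"
        using LIMSEQ_ignore_initial_segment[OF lim[OF x], of k] by simp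
      then have "(\<lambda>i. dist (f (N * k + r) x) (f (N * (i + k) + r) x)) \<longlonglongrightarrow> dist (f (N * k + r) x) (l x)"
        by (intro tendsto_intros)
      then show ?thesis
      proof (rule LIMSEQ_le_const2, intro exI allI impI)
        fix i
        have eq: "N * (i + k) + r = N * k + r + N * i" by (simp add: algebra_simps)
        have "dist (f (N * k + r) x) (f (N * (i + k) + r) x) \<le> sum v {N * k + r..<N * k + r + N * i}"
          unfolding eq using step[OF x, of "N * k + r" i] by (simp add: dist_real_def abs_minus_commute)
        also have "\<dots> < e / 2" using M[OF \<open>N * k + r \<ge> M\<close>] by (smt (verit) real_norm_def)
        finally show "dist (f (N * k + r) x) (f (N * (i + k) + r) x) \<le> e / 2" by simp
      qed
    qed
    then show ?case using e by fastforce
  qed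
qed

text \<open>Complete the square twice: 4 A Q and 4 C Q are squares plus the discriminant times u^2
  and v^2. Adding the two bounds needs no information on the sign of the form.\<close>

lemma definite_quadratic_form_lower_bound:
  fixes A B C u v :: real
  assumes disc: "4 * A * C - B\<^sup>2 \<ge> d" and d: "d > 0"
    and A: "\<bar>A\<bar> \<le> M" and C: "\<bar>C\<bar> \<le> M"
  shows "d * (u\<^sup>2 + v\<^sup>2) \<le> 8 * M * \<bar>A * v\<^sup>2 + B * u * v + C * u\<^sup>2\<bar>"
proof -
  let ?Q = "A * v\<^sup>2 + B * u * v + C * u\<^sup>2"
  have "4 * (A * ?Q) = (2 * A * v + B * u)\<^sup>2 + (4 * A * C - B\<^sup>2) * u\<^sup>2"
    by (simp add: power2_eq_square algebra_simps)
  moreover have "(4 * A * C - B\<^sup>2) * u\<^sup>2 \<ge> d * u\<^sup>2" using disc by (intro mult_right_mono) auto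
  ultimately have "d * u\<^sup>2 \<le> 4 * (A * ?Q)" by (smt (verit) zero_le_power2)
  also have "\<dots> \<le> 4 * (\<bar>A\<bar> * \<bar>?Q\<bar>)" unfolding abs_mult[symmetric] by simp
  also have "\<dots> \<le> 4 * (M * \<bar>?Q\<bar>)" using A by (intro mult_left_mono mult_right_mono) auto
  finally have 1: "d * u\<^sup>2 \<le> 4 * (M * \<bar>?Q\<bar>)" .
  have "4 * (C * ?Q) = (2 * C * u + B * v)\<^sup>2 + (4 * A * C - B\<^sup>2) * v\<^sup>2"
    by (simp add: power2_eq_square algebra_simps)
  moreover have "(4 * A * C - B\<^sup>2) * v\<^sup>2 \<ge> d * v\<^sup>2" using disc by (intro mult_right_mono) auto
  ultimately have "d * v\<^sup>2 \<le> 4 * (C * ?Q)" by (smt (verit) zero_le_power2)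
  also have "\<dots> \<le> 4 * (\<bar>C\<bar> * \<bar>?Q\<bar>)" unfolding abs_mult[symmetric] by simp
  also have "\<dots> \<le> 4 * (M * \<bar>?Q\<bar>)" using C by (intro mult_left_mono mult_right_mono) auto
  finally have "d * v\<^sup>2 \<le> 4 * (M * \<bar>?Q\<bar>)" .
  with 1 show ?thesis by (simp add: algebra_simps)
qed

lemma quadratic_form_upper_bound:
  fixes A B C u v :: real
  assumes "\<bar>A\<bar> \<le> M" "\<bar>B\<bar> \<le> M" "\<bar>C\<bar> \<le> M"
  shows "\<bar>A * v\<^sup>2 + B * u * v + C * u\<^sup>2\<bar> \<le> 2 * M * (u\<^sup>2 + v\<^sup>2)"
proof -
  have uv: "\<bar>u * v\<bar> \<le> u\<^sup>2 + v\<^sup>2"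
  proof -
    have "0 \<le> (\<bar>u\<bar> - \<bar>v\<bar>)\<^sup>2" by simp
    also have "\<dots> = u\<^sup>2 + v\<^sup>2 - 2 * \<bar>u * v\<bar>" by (simp add: power2_diff abs_mult)
    finally show ?thesis by linarith
  qed
  have M: "M \<ge> 0" using assms(1) by linarith
  have "\<bar>A * v\<^sup>2 + B * u * v + C * u\<^sup>2\<bar> \<le> \<bar>A\<bar> * v\<^sup>2 + \<bar>B\<bar> * \<bar>u * v\<bar> + \<bar>C\<bar> * u\<^sup>2"
    using abs_triangle_ineq[of "A * v\<^sup>2 + B * u * v" "C * u\<^sup>2"] abs_triangle_ineq[of "A * v\<^sup>2" "B * u * v"]
    by (simp add: abs_mult mult.assoc)
  also have "\<dots> \<le> M * v\<^sup>2 + M * (u\<^sup>2 + v\<^sup>2) + M * u\<^sup>2"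
    using assms uv M by (intro add_mono mult_mono) auto
  finally show ?thesis by (simp add: algebra_simps)
qed

text \<open>Relative increments with summable bounds behave like a convergent infinite product: from
  some index on the sequence stays within half of its current value. This gives an absolute majorant
  for the Weierstrass test and keeps the limit away from 0.\<close>

lemma uniform_limit_multiplicative_perturbation:
  fixes t :: "nat \<Rightarrow> real \<Rightarrow> real"
  assumes K: "compact K" and cont: "\<And>k. continuous_on K (t k)" and \<eta>: "summable \<eta>"
    and step: "\<And>k x. k \<ge> k0 \<Longrightarrow> x \<in> K \<Longrightarrow> \<bar>t (Suc k) x - t k x\<bar> \<le> \<eta> k * \<bar>t k x\<bar>"
    and nz: "\<And>k x. k \<ge> k0 \<Longrightarrow> x \<in> K \<Longrightarrow> t k x \<noteq> 0"
  obtains g where "uniform_limit K t g sequentially" "\<And>x. x \<in> K \<Longrightarrow> g x \<noteq> 0"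
proof (cases "K = {}")
  case True
  then show thesis by (intro that[of undefined]) auto
next
  case False
  then obtain x0 where x0: "x0 \<in> K" by auto
  have \<eta>0: "\<eta> k \<ge> 0" if "k \<ge> k0" for k
  proof -
    have "0 \<le> \<eta> k * \<bar>t k x0\<bar>" using step[OF that x0] by linarith
    moreover have "\<bar>t k x0\<bar> > 0" using nz[OF that x0] by simp
    ultimately show ?thesis by (simp add: zero_le_mult_iff)
  qed
  \<comment> \<open>The tail is below 1/4 because the induction carries the factor 2, and 2 * 1/4
    leaves the margin one half.\<close>
  from summable_Cauchy[THEN iffD1, OF \<eta>, rule_format, of "1/4"]
  obtain M where M: "\<And>m n. m \<ge> M \<Longrightarrow> norm (sum \<eta> {m..<n}) < 1 / 4" by auto
  define k1 where "k1 = max k0 M"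
  have k1: "k1 \<ge> k0" "k1 \<ge> M" by (auto simp: k1_def)
  have sum_le: "sum \<eta> {k1..<n} \<le> 1 / 4" for n using M[OF k1(2), of n] by (auto simp: abs_le_iff)
  have close: "\<bar>t n x - t k1 x\<bar> \<le> 2 * \<bar>t k1 x\<bar> * sum \<eta> {k1..<n}" if n: "n \<ge> k1" and x: "x \<in> K" for n x
    using n
  proof (induction rule: dec_induct)
    case (step n)
    have "2 * \<bar>t k1 x\<bar> * sum \<eta> {k1..<n} \<le> 2 * \<bar>t k1 x\<bar> * (1 / 4)"
      by (intro mult_left_mono sum_le) auto
    then have tn: "\<bar>t n x\<bar> \<le> 2 * \<bar>t k1 x\<bar>" using step.IH by linarith
    have nk: "n \<ge> k0" using step k1 by simp
    have "\<bar>t (Suc n) x - t n x\<bar> \<le> \<eta> n * \<bar>t n x\<bar>" using assms(4)[OF nk x] .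
    also have "\<dots> \<le> \<eta> n * (2 * \<bar>t k1 x\<bar>)" by (intro mult_left_mono tn \<eta>0 nk)
    finally have "\<bar>t (Suc n) x - t k1 x\<bar> \<le> 2 * \<bar>t k1 x\<bar> * sum \<eta> {k1..<n} + \<eta> n * (2 * \<bar>t k1 x\<bar>)"
      using step.IH by linarith
    also have "\<dots> = 2 * \<bar>t k1 x\<bar> * sum \<eta> {k1..<Suc n}" using step by (simp add: algebra_simps)
    finally show ?case .
  qed simp
  have half: "\<bar>t n x - t k1 x\<bar> \<le> \<bar>t k1 x\<bar> / 2" if "n \<ge> k1" "x \<in> K" for n x
  proof -
    have "2 * \<bar>t k1 x\<bar> * sum \<eta> {k1..<n} \<le> 2 * \<bar>t k1 x\<bar> * (1 / 4)"
      by (intro mult_left_mono sum_le) auto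
    then show ?thesis using close[OF that] by linarith
  qed
  obtain B where B: "\<And>x. x \<in> K \<Longrightarrow> \<bar>t k1 x\<bar> \<le> B"
    using compact_imp_bounded[OF compact_continuous_image[OF cont[of k1] K]] unfolding bounded_iff by auto
  define f where "f i x = t (Suc (k1 + i)) x - t (k1 + i) x" for i x
  have "uniform_limit K (\<lambda>n x. \<Sum>i<n. f i x) (\<lambda>x. suminf (\<lambda>i. f i x)) sequentially"
  proof (rule Weierstrass_m_test)
    show "summable (\<lambda>i. 2 * B * \<eta> (k1 + i))"
      using \<eta> by (intro summable_mult) (simp add: summable_iff_shift add.commute)
    show "norm (f i x) \<le> 2 * B * \<eta> (k1 + i)" if x: "x \<in> K" for i x
    proof -
      have k: "k1 + i \<ge> k0" using k1 by simp
      have "\<bar>t (k1 + i) x\<bar> \<le> 2 * \<bar>t k1 x\<bar>" using half[OF _ x, of "k1 + i"] abs_ge_zero[of "t k1 x"] abs_ge_self[of "t (k1+i) x"] by linarith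
      then have t2: "\<bar>t (k1 + i) x\<bar> \<le> 2 * B" using B[OF x] by linarith
      have "norm (f i x) \<le> \<eta> (k1 + i) * \<bar>t (k1 + i) x\<bar>" using step[OF k x] by (simp add: f_def)
      also have "\<dots> \<le> \<eta> (k1 + i) * (2 * B)" by (intro mult_left_mono t2 \<eta>0 k)
      finally show ?thesis by (simp add: mult.commute)
    qed
  qed
  moreover have "(\<Sum>i<n. f i x) = t (k1 + n) x - t k1 x" for n x
    using sum_lessThan_telescope[of "\<lambda>i. t (k1 + i) x" n] by (simp add: f_def)
  ultimately have u: "uniform_limit K (\<lambda>n x. t (k1 + n) x - t k1 x) (\<lambda>x. suminf (\<lambda>i. f i x)) sequentially" by simp
  define g where "g x = suminf (\<lambda>i. f i x) + t k1 x" for x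
  have "uniform_limit K (\<lambda>n x. (t (k1 + n) x - t k1 x) + t k1 x) (\<lambda>x. suminf (\<lambda>i. f i x) + t k1 x) sequentially"
    by (intro uniform_limit_add u uniform_limit_const)
  then have u2: "uniform_limit K (\<lambda>n. t (n + k1)) g sequentially" by (simp add: g_def[abs_def] add.commute)
  have u3: "uniform_limit K t g sequentially"
  proof (rule uniform_limitI)
    fix e :: real assume "e > 0"
    from uniform_limitD[OF u2 this] have "\<forall>\<^sub>F n in sequentially. \<forall>x\<in>K. dist (t (n + k1) x) (g x) < e" .
    then show "\<forall>\<^sub>F n in sequentially. \<forall>x\<in>K. dist (t n x) (g x) < e"
      by (rule eventually_sequentially_seg[THEN iffD1])
  qed
  show thesis
  proof (rule that[OF u3])
    fix x assume x: "x \<in> K"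
    have "(\<lambda>n. t n x) \<longlonglongrightarrow> g x" by (rule tendsto_uniform_limitI[OF u3 x])
    then have "(\<lambda>n. \<bar>t n x - t k1 x\<bar>) \<longlonglongrightarrow> \<bar>g x - t k1 x\<bar>" by (intro tendsto_intros)
    then have "\<bar>g x - t k1 x\<bar> \<le> \<bar>t k1 x\<bar> / 2"
      by (rule LIMSEQ_le_const2) (use half[OF _ x] in blast)
    then show "g x \<noteq> 0" using nz[OF k1(1) x] by auto
  qed
qed

text \<open>Within a block of length \<open>N\<close> only finitely many vanishing differences
  separate an index from the given class.\<close>

lemma tendsto_from_residue_class:
  fixes f :: "nat \<Rightarrow> real"
  assumes N: "N > 0" and lim: "(\<lambda>k. f (N * k + r)) \<longlonglongrightarrow> g" and diff: "(\<lambda>m. f (Suc m) - f m) \<longlonglongrightarrow> 0"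
  shows "f \<longlonglongrightarrow> g"
proof -
  have inf: "filterlim (\<lambda>k. N * k + i) at_top sequentially" for i
    using N by (intro filterlim_subseq) (auto simp: strict_mono_def)
  have l: "(\<lambda>k. f (N * k + (r + l))) \<longlonglongrightarrow> g" for l
  proof (induction l)
    case 0 show ?case using lim by simp
  next
    case (Suc l)
    have "(\<lambda>k. f (Suc (N * k + (r + l))) - f (N * k + (r + l))) \<longlonglongrightarrow> 0"
      by (rule filterlim_compose[OF diff inf])
    from tendsto_add[OF this Suc] show ?case by simp
  qed
  show ?thesis
  proof (rule tendstoI)
    fix e :: real assume "e > 0"
    then have "\<forall>l<N. \<forall>\<^sub>F k in sequentially. dist (f (N * k + (r + l))) g < e"
      using l tendstoD by blast
    then have "\<forall>\<^sub>F k in sequentially. \<forall>l\<in>{..<N}. dist (f (N * k + (r + l))) g < e"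
      by (intro eventually_ball_finite) auto
    then obtain k0 where k0: "\<And>k l. k \<ge> k0 \<Longrightarrow> l < N \<Longrightarrow> dist (f (N * k + (r + l))) g < e"
      by (auto simp: eventually_sequentially)
    have "dist (f m) g < e" if m: "m \<ge> N * k0 + r" for m
    proof -
      have "m = N * ((m - r) div N) + (r + (m - r) mod N)"
        using m mult_div_mod_eq[of N "m - r"] by linarith
      moreover have "(m - r) div N \<ge> k0"
        using m N by (metis add_le_imp_le_diff div_le_mono nonzero_mult_div_cancel_left less_numeral_extra(3))
      ultimately show ?thesis using k0[of "(m - r) div N" "(m - r) mod N"] N by simp
    qed
    then show "\<forall>\<^sub>F m in sequentially. dist (f m) g < e" by (auto simp: eventually_sequentially)
  qed
qed

section \<open>Turan determinants\<close>

text \<open>Lagrange's identity supplies the Cauchy-Schwarz inequality.\<close>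

lemma square_sum_le:
  fixes u v s t C :: real
  assumes "\<bar>s\<bar> \<le> C" "\<bar>t\<bar> \<le> C"
  shows "(s * u + t * v)\<^sup>2 \<le> 2 * C\<^sup>2 * (u\<^sup>2 + v\<^sup>2)"
proof -
  have "(s * u + t * v)\<^sup>2 + (s * v - t * u)\<^sup>2 = (s\<^sup>2 + t\<^sup>2) * (u\<^sup>2 + v\<^sup>2)"
    by (simp add: power2_eq_square algebra_simps)
  then have "(s * u + t * v)\<^sup>2 \<le> (s\<^sup>2 + t\<^sup>2) * (u\<^sup>2 + v\<^sup>2)" by (smt (verit) zero_le_power2)
  also have "s\<^sup>2 \<le> C\<^sup>2" "t\<^sup>2 \<le> C\<^sup>2" using assms by (metis abs_ge_zero power2_abs power_mono)+
  then have "(s\<^sup>2 + t\<^sup>2) * (u\<^sup>2 + v\<^sup>2) \<le> 2 * C\<^sup>2 * (u\<^sup>2 + v\<^sup>2)" by (intro mult_right_mono) auto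
  finally show ?thesis .
qed

context jacobi
begin

text \<open>The solution of the recurrence started at index \<open>m\<close> with values
  \<open>c0\<close>, \<open>c1\<close> at \<open>m\<close> and \<open>Suc m\<close>. The starts (1,
  0) and (0, 1) give the entries of a product of transfer matrices.\<close>

fun transfer_sol :: "real \<Rightarrow> real \<Rightarrow> nat \<Rightarrow> nat \<Rightarrow> real \<Rightarrow> real" where
  "transfer_sol c0 c1 0 m x = c0"
| "transfer_sol c0 c1 (Suc 0) m x = c1"
| "transfer_sol c0 c1 (Suc (Suc l)) m x = (x - b (Suc (m + l))) / a (Suc (m + l)) * transfer_sol c0 c1 (Suc l) m x
     - a (m + l) / a (Suc (m + l)) * transfer_sol c0 c1 l m x"

lemma opoly_transfer_sol: "p (m + l) x = transfer_sol 1 0 l m x * p m x + transfer_sol 0 1 l m x * p (Suc m) x"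
proof (induction l rule: induct_nat_012)
  case (ge2 l)
  have "p (m + Suc (Suc l)) x = (x - b (Suc (m + l))) / a (Suc (m + l)) * p (m + Suc l) x
     - a (m + l) / a (Suc (m + l)) * p (m + l) x"
    by (simp add: diff_divide_distrib left_diff_distrib)
  then show ?case unfolding ge2 transfer_sol.simps by (simp add: algebra_simps)
qed auto

text \<open>One step has determinant \<open>a (m + l) / a (Suc (m + l))\<close>, and the product
  telescopes.\<close>

lemma transfer_sol_wronskian:
  "transfer_sol 1 0 l m x * transfer_sol 0 1 (Suc l) m x - transfer_sol 0 1 l m x * transfer_sol 1 0 (Suc l) m x = a m / a (m + l)"
proof (induction l)
  case (Suc l)
  let ?\<beta> = "(x - b (Suc (m + l))) / a (Suc (m + l))" and ?\<alpha> = "a (m + l) / a (Suc (m + l))"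
  have "transfer_sol 1 0 (Suc l) m x * transfer_sol 0 1 (Suc (Suc l)) m x - transfer_sol 0 1 (Suc l) m x * transfer_sol 1 0 (Suc (Suc l)) m x
     = ?\<alpha> * (transfer_sol 1 0 l m x * transfer_sol 0 1 (Suc l) m x - transfer_sol 0 1 l m x * transfer_sol 1 0 (Suc l) m x)"
    unfolding transfer_sol.simps(3) by (simp only: algebra_simps)
  also have "\<dots> = a m / a (m + Suc l)" unfolding Suc by simp
  finally show ?case .
qed simp

end

text \<open>The minus sign in \<open>q_eq\<close> makes sin(l \<phi>) a solution of the limiting
  recurrence, whose coefficient is \<open>- q\<close>. In \<open>lim_s\<close> indices are moved up
  by one period so that \<open>i = 0\<close> does not reach index -1.\<close>

locale turan_setup = jacobi a b for a b :: "nat \<Rightarrow> real" +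
  fixes N :: nat and q \<phi> :: real and s :: "nat \<Rightarrow> real"
  assumes N2: "N \<ge> 2"
    and q_eq: "q = - 2 * cos \<phi>" and sin_\<phi>: "sin \<phi> \<noteq> 0" and sin_N: "sin (real N * \<phi>) = 0"
    and var1: "finite_Nvar N (\<lambda>n. 1 / a n)"
    and var2: "finite_Nvar N (\<lambda>n. a (n + 1) - a n)"
    and var3: "finite_Nvar N (\<lambda>n. b n - q * a n)"
    and lim_inv: "(\<lambda>n. 1 / a n) \<longlonglongrightarrow> 0"
    and lim_s: "\<And>i. i < N \<Longrightarrow>
                 (\<lambda>k. a (N * k + i + N) - a (N * k + i + N - 1)) \<longlonglongrightarrow> s i"
    and lim_b: "(\<lambda>n. b n - q * a n) \<longlonglongrightarrow> 0"
    and lim_N: "(\<lambda>n. a (n + N) - a n) \<longlonglongrightarrow> 0"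
begin

lemma N_pos: "N > 0" using N2 by simp

text \<open>The residue class is chosen so that the increments along \<open>base k, ..., base k + N - 1\<close> converge
  to \<open>s 0, ..., s (N - 1)\<close>.\<close>

definition base :: "nat \<Rightarrow> nat" where "base k = N * k + (N - 1)"

lemma base_strict_mono: "strict_mono base"
proof (rule strict_monoI)
  fix x y :: nat assume "x < y"
  then show "base x < base y"
    unfolding base_def add_less_cancel_right using N_pos by simp
qed

lemma base_filterlim: "filterlim (\<lambda>k. base k + i) at_top sequentially"
  using base_strict_mono by (intro filterlim_subseq) (simp add: strict_mono_def)

lemma base_Suc: "base (Suc k) = base k + N"
  by (simp add: base_def)

text \<open>The increments over one period telescope to \<open>a (m + N) - a m\<close>, which tends
  to 0.\<close>

lemma sum_s: "(\<Sum>j<N. s j) = 0"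
proof -
  have "(\<lambda>k. \<Sum>j<N. a (N * k + j + N) - a (N * k + j + N - 1)) \<longlonglongrightarrow> (\<Sum>j<N. s j)"
    by (intro tendsto_sum lim_s) auto
  moreover have "(\<Sum>j<N. a (N * k + j + N) - a (N * k + j + N - 1)) = a (base k + 0 + N) - a (base k + 0)" for k
    using sum_lessThan_telescope[of "\<lambda>j. a (base k + j)" N] N_pos
    by (auto simp: base_def algebra_simps intro!: sum.cong)
  moreover have "(\<lambda>k. a (base k + 0 + N) - a (base k + 0)) \<longlonglongrightarrow> 0"
    by (rule filterlim_compose[OF lim_N base_filterlim])
  ultimately show ?thesis using LIMSEQ_unique by simp
qed

lemma bv_inv: "unif_bv N K (\<lambda>m x. 1 / a (m + j))"
  by (rule unif_bv_shift[OF unif_bv_seq[OF N_pos var1]])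

lemma bv_inc: "unif_bv N K (\<lambda>m x. a (Suc (m + j)) - a (m + j))"
  using unif_bv_shift[OF unif_bv_seq[OF N_pos var2, of K], of j] by simp

lemma bv_b: "unif_bv N K (\<lambda>m x. b (m + j) - q * a (m + j))"
  by (rule unif_bv_shift[OF unif_bv_seq[OF N_pos var3]])

lemma telescope: "a (m + j + i) - a (m + j) = (\<Sum>l<i. a (Suc (m + (j + l))) - a (m + (j + l)))"
  using sum_lessThan_telescope[of "\<lambda>l. a (m + (j + l))" i] by (simp add: add.assoc)

lemma bv_diff: "unif_bv N K (\<lambda>m x. a (m + j + i) - a (m + j))"
  unfolding telescope by (intro unif_bv_sum bv_inc)

text \<open>Since \<open>a\<close> is unbounded, ratios are rewritten through increments and
  \<open>1 / a\<close>, which do belong to \<open>unif_bv\<close>.\<close>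

lemma ratio_eq: "a (m + j + i) / a (m + j) = 1 + (a (m + j + i) - a (m + j)) * (1 / a (m + j))"
  by (simp add: field_simps)

lemma bv_ratio: "unif_bv N K (\<lambda>m x. a (m + j + i) / a (m + j))"
  unfolding ratio_eq by (intro unif_bv_add unif_bv_mult unif_bv_const bv_diff bv_inv)

lemma bv_alpha: "unif_bv N K (\<lambda>m x. a (m + j) / a (Suc (m + j)))"
proof -
  have eq: "a (m + j) / a (Suc (m + j)) = 1 - (a (Suc (m + j)) - a (m + j)) * (1 / a (m + Suc j))" for m
    by (simp add: field_simps)
  show ?thesis unfolding eq by (intro unif_bv_diff unif_bv_mult unif_bv_const bv_inc bv_inv)
qed

lemma bv_id: "bounded K \<Longrightarrow> unif_bv N K (\<lambda>m x. x)"
  unfolding bounded_iff by (auto intro: unif_bv_fun)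

lemma bv_beta: "bounded K \<Longrightarrow> unif_bv N K (\<lambda>m x. (x - b (Suc (m + j))) / a (Suc (m + j)))"
proof -
  assume K: "bounded K"
  have eq: "(x - b (Suc (m + j))) / a (Suc (m + j)) =
      x * (1 / a (m + Suc j)) - q - (b (m + Suc j) - q * a (m + Suc j)) * (1 / a (m + Suc j))" for m x
    by (simp add: field_simps)
  show ?thesis unfolding eq by (intro unif_bv_diff unif_bv_mult unif_bv_const bv_b bv_inv bv_id K)
qed

lemma bv_transfer_sol:
  assumes K: "bounded K"
  shows "unif_bv N K (transfer_sol c0 c1 l)"
proof (induction l rule: induct_nat_012)
  case (ge2 l)
  have "transfer_sol c0 c1 (Suc (Suc l)) = (\<lambda>m x. (x - b (Suc (m + l))) / a (Suc (m + l)) * transfer_sol c0 c1 (Suc l) m x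
     - a (m + l) / a (Suc (m + l)) * transfer_sol c0 c1 l m x)" by (intro ext) simp
  then show ?case by (simp only:) (intro unif_bv_diff unif_bv_mult bv_alpha bv_beta K ge2)
qed (simp_all add: unif_bv_const fun_eq_iff[symmetric] transfer_sol.simps[abs_def])

text \<open>The deviation from the limiting solution on the scale \<open>1 / a\<close>. The weight
  is the same for all \<open>l\<close>, so \<open>pert\<close> satisfies the same recurrence up to
  source terms.\<close>

definition pert :: "real \<Rightarrow> real \<Rightarrow> nat \<Rightarrow> nat \<Rightarrow> real \<Rightarrow> real" where
  "pert c0 c1 l m x = a (m + N) * (transfer_sol c0 c1 l m x - limit_sol q c0 c1 l)"

text \<open>The ratio is spelled \<open>a (m + Suc l + (N - Suc l)) / a (m + Suc l)\<close> to fit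
  \<open>bv_ratio\<close> and \<open>ratio_tendsto\<close>; this is where
  \<open>Suc l \<le> N\<close> enters.\<close>

lemma pert_Suc_Suc:
  assumes "Suc l \<le> N"
  shows "pert c0 c1 (Suc (Suc l)) m x =
    (x - b (Suc (m + l))) / a (Suc (m + l)) * pert c0 c1 (Suc l) m x
    - a (m + l) / a (Suc (m + l)) * pert c0 c1 l m x
    + a (m + Suc l + (N - Suc l)) / a (m + Suc l) * (x - (b (m + Suc l) - q * a (m + Suc l))) * limit_sol q c0 c1 (Suc l)
    + a (m + Suc l + (N - Suc l)) / a (m + Suc l) * (a (Suc (m + l)) - a (m + l)) * limit_sol q c0 c1 l"
proof -
  have "m + Suc l + (N - Suc l) = m + N" using assms by simp
  then show ?thesis unfolding pert_def transfer_sol.simps(3) limit_sol.simps(3)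
    by (simp add: divide_simps) (simp add: algebra_simps)
qed

lemma bv_pert:
  assumes K: "bounded K"
  shows "l \<le> Suc N \<Longrightarrow> unif_bv N K (pert c0 c1 l)"
proof (induction l rule: induct_nat_012)
  case (ge2 l)
  have "pert c0 c1 (Suc (Suc l)) = (\<lambda>m x. (x - b (Suc (m + l))) / a (Suc (m + l)) * pert c0 c1 (Suc l) m x
    - a (m + l) / a (Suc (m + l)) * pert c0 c1 l m x
    + a (m + Suc l + (N - Suc l)) / a (m + Suc l) * (x - (b (m + Suc l) - q * a (m + Suc l))) * limit_sol q c0 c1 (Suc l)
    + a (m + Suc l + (N - Suc l)) / a (m + Suc l) * (a (Suc (m + l)) - a (m + l)) * limit_sol q c0 c1 l)"
    using ge2.prems by (intro ext pert_Suc_Suc) simp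
  moreover have "unif_bv N K (pert c0 c1 l)" "unif_bv N K (pert c0 c1 (Suc l))" using ge2 by auto
  ultimately show ?case
    by (simp only:) (intro unif_bv_diff unif_bv_add unif_bv_mult unif_bv_const bv_alpha bv_beta bv_ratio bv_id bv_b bv_inc K)
qed (simp_all add: pert_def[abs_def] unif_bv_const)

lemma inc_bounded: "\<exists>C. \<forall>m. \<bar>a (m + j + i) - a (m + j)\<bar> \<le> C"
  using unif_bvE[OF bv_diff[of UNIV j i]] by (metis UNIV_I)

lemma lim_inv_shift: "(\<lambda>m. 1 / a (m + j)) \<longlonglongrightarrow> 0"
  by (rule LIMSEQ_ignore_initial_segment[OF lim_inv])

lemma ratio_tendsto: "(\<lambda>m. a (m + j + i) / a (m + j)) \<longlonglongrightarrow> 1"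
proof -
  obtain C where C: "\<And>m. \<bar>a (m + j + i) - a (m + j)\<bar> \<le> C" using inc_bounded by blast
  have "(\<lambda>m. (a (m + j + i) - a (m + j)) * (1 / a (m + j))) \<longlonglongrightarrow> 0"
  proof (rule Lim_null_comparison)
    show "\<forall>\<^sub>F m in sequentially. norm ((a (m + j + i) - a (m + j)) * (1 / a (m + j))) \<le> C * (1 / a (m + j))"
      using C a_pos by (intro always_eventually allI) (simp add: abs_mult abs_of_pos divide_right_mono less_imp_le)
    show "(\<lambda>m. C * (1 / a (m + j))) \<longlonglongrightarrow> 0" by (rule tendsto_mult_right_zero[OF lim_inv_shift])
  qed
  from tendsto_add[OF tendsto_const[of 1] this] show ?thesis unfolding ratio_eq by simp
qed

lemma ratio_tendsto': "(\<lambda>m. a (m + i) / a (m + j)) \<longlonglongrightarrow> 1"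
proof -
  have "(\<lambda>m. (a (m + 0 + i) / a (m + 0)) / (a (m + 0 + j) / a (m + 0))) \<longlonglongrightarrow> 1 / 1"
    by (intro tendsto_divide ratio_tendsto) simp
  then show ?thesis by simp
qed

lemma inc_tendsto:
  assumes "l < N"
  shows "(\<lambda>k. a (Suc (base k + l)) - a (base k + l)) \<longlonglongrightarrow> s l"
proof -
  have "N * k + l + N = Suc (base k + l)" for k
    using N_pos by (auto simp: base_def)
  then show ?thesis using lim_s[OF assms] by (simp only: diff_Suc_1)
qed

lemma beta_tendsto: "(\<lambda>m. (x - b (Suc (m + j))) / a (Suc (m + j))) \<longlonglongrightarrow> - q"
proof -
  have eq: "(x - b (Suc (m + j))) / a (Suc (m + j)) =
      x * (1 / a (m + Suc j)) - q - (b (m + Suc j) - q * a (m + Suc j)) * (1 / a (m + Suc j))" for m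
    by (simp add: field_simps)
  have "(\<lambda>m. x * (1 / a (m + Suc j)) - q - (b (m + Suc j) - q * a (m + Suc j)) * (1 / a (m + Suc j))) \<longlonglongrightarrow> x * 0 - q - 0 * 0"
    by (intro tendsto_intros lim_inv_shift LIMSEQ_ignore_initial_segment[OF lim_b])
  then show ?thesis unfolding eq by simp
qed

text \<open>The recurrence passes to the limit term by term and becomes the recursion of
  \<open>limit_pert\<close>; along \<open>base\<close>, the increment number \<open>l\<close> tends
  to \<open>s l\<close>.\<close>

lemma pert_tendsto:
  "l \<le> Suc N \<Longrightarrow> (\<lambda>k. pert c0 c1 l (base k) x) \<longlonglongrightarrow> limit_pert q s c0 c1 l x"
proof (induction l rule: induct_nat_012)
  case (ge2 l)
  then have l: "Suc l \<le> N" by simp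
  have base0: "filterlim base at_top sequentially" using base_filterlim[of 0] by simp
  have \<beta>: "(\<lambda>k. (x - b (Suc (base k + l))) / a (Suc (base k + l))) \<longlonglongrightarrow> - q"
    by (rule filterlim_compose[OF beta_tendsto base0])
  have \<alpha>: "(\<lambda>k. a (base k + l) / a (Suc (base k + l))) \<longlonglongrightarrow> 1"
    using filterlim_compose[OF ratio_tendsto'[of l "Suc l"] base0] by simp
  have r: "(\<lambda>k. a (base k + Suc l + (N - Suc l)) / a (base k + Suc l)) \<longlonglongrightarrow> 1"
    by (rule filterlim_compose[OF ratio_tendsto base0])
  have \<delta>: "(\<lambda>k. b (base k + Suc l) - q * a (base k + Suc l)) \<longlonglongrightarrow> 0"
    by (rule filterlim_compose[OF lim_b base_filterlim])
  have "(\<lambda>k. pert c0 c1 (Suc (Suc l)) (base k) x) \<longlonglongrightarrow>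
     - q * limit_pert q s c0 c1 (Suc l) x - 1 * limit_pert q s c0 c1 l x
     + 1 * (x - 0) * limit_sol q c0 c1 (Suc l) + 1 * s l * limit_sol q c0 c1 l"
    unfolding pert_Suc_Suc[OF l]
    using ge2 l by (intro tendsto_intros \<beta> \<alpha> r \<delta> inc_tendsto) auto
  then show ?case by simp
qed (simp_all add: pert_def)

text \<open>Together with \<open>qB\<close> and \<open>qC\<close>: the off-diagonal entries and the
  difference of the diagonal entries of the \<open>N\<close>-step transfer matrix, weighted by
  \<open>a (m + N)\<close>. The \<open>limit_sol\<close> parts cancel because the limiting matrix is
  scalar. The resulting form is, up to weight and sign, the determinant of a vector and its
  image.\<close>

definition qA :: "nat \<Rightarrow> real \<Rightarrow> real" where "qA = pert 0 1 N"
definition qB :: "nat \<Rightarrow> real \<Rightarrow> real" where "qB m x = pert 1 0 N m x - pert 0 1 (Suc N) m x"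
definition qC :: "nat \<Rightarrow> real \<Rightarrow> real" where "qC m x = - pert 1 0 (Suc N) m x"
definition form :: "nat \<Rightarrow> real \<Rightarrow> real \<Rightarrow> real \<Rightarrow> real" where
  "form m x u v = qA m x * v\<^sup>2 + qB m x * u * v + qC m x * u\<^sup>2"
definition limA :: "real \<Rightarrow> real" where "limA = limit_pert q s 0 1 N"
definition limB :: "real \<Rightarrow> real" where "limB x = limit_pert q s 1 0 N x - limit_pert q s 0 1 (Suc N) x"
definition limC :: "real \<Rightarrow> real" where "limC x = - limit_pert q s 1 0 (Suc N) x"
text \<open>Shifted by one: \<open>m\<close> stands for \<open>n - 1\<close>, so
  \<open>a (m + N)\<close> is \<open>a (n + N - 1)\<close> and the vector is \<open>p m\<close>,
  \<open>p (Suc m)\<close>.\<close>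

definition scaled_turan :: "nat \<Rightarrow> real \<Rightarrow> real" where "scaled_turan m x = (a (m + N))\<^sup>2 * turan a b N (Suc m) x"

lemma lim_discriminant: "4 * limA x * limC x - (limB x)\<^sup>2 = hfun N q s x"
  unfolding limA_def limB_def limC_def by (rule limit_form_discriminant[OF q_eq sin_\<phi> sin_N sum_s])

lemma continuous_lim [continuous_intros]: "continuous_on S limA" "continuous_on S limB" "continuous_on S limC"
  unfolding limA_def limB_def[abs_def] limC_def[abs_def] by (intro continuous_intros)+

lemma bv_form:
  assumes "bounded K"
  shows "unif_bv N K qA" "unif_bv N K qB" "unif_bv N K qC"
  unfolding qA_def qB_def[abs_def] qC_def[abs_def]
  using bv_pert[OF assms] by (auto intro!: unif_bv_diff unif_bv_uminus)

lemma form_tendsto: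
  "(\<lambda>k. qA (base k) x) \<longlonglongrightarrow> limA x" "(\<lambda>k. qB (base k) x) \<longlonglongrightarrow> limB x" "(\<lambda>k. qC (base k) x) \<longlonglongrightarrow> limC x"
  unfolding qA_def qB_def qC_def limA_def limB_def limC_def
  by (intro tendsto_intros pert_tendsto; simp)+

lemma form_uniform_limit:
  assumes K: "bounded K"
  shows "uniform_limit K (\<lambda>k. qA (base k)) limA sequentially"
    "uniform_limit K (\<lambda>k. qB (base k)) limB sequentially"
    "uniform_limit K (\<lambda>k. qC (base k)) limC sequentially"
  using form_tendsto unfolding base_def
  by (auto intro!: unif_bv_uniform_limit bv_form K N_pos)

lemma turan_Suc: "turan a b N (Suc m) x = p (Suc m) x * p (m + N) x - p m x * p (m + Suc N) x"
  by (simp add: turan_def opoly_pred_def)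

lemmas sol_N = limit_sol_N[OF q_eq sin_\<phi> sin_N sum_s]

lemma scaled_turan_form: "scaled_turan m x = a (m + N) * form m x (p m x) (p (Suc m) x)"
  unfolding scaled_turan_def turan_Suc form_def qA_def qB_def qC_def pert_def sol_N opoly_transfer_sol[of m N x] opoly_transfer_sol[of m "Suc N" x]
  by (simp add: power2_eq_square algebra_simps)

text \<open>With T the \<open>N\<close>-step transfer matrix, the form at w is a multiple of det(w,
  T w). Replacing w by T w gives det(T w, T T w), so the determinant of T factors out.\<close>

lemma form_invariant:
  "form m x (p (m + N) x) (p (m + Suc N) x) = a m / a (m + N) * form m x (p m x) (p (Suc m) x)"
proof -
  define u w u' w' where defs: "u = transfer_sol 1 0 N m x" "w = transfer_sol 0 1 N m x" "u' = transfer_sol 1 0 (Suc N) m x" "w' = transfer_sol 0 1 (Suc N) m x"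
  have F: "form m x c d = a (m + N) * (w * d\<^sup>2 + (u - w') * c * d - u' * c\<^sup>2)" for c d
    unfolding form_def qA_def qB_def qC_def pert_def sol_N defs by (simp add: power2_eq_square algebra_simps)
  have "form m x (u * c + w * d) (u' * c + w' * d) = (u * w' - w * u') * form m x c d" for c d
    unfolding F by (simp add: power2_eq_square algebra_simps)
  moreover have "u * w' - w * u' = a m / a (m + N)" unfolding defs by (rule transfer_sol_wronskian)
  ultimately show ?thesis unfolding opoly_transfer_sol[of m N x] opoly_transfer_sol[of m "Suc N" x] defs by simp
qed

lemma scaled_turan_continuous: "continuous_on S (scaled_turan m)"
  unfolding scaled_turan_def[abs_def] turan_Suc by (intro continuous_intros)

text \<open>Compares the forms of \<open>m + N\<close> and \<open>m\<close> at the same vector; the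
  invariance accounts for the rest by a factor close to 1.\<close>

lemma scaled_turan_step_identity:
  "scaled_turan (m + N) x = a (m + N + N) * a m / (a (m + N))\<^sup>2 * scaled_turan m x
     + a (m + N + N) * (form (m + N) x (p (m + N) x) (p (m + Suc N) x) - form m x (p (m + N) x) (p (m + Suc N) x))"
proof -
  have "scaled_turan (m + N) x = a (m + N + N) * form (m + N) x (p (m + N) x) (p (m + Suc N) x)"
    unfolding scaled_turan_form by simp
  moreover have "a (m + N + N) * a m / (a (m + N))\<^sup>2 * scaled_turan m x = a (m + N + N) * form m x (p (m + N) x) (p (m + Suc N) x)"
    unfolding form_invariant scaled_turan_form by (simp add: power2_eq_square)
  ultimately show ?thesis by (simp add: algebra_simps)
qed

text \<open>Since \<open>a\<close> itself need not have bounded variation, the deviation from 1 is written in terms of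
  the variations of \<open>a (m + N) - a m\<close> and of \<open>1 / a\<close>.\<close>

lemma ratio_variation:
  obtains v where "summable v" "\<And>m. v m \<ge> 0" "\<And>m. \<bar>a (m + N + N) * a m / (a (m + N))\<^sup>2 - 1\<bar> \<le> v m"
proof -
  obtain CD vD where D: "CD \<ge> 0" "\<And>m. \<bar>a (m + 0 + N) - a (m + 0)\<bar> \<le> CD" "summable vD" "\<And>m. vD m \<ge> 0"
     "\<And>m. \<bar>(a (m + N + 0 + N) - a (m + N + 0)) - (a (m + 0 + N) - a (m + 0))\<bar> \<le> vD m"
    by (rule unif_bvE[OF bv_diff[of UNIV 0 N]]) blast
  obtain CI vI where I: "CI \<ge> 0" "\<And>m. \<bar>1 / a (m + N)\<bar> \<le> CI" "summable vI" "\<And>m. vI m \<ge> 0"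
     "\<And>m. \<bar>1 / a (m + N + N) - 1 / a (m + N)\<bar> \<le> vI m"
    by (rule unif_bvE[OF bv_inv[of UNIV N]]) blast
  obtain CR where R: "CR \<ge> 0" "\<And>m. \<bar>a (m + N + N) / a (m + N)\<bar> \<le> CR"
    by (rule unif_bvE[OF bv_ratio[of UNIV N N]]) blast
  show thesis
  proof (rule that[of "\<lambda>m. vD m * CI + CD * (CR * vI m)"])
    show "summable (\<lambda>m. vD m * CI + CD * (CR * vI m))"
      by (intro summable_add summable_mult summable_mult2 D I)
    show "vD m * CI + CD * (CR * vI m) \<ge> 0" for m using D I R by simp
    fix m
    let ?\<alpha> = "a m" and ?\<beta> = "a (m + N)" and ?\<gamma> = "a (m + N + N)"
    have eq: "?\<gamma> * ?\<alpha> / ?\<beta>\<^sup>2 - 1 = ((?\<gamma> - ?\<beta>) - (?\<beta> - ?\<alpha>)) * (1 / ?\<beta>) - (?\<beta> - ?\<alpha>) * (?\<gamma> / ?\<beta> * (1 / ?\<beta> - 1 / ?\<gamma>))"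
      by (simp add: power2_eq_square field_simps)
    have "\<bar>?\<gamma> * ?\<alpha> / ?\<beta>\<^sup>2 - 1\<bar> \<le> \<bar>(?\<gamma> - ?\<beta>) - (?\<beta> - ?\<alpha>)\<bar> * \<bar>1 / ?\<beta>\<bar> + \<bar>?\<beta> - ?\<alpha>\<bar> * (\<bar>?\<gamma> / ?\<beta>\<bar> * \<bar>1 / ?\<beta> - 1 / ?\<gamma>\<bar>)"
      unfolding eq abs_mult[symmetric] by (rule abs_triangle_ineq4)
    also have "\<dots> \<le> vD m * CI + CD * (CR * vI m)"
      using D(5)[of m] D(2)[of m] I(5)[of m] D I R by (intro add_mono mult_mono) (auto simp: abs_minus_commute)
    finally show "\<bar>?\<gamma> * ?\<alpha> / ?\<beta>\<^sup>2 - 1\<bar> \<le> vD m * CI + CD * (CR * vI m)" .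
  qed
qed

text \<open>The discriminants converge uniformly on \<open>K\<close> to \<open>hfun\<close>, which
  has a positive minimum there.\<close>

lemma form_definite:
  assumes K: "compact K" and h: "\<And>x. x \<in> K \<Longrightarrow> hfun N q s x > 0"
  shows "\<exists>c>0. \<exists>k0. \<forall>k\<ge>k0. \<forall>x\<in>K. \<forall>u v. c * (u\<^sup>2 + v\<^sup>2) \<le> \<bar>form (base k) x u v\<bar>"
proof (cases "K = {}")
  case True
  then show ?thesis by (intro exI[of _ 1]) auto
next
  case False
  have bK: "bounded K" using K by (rule compact_imp_bounded)
  have "continuous_on K (\<lambda>x. 4 * limA x * limC x - (limB x)\<^sup>2)" by (intro continuous_intros)
  then have "continuous_on K (hfun N q s)" unfolding lim_discriminant .
  then obtain x0 where x0: "x0 \<in> K" "\<And>x. x \<in> K \<Longrightarrow> hfun N q s x0 \<le> hfun N q s x"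
    using continuous_attains_inf[OF K False] by blast
  \<comment> \<open>Half of the minimum: the other half is the tolerance for the convergence of the
    discriminants.\<close>
  define d where "d = hfun N q s x0 / 2"
  have d: "d > 0" using h[OF x0(1)] by (simp add: d_def)
  let ?D = "\<lambda>m x. 4 * qA m x * qC m x - (qB m x)\<^sup>2"
  have "unif_bv N K ?D" unfolding power2_eq_square
    using bv_form[OF bK] by (intro unif_bv_diff unif_bv_mult unif_bv_const)
  moreover have "(\<lambda>k. ?D (base k) x) \<longlonglongrightarrow> hfun N q s x" for x
    unfolding lim_discriminant[symmetric] by (intro tendsto_intros form_tendsto)
  ultimately have "uniform_limit K (\<lambda>k. ?D (base k)) (hfun N q s) sequentially"
    unfolding base_def by (intro unif_bv_uniform_limit N_pos)
  from uniform_limitD[OF this d] obtain k0 where k0: "\<And>k x. k \<ge> k0 \<Longrightarrow> x \<in> K \<Longrightarrow> dist (?D (base k) x) (hfun N q s x) < d"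
    by (auto simp: eventually_sequentially)
  obtain M1 where M1: "\<And>m x. x \<in> K \<Longrightarrow> \<bar>qA m x\<bar> \<le> M1" by (rule unif_bvE[OF bv_form(1)[OF bK]]) blast
  obtain M2 where M2: "\<And>m x. x \<in> K \<Longrightarrow> \<bar>qC m x\<bar> \<le> M2" by (rule unif_bvE[OF bv_form(3)[OF bK]]) blast
  define M where "M = max 1 (max M1 M2)"
  have M: "M > 0" by (simp add: M_def)
  show ?thesis
  proof (intro exI[of _ "d / (8 * M)"] exI[of _ k0] conjI allI impI ballI)
    show "d / (8 * M) > 0" using d M by simp
    fix k x u v assume k: "k \<ge> k0" and x: "x \<in> K"
    have "\<bar>?D (base k) x - hfun N q s x\<bar> < d" using k0[OF k x] unfolding dist_real_def .
    then have "hfun N q s x - d < ?D (base k) x" unfolding abs_less_iff by linarith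
    moreover have "2 * d \<le> hfun N q s x" using x0(2)[OF x] by (simp add: d_def)
    ultimately have "?D (base k) x \<ge> d" by linarith
    then have "d * (u\<^sup>2 + v\<^sup>2) \<le> 8 * M * \<bar>form (base k) x u v\<bar>"
      unfolding form_def using M1[OF x] M2[OF x] d
      by (intro definite_quadratic_form_lower_bound) (auto simp: M_def le_max_iff_disj)
    then show "d / (8 * M) * (u\<^sup>2 + v\<^sup>2) \<le> \<bar>form (base k) x u v\<bar>"
      using M by (simp add: field_simps)
  qed
qed

lemma scaled_turan_nonzero:
  assumes c: "c > 0" "c * ((p m x)\<^sup>2 + (p (Suc m) x)\<^sup>2) \<le> \<bar>form m x (p m x) (p (Suc m) x)\<bar>"
  shows "scaled_turan m x \<noteq> 0"
proof -
  have "(p m x)\<^sup>2 + (p (Suc m) x)\<^sup>2 > 0"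
    using opoly_consecutive_nonzero[of m x] by (auto simp: sum_power2_gt_zero_iff)
  then have "c * ((p m x)\<^sup>2 + (p (Suc m) x)\<^sup>2) > 0" using c(1) by simp
  then have "form m x (p m x) (p (Suc m) x) \<noteq> 0" using c(2) by auto
  then show ?thesis unfolding scaled_turan_form by simp
qed

text \<open>Definiteness turns the change of the coefficients, measured against the squared length
  of the vector, into an error relative to the determinant. It is a premise for each
  \<open>m\<close> and x because it is available only at \<open>base k\<close> with \<open>k\<close>
  large.\<close>

lemma scaled_turan_step_bound:
  assumes K: "compact K" and c: "c > 0"
  shows "\<exists>\<eta>. summable \<eta> \<and> (\<forall>m. \<eta> m \<ge> 0) \<and> (\<forall>m. \<forall>x\<in>K.
      c * ((p m x)\<^sup>2 + (p (Suc m) x)\<^sup>2) \<le> \<bar>form m x (p m x) (p (Suc m) x)\<bar> \<longrightarrow>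
      \<bar>scaled_turan (m + N) x - scaled_turan m x\<bar> \<le> \<eta> m * \<bar>scaled_turan m x\<bar>)"
proof -
  have bK: "bounded K" using K by (rule compact_imp_bounded)
  obtain v where v: "summable v" "\<And>m. v m \<ge> 0" "\<And>m. \<bar>a (m + N + N) * a m / (a (m + N))\<^sup>2 - 1\<bar> \<le> v m"
    by (rule ratio_variation) blast
  obtain CR where R: "CR \<ge> 0" "\<And>m. \<bar>a (m + N + N) / a (m + N)\<bar> \<le> CR"
    by (rule unif_bvE[OF bv_ratio[of UNIV N N]]) blast
  obtain vA where A: "summable vA" "\<And>m. vA m \<ge> 0" "\<And>m x. x \<in> K \<Longrightarrow> \<bar>qA (m + N) x - qA m x\<bar> \<le> vA m"
    by (rule unif_bvE[OF bv_form(1)[OF bK]]) blast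
  obtain vB where B: "summable vB" "\<And>m. vB m \<ge> 0" "\<And>m x. x \<in> K \<Longrightarrow> \<bar>qB (m + N) x - qB m x\<bar> \<le> vB m"
    by (rule unif_bvE[OF bv_form(2)[OF bK]]) blast
  obtain vC where C: "summable vC" "\<And>m. vC m \<ge> 0" "\<And>m x. x \<in> K \<Longrightarrow> \<bar>qC (m + N) x - qC m x\<bar> \<le> vC m"
    by (rule unif_bvE[OF bv_form(3)[OF bK]]) blast
  define V where "V m = vA m + vB m + vC m" for m
  have V: "summable V" "\<And>m. V m \<ge> 0" unfolding V_def by (intro summable_add A B C) (simp add: A B C)
  have tr: "\<exists>C\<ge>0. \<forall>m. \<forall>x\<in>K. \<bar>transfer_sol c0 c1 l m x\<bar> \<le> C" for c0 c1 l
    by (rule unif_bvE[OF bv_transfer_sol[OF bK, of c0 c1 l]]) blast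
  obtain t1 where t1: "\<And>m x. x \<in> K \<Longrightarrow> \<bar>transfer_sol 1 0 N m x\<bar> \<le> t1" using tr by blast
  obtain t2 where t2: "\<And>m x. x \<in> K \<Longrightarrow> \<bar>transfer_sol 0 1 N m x\<bar> \<le> t2" using tr by blast
  obtain t3 where t3: "\<And>m x. x \<in> K \<Longrightarrow> \<bar>transfer_sol 1 0 (Suc N) m x\<bar> \<le> t3" using tr by blast
  obtain t4 where t4: "\<And>m x. x \<in> K \<Longrightarrow> \<bar>transfer_sol 0 1 (Suc N) m x\<bar> \<le> t4" using tr by blast
  define t where "t = max (max t1 t2) (max t3 t4)"
  \<comment> \<open>The factor 2 comes from \<open>quadratic_form_upper_bound\<close>,
    \<open>4 * t\<^sup>2\<close> from the two transferred components, \<open>1 / c\<close> from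
    definiteness, and \<open>CR\<close> from the ratio of weights at \<open>m + N + N\<close> and
    \<open>m + N\<close>.\<close>
  define \<eta> where "\<eta> m = v m + CR * (2 * V m * (4 * t\<^sup>2)) / c" for m
  show ?thesis
  proof (intro exI[of _ \<eta>] conjI allI ballI impI)
    have "summable (\<lambda>m. CR * (2 * V m * (4 * t\<^sup>2)) / c)"
      by (intro summable_divide summable_mult summable_mult2 V)
    then show "summable \<eta>" unfolding \<eta>_def by (intro summable_add v(1))
    show "\<eta> m \<ge> 0" for m unfolding \<eta>_def using v V R c by simp
    fix m x assume x: "x \<in> K" and lower: "c * ((p m x)\<^sup>2 + (p (Suc m) x)\<^sup>2) \<le> \<bar>form m x (p m x) (p (Suc m) x)\<bar>"
    let ?u = "p m x" and ?w = "p (Suc m) x" and ?u' = "p (m + N) x" and ?w' = "p (m + Suc N) x"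
    have "?u'\<^sup>2 \<le> 2 * t\<^sup>2 * (?u\<^sup>2 + ?w\<^sup>2)"
      unfolding opoly_transfer_sol[of m N x] using t1[OF x, of m] t2[OF x, of m] by (intro square_sum_le) (auto simp: t_def)
    moreover have "?w'\<^sup>2 \<le> 2 * t\<^sup>2 * (?u\<^sup>2 + ?w\<^sup>2)"
      unfolding opoly_transfer_sol[of m "Suc N" x] using t3[OF x, of m] t4[OF x, of m] by (intro square_sum_le) (auto simp: t_def)
    ultimately have uw: "?u'\<^sup>2 + ?w'\<^sup>2 \<le> 4 * t\<^sup>2 * (?u\<^sup>2 + ?w\<^sup>2)" by (simp add: algebra_simps)
    have TT: "\<bar>scaled_turan m x\<bar> = a (m + N) * \<bar>form m x ?u ?w\<bar>" unfolding scaled_turan_form abs_mult using a_pos[of "m + N"] by simp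
    have "\<bar>form (m + N) x ?u' ?w' - form m x ?u' ?w'\<bar>
       = \<bar>(qA (m + N) x - qA m x) * ?w'\<^sup>2 + (qB (m + N) x - qB m x) * ?u' * ?w' + (qC (m + N) x - qC m x) * ?u'\<^sup>2\<bar>"
      unfolding form_def by (simp add: algebra_simps del: opoly.simps)
    also have "\<dots> \<le> 2 * V m * (?u'\<^sup>2 + ?w'\<^sup>2)"
      using A(2)[of m] B(2)[of m] C(2)[of m] A(3)[OF x, of m] B(3)[OF x, of m] C(3)[OF x, of m]
      by (intro quadratic_form_upper_bound) (auto simp: V_def)
    also have "\<dots> \<le> 2 * V m * (4 * t\<^sup>2 * (?u\<^sup>2 + ?w\<^sup>2))"
      using V by (intro mult_left_mono uw) auto
    also have "\<dots> \<le> 2 * V m * (4 * t\<^sup>2 * (\<bar>form m x ?u ?w\<bar> / c))"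
      using lower c V(2)[of m] by (intro mult_left_mono) (auto simp: field_simps)
    finally have d: "\<bar>form (m + N) x ?u' ?w' - form m x ?u' ?w'\<bar> \<le> 2 * V m * (4 * t\<^sup>2 * (\<bar>form m x ?u ?w\<bar> / c))" .
    have tri: "\<bar>A * B + D * E\<bar> \<le> \<bar>A\<bar> * \<bar>B\<bar> + D * \<bar>E\<bar>" if "D > 0" for A B D E :: real
      by (rule order_trans[OF abs_triangle_ineq]) (use that in \<open>simp add: abs_mult\<close>)
    have eq: "scaled_turan (m + N) x - scaled_turan m x = (a (m + N + N) * a m / (a (m + N))\<^sup>2 - 1) * scaled_turan m x
       + a (m + N + N) * (form (m + N) x ?u' ?w' - form m x ?u' ?w')"
      unfolding scaled_turan_step_identity by (simp only: left_diff_distrib; simp)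
    have "\<bar>scaled_turan (m + N) x - scaled_turan m x\<bar> \<le> \<bar>a (m + N + N) * a m / (a (m + N))\<^sup>2 - 1\<bar> * \<bar>scaled_turan m x\<bar>
       + a (m + N + N) * \<bar>form (m + N) x ?u' ?w' - form m x ?u' ?w'\<bar>"
      unfolding eq by (rule tri[OF a_pos])
    also have "\<dots> \<le> v m * \<bar>scaled_turan m x\<bar> + a (m + N + N) * (2 * V m * (4 * t\<^sup>2 * (\<bar>form m x ?u ?w\<bar> / c)))"
      using v(3)[of m] d a_pos[of "m + N + N"] by (intro add_mono mult_right_mono mult_left_mono) auto
    also have "a (m + N + N) * (2 * V m * (4 * t\<^sup>2 * (\<bar>form m x ?u ?w\<bar> / c)))
       = (a (m + N + N) / a (m + N)) * (2 * V m * (4 * t\<^sup>2) / c * \<bar>scaled_turan m x\<bar>)"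
      unfolding TT by (simp add: field_simps del: opoly.simps)
    also have "\<dots> \<le> CR * (2 * V m * (4 * t\<^sup>2) / c * \<bar>scaled_turan m x\<bar>)"
      using order_trans[OF abs_ge_self R(2)] V(2)[of m] c by (intro mult_right_mono) auto
    finally show "\<bar>scaled_turan (m + N) x - scaled_turan m x\<bar> \<le> \<eta> m * \<bar>scaled_turan m x\<bar>"
      unfolding \<eta>_def by (simp add: algebra_simps)
  qed
qed

lemma scaled_turan_base_uniform_limit:
  assumes K: "compact K" and h: "\<And>x. x \<in> K \<Longrightarrow> hfun N q s x > 0"
  obtains g where "uniform_limit K (\<lambda>k. scaled_turan (base k)) g sequentially" "\<And>x. x \<in> K \<Longrightarrow> g x \<noteq> 0"
proof -
  obtain c k0 where c: "c > 0" and k0: "\<And>k x u v. k \<ge> k0 \<Longrightarrow> x \<in> K \<Longrightarrow> c * (u\<^sup>2 + v\<^sup>2) \<le> \<bar>form (base k) x u v\<bar>"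
    using form_definite[OF K h] by blast
  obtain \<eta> where \<eta>: "summable \<eta>" "\<And>m x. x \<in> K \<Longrightarrow>
      c * ((p m x)\<^sup>2 + (p (Suc m) x)\<^sup>2) \<le> \<bar>form m x (p m x) (p (Suc m) x)\<bar> \<Longrightarrow>
      \<bar>scaled_turan (m + N) x - scaled_turan m x\<bar> \<le> \<eta> m * \<bar>scaled_turan m x\<bar>" "\<And>m. \<eta> m \<ge> 0"
    using scaled_turan_step_bound[OF K c] by blast
  have inj: "inj base" by (rule strict_mono_imp_inj_on[OF base_strict_mono])
  show thesis
  proof (rule uniform_limit_multiplicative_perturbation[OF K, of "\<lambda>k. scaled_turan (base k)" "\<eta> \<circ> base" k0])
    show "continuous_on K (scaled_turan (base k))" for k by (rule scaled_turan_continuous)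
    show "summable (\<eta> \<circ> base)" using \<eta> inj by (intro summable_reindex) auto
    show "\<bar>scaled_turan (base (Suc k)) x - scaled_turan (base k) x\<bar> \<le> (\<eta> \<circ> base) k * \<bar>scaled_turan (base k) x\<bar>" if "k \<ge> k0" "x \<in> K" for k x
      unfolding base_Suc o_def using that by (intro \<eta>(2) k0)
    show "scaled_turan (base k) x \<noteq> 0" if "k \<ge> k0" "x \<in> K" for k x
      using that by (intro scaled_turan_nonzero[OF c] k0)
  qed (use that in blast)
qed

end

section \<open>From one residue class to all indices\<close>

context turan_setup
begin

definition energy :: "nat \<Rightarrow> real \<Rightarrow> real" where
  "energy m x = a m * ((p m x)\<^sup>2 + (p (Suc m) x)\<^sup>2)"

lemma ratio_bounded: "\<exists>B. \<forall>m. \<bar>a (m + i) / a (m + j)\<bar> \<le> B"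
  using ratio_tendsto'[THEN convergentI, THEN convergent_imp_Bseq, of i j] unfolding Bseq_def by auto

lemma energy_nonneg: "energy m x \<ge> 0"
  unfolding energy_def using a_pos[of m] by (simp add: less_imp_le)

text \<open>One-step growth is bounded uniformly in \<open>m\<close>, so a bound along
  \<open>base\<close> spreads to the indices in between; \<open>G \<ge> 1\<close> makes its powers
  monotone.\<close>

lemma energy_step: "\<exists>G\<ge>1. \<forall>m. energy (Suc m) x \<le> G * energy m x"
proof -
  have b: "bounded {x}" by simp
  obtain B where B: "\<And>m. \<bar>(x - b (Suc (m + 0))) / a (Suc (m + 0))\<bar> \<le> B"
    by (rule unif_bvE[OF bv_beta[OF b, of 0]]) blast
  obtain A where A: "\<And>m. \<bar>a (m + 0) / a (Suc (m + 0))\<bar> \<le> A"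
    by (rule unif_bvE[OF bv_alpha[of UNIV 0]]) blast
  obtain R where R: "R \<ge> 0" "\<And>m. \<bar>a (m + 0 + 1) / a (m + 0)\<bar> \<le> R"
    by (rule unif_bvE[OF bv_ratio[of UNIV 0 1]]) blast
  define C where "C = max A B"
  show ?thesis
  proof (intro exI[of _ "max 1 (R * (1 + 2 * C\<^sup>2))"] conjI allI)
    fix m
    have "p (Suc (Suc m)) x = - (a m / a (Suc m)) * p m x + (x - b (Suc m)) / a (Suc m) * p (Suc m) x"
      by (simp add: diff_divide_distrib left_diff_distrib)
    also have "\<dots>\<^sup>2 \<le> 2 * C\<^sup>2 * ((p m x)\<^sup>2 + (p (Suc m) x)\<^sup>2)"
      using A[of m] B[of m] by (intro square_sum_le) (auto simp: C_def)
    finally have "(p (Suc m) x)\<^sup>2 + (p (Suc (Suc m)) x)\<^sup>2 \<le> (1 + 2 * C\<^sup>2) * ((p m x)\<^sup>2 + (p (Suc m) x)\<^sup>2)"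
      using zero_le_power2[of "p m x"] by (simp only: distrib_right mult_1; linarith)
    then have "energy (Suc m) x \<le> a (Suc m) * ((1 + 2 * C\<^sup>2) * ((p m x)\<^sup>2 + (p (Suc m) x)\<^sup>2))"
      unfolding energy_def using a_pos[of "Suc m"] by (intro mult_left_mono) auto
    also have "\<dots> = (a (Suc m) / a m) * (1 + 2 * C\<^sup>2) * energy m x"
      unfolding energy_def by (simp add: field_simps del: opoly.simps)
    also have "\<dots> \<le> R * (1 + 2 * C\<^sup>2) * energy m x"
      using order_trans[OF abs_ge_self R(2)[of m]] energy_nonneg[of m x]
      by (intro mult_right_mono) (auto simp: add_nonneg_nonneg)
    also have "\<dots> \<le> max 1 (R * (1 + 2 * C\<^sup>2)) * energy m x"
      by (intro mult_right_mono energy_nonneg) auto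
    finally show "energy (Suc m) x \<le> max 1 (R * (1 + 2 * C\<^sup>2)) * energy m x" .
  qed simp
qed

text \<open>At \<open>base k\<close> definiteness bounds the energy by the scaled determinant, which
  converges. At most \<open>N\<close> further steps cost a factor \<open>G ^ N\<close>, and the
  finitely many early indices are added by hand.\<close>

lemma energy_bounded:
  assumes h: "hfun N q s x > 0"
  shows "\<exists>C. \<forall>m. energy m x \<le> C"
proof -
  from form_definite[of "{x}"] h obtain c k0 where c: "c > 0"
    and k0': "\<forall>k\<ge>k0. \<forall>u v. c * (u\<^sup>2 + v\<^sup>2) \<le> \<bar>form (base k) x u v\<bar>"
    by auto
  have k0: "c * (u\<^sup>2 + v\<^sup>2) \<le> \<bar>form (base k) x u v\<bar>" if "k \<ge> k0" for k u v
    using k0' that by blast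
  obtain g where g: "uniform_limit {x} (\<lambda>k. scaled_turan (base k)) g sequentially"
    by (rule scaled_turan_base_uniform_limit[of "{x}"]) (use h in auto)
  then have "convergent (\<lambda>k. scaled_turan (base k) x)" using tendsto_uniform_limitI[OF g, of x] by (auto simp: convergent_def)
  then obtain B where B: "\<And>k. \<bar>scaled_turan (base k) x\<bar> \<le> B"
    using convergent_imp_Bseq[THEN BseqD] by (metis real_norm_def)
  obtain R where R': "\<And>m. \<bar>a (m + 0) / a (m + N)\<bar> \<le> R" using ratio_bounded by blast
  have R: "R \<ge> 0" "\<And>m. \<bar>a m / a (m + N)\<bar> \<le> R"
    using order_trans[OF abs_ge_zero R'] R' by auto
  have E: "energy (base k) x \<le> R * B / c" if k: "k \<ge> k0" for k
  proof -
    let ?m = "base k"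
    have "c * energy ?m x \<le> a ?m * \<bar>form ?m x (p ?m x) (p (Suc ?m) x)\<bar>"
      unfolding energy_def using mult_left_mono[OF k0[OF k], of "a ?m" "p ?m x" "p (Suc ?m) x"] a_pos[of ?m]
      by (simp add: mult.left_commute less_imp_le)
    also have "\<dots> = (a ?m / a (?m + N)) * \<bar>scaled_turan ?m x\<bar>"
      unfolding scaled_turan_form abs_mult using a_pos[of "?m + N"] by simp
    also have "\<dots> \<le> R * B"
      using order_trans[OF abs_ge_self R(2)[of ?m]] B[of k] R(1) by (intro mult_mono) auto
    finally show ?thesis using c by (simp add: field_simps)
  qed
  obtain G where G: "G \<ge> 1" "\<And>m. energy (Suc m) x \<le> G * energy m x" using energy_step by blast
  have pow: "energy (m + l) x \<le> G ^ l * energy m x" for m l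
  proof (induction l)
    case (Suc l)
    have "energy (m + Suc l) x \<le> G * energy (m + l) x" using G(2)[of "m + l"] by simp
    also have "\<dots> \<le> G * (G ^ l * energy m x)" using G(1) by (intro mult_left_mono Suc) auto
    finally show ?case by (simp add: mult.assoc)
  qed simp
  have big: "energy m x \<le> G ^ N * (R * B / c)" if m: "m \<ge> base k0" for m
  proof -
    define k where "k = (m - (N - 1)) div N"
    define l where "l = (m - (N - 1)) mod N"
    have ge: "m \<ge> N * k0 + (N - 1)" using m by (simp add: base_def)
    have "m = base k + l" unfolding base_def k_def l_def using ge mult_div_mod_eq[of N "m - (N - 1)"] by linarith
    moreover have "k \<ge> k0" unfolding k_def using ge N_pos
      by (metis add_le_imp_le_diff div_le_mono nonzero_mult_div_cancel_left less_numeral_extra(3))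
    moreover have l: "l \<le> N" unfolding l_def using N_pos by (simp add: less_imp_le)
    ultimately have "energy m x \<le> G ^ l * energy (base k) x" using pow by simp
    also have "\<dots> \<le> G ^ N * (R * B / c)"
      using E[OF \<open>k \<ge> k0\<close>] G(1) l energy_nonneg by (intro mult_mono power_increasing) auto
    finally show ?thesis .
  qed
  have "energy m x \<le> max (G ^ N * (R * B / c)) (\<Sum>i<base k0. energy i x)" for m
  proof (cases "m \<ge> base k0")
    case False
    then have "energy m x \<le> (\<Sum>i<base k0. energy i x)"
      by (intro member_le_sum energy_nonneg) auto
    then show ?thesis by simp
  qed (use big in \<open>simp add: le_max_iff_disj\<close>)
  then show ?thesis by blast
qed

text \<open>Apply the recurrence to \<open>p (Suc (Suc m))\<close> and to its
  \<open>N\<close>-shift: the error contains only differences of recurrence coefficients at distance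
  \<open>N\<close>.\<close>

lemma scaled_turan_Suc_identity:
  "scaled_turan (Suc m) x - scaled_turan m x = ((a (m + Suc N))\<^sup>2 / (a (m + N))\<^sup>2 * (a m / a (Suc m)) - 1) * scaled_turan m x
    + (a (m + Suc N))\<^sup>2 * (((x - b (Suc m)) / a (Suc m) - (x - b (Suc (m + N))) / a (Suc (m + N))) * (p (Suc m) x * p (m + Suc N) x)
      + (a (m + N) / a (Suc (m + N)) - a m / a (Suc m)) * (p (Suc m) x * p (m + N) x))"
proof -
  have r: "p (Suc (Suc j)) x = (x - b (Suc j)) / a (Suc j) * p (Suc j) x - a j / a (Suc j) * p j x" for j
    by (simp add: diff_divide_distrib left_diff_distrib)
  have "turan a b N (Suc (Suc m)) x = p (Suc (Suc m)) x * p (m + Suc N) x - p (Suc m) x * p (Suc (Suc (m + N))) x"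
    unfolding turan_Suc by simp
  also have "\<dots> = a m / a (Suc m) * turan a b N (Suc m) x
     + (((x - b (Suc m)) / a (Suc m) - (x - b (Suc (m + N))) / a (Suc (m + N))) * (p (Suc m) x * p (m + Suc N) x)
      + (a (m + N) / a (Suc (m + N)) - a m / a (Suc m)) * (p (Suc m) x * p (m + N) x))"
    unfolding turan_Suc r[of m] r[of "m + N"] add_Suc_right by (simp only: algebra_simps)
  finally have t: "turan a b N (Suc (Suc m)) x = a m / a (Suc m) * turan a b N (Suc m) x
     + (((x - b (Suc m)) / a (Suc m) - (x - b (Suc (m + N))) / a (Suc (m + N))) * (p (Suc m) x * p (m + Suc N) x)
      + (a (m + N) / a (Suc (m + N)) - a m / a (Suc m)) * (p (Suc m) x * p (m + N) x))" .
  have gen: "c\<^sup>2 * (r * D + W) - d\<^sup>2 * D = (c\<^sup>2 / d\<^sup>2 * r - 1) * (d\<^sup>2 * D) + c\<^sup>2 * W" if "d \<noteq> 0" for c d r D W :: real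
    using that by (simp add: field_simps)
  show ?thesis unfolding scaled_turan_def t add_Suc add_Suc_right by (rule gen) simp
qed

text \<open>The two contributions of \<open>q\<close> cancel, leaving \<open>x\<close> minus a ratio
  tending to 1 times \<open>x\<close>, up to vanishing terms.\<close>

lemma beta_diff_tendsto:
  "(\<lambda>m. a (Suc m) * ((x - b (Suc m)) / a (Suc m) - (x - b (Suc (m + N))) / a (Suc (m + N)))) \<longlonglongrightarrow> 0"
proof -
  have eq: "a (Suc m) * ((x - b (Suc m)) / a (Suc m) - (x - b (Suc (m + N))) / a (Suc (m + N)))
     = (x - (b (m + 1) - q * a (m + 1))) - a (m + 1) / a (m + Suc N) * (x - (b (m + Suc N) - q * a (m + Suc N)))" for m
    by (simp add: field_simps)
  have "(\<lambda>m. (x - (b (m + 1) - q * a (m + 1))) - a (m + 1) / a (m + Suc N) * (x - (b (m + Suc N) - q * a (m + Suc N))))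
     \<longlonglongrightarrow> (x - 0) - 1 * (x - 0)"
    by (intro tendsto_intros ratio_tendsto' LIMSEQ_ignore_initial_segment[OF lim_b])
  then show ?thesis unfolding eq by simp
qed

text \<open>Each ratio is 1 minus an increment of \<open>a\<close> over \<open>a\<close>; increments
  at distance \<open>N\<close> differ by the terms of a convergent series, hence by a null
  sequence.\<close>

lemma alpha_diff_tendsto:
  "(\<lambda>m. a (Suc m) * (a (m + N) / a (Suc (m + N)) - a m / a (Suc m))) \<longlonglongrightarrow> 0"
proof -
  let ?i = "\<lambda>m. a (m + 1) - a m"
  have "(\<lambda>m. \<bar>?i (m + N) - ?i m\<bar>) \<longlonglongrightarrow> 0"
    using summable_LIMSEQ_zero var2 unfolding finite_Nvar_def by blast
  then have d: "(\<lambda>m. ?i (m + N) - ?i m) \<longlonglongrightarrow> 0" by (rule tendsto_rabs_zero_cancel)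
  obtain C where C: "\<And>m. \<bar>a (m + N + 1) - a (m + N)\<bar> \<le> C" using inc_bounded[of N 1] by blast
  have r: "(\<lambda>m. 1 - a (m + 1) / a (m + Suc N)) \<longlonglongrightarrow> 1 - 1"
    by (intro tendsto_intros ratio_tendsto')
  have e: "(\<lambda>m. (1 - a (m + 1) / a (m + Suc N)) * ?i (m + N)) \<longlonglongrightarrow> 0"
  proof (rule Lim_null_comparison)
    show "\<forall>\<^sub>F m in sequentially. norm ((1 - a (m + 1) / a (m + Suc N)) * ?i (m + N)) \<le> \<bar>1 - a (m + 1) / a (m + Suc N)\<bar> * C"
      using C by (intro always_eventually allI) (simp add: abs_mult mult_left_mono)
    show "(\<lambda>m. \<bar>1 - a (m + 1) / a (m + Suc N)\<bar> * C) \<longlonglongrightarrow> 0"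
      using tendsto_mult_left_zero[OF tendsto_rabs_zero] r by simp
  qed
  have eq: "a (Suc m) * (a (m + N) / a (Suc (m + N)) - a m / a (Suc m))
     = (1 - a (m + 1) / a (m + Suc N)) * ?i (m + N) - (?i (m + N) - ?i m)" for m
    by (simp add: field_simps)
  show ?thesis unfolding eq using tendsto_diff[OF e d] by simp
qed

text \<open>A balance of powers: the prefactor is of order \<open>a\<close> squared, the coefficient
  differences are o(1 / a), and bounded energy makes the products of polynomials O(1 / a).\<close>

lemma scaled_turan_Suc_diff_tendsto:
  assumes h: "hfun N q s x > 0"
  shows "(\<lambda>m. scaled_turan (Suc m) x - scaled_turan m x) \<longlonglongrightarrow> 0"
proof -
  obtain C where C: "\<And>m. energy m x \<le> C" using energy_bounded[OF h] by blast
  have C0: "C \<ge> 0" using order_trans[OF energy_nonneg C] .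
  have sq: "a m * (p m x)\<^sup>2 \<le> C" "a m * (p (Suc m) x)\<^sup>2 \<le> C" for m
  proof -
    have "a m * (p m x)\<^sup>2 + a m * (p (Suc m) x)\<^sup>2 \<le> C" using C[of m] by (simp add: energy_def distrib_left)
    moreover have "a m * (p m x)\<^sup>2 \<ge> 0" "a m * (p (Suc m) x)\<^sup>2 \<ge> 0" using a_pos[of m] by simp_all
    ultimately show "a m * (p m x)\<^sup>2 \<le> C" "a m * (p (Suc m) x)\<^sup>2 \<le> C" by linarith+
  qed
  have prod: "\<exists>B. \<forall>m. \<bar>a (Suc m) * (p (Suc m) x * p (m + j) x)\<bar> \<le> B" for j
  proof -
    obtain B where B: "\<And>m. \<bar>a (m + 1) / a (m + j)\<bar> \<le> B" using ratio_bounded by blast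
    have "\<bar>a (Suc m) * (p (Suc m) x * p (m + j) x)\<bar> \<le> C + B * C" for m
    proof -
      have "2 * \<bar>u * v\<bar> \<le> u\<^sup>2 + v\<^sup>2" for u v :: real
      proof -
        have "0 \<le> (\<bar>u\<bar> - \<bar>v\<bar>)\<^sup>2" by simp
        then show ?thesis by (simp add: power2_diff abs_mult)
      qed
      then have "\<bar>p (Suc m) x * p (m + j) x\<bar> \<le> (p (Suc m) x)\<^sup>2 + (p (m + j) x)\<^sup>2"
        by (smt (verit, best) abs_ge_zero)
      then have "a (Suc m) * \<bar>p (Suc m) x * p (m + j) x\<bar> \<le> a (Suc m) * ((p (Suc m) x)\<^sup>2 + (p (m + j) x)\<^sup>2)"
        using a_pos[of "Suc m"] by (intro mult_left_mono) auto
      also have "\<dots> = a (Suc m) * (p (Suc m) x)\<^sup>2 + a (m + 1) / a (m + j) * (a (m + j) * (p (m + j) x)\<^sup>2)"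
        by (simp add: distrib_left)
      also have "\<dots> \<le> C + B * C"
        using sq(1)[of "Suc m"] sq(1)[of "m + j"] order_trans[OF abs_ge_self B[of m]] order_trans[OF abs_ge_zero B[of m]] a_pos[of "m + j"]
        by (intro add_mono mult_mono) auto
      finally show ?thesis using a_pos[of "Suc m"] by (simp add: abs_mult)
    qed
    then show ?thesis by blast
  qed
  obtain BT where BT: "\<And>m. \<bar>scaled_turan m x\<bar> \<le> BT"
  proof -
    obtain M1 where M1: "\<And>m. \<bar>qA m x\<bar> \<le> M1" by (rule unif_bvE[OF bv_form(1)[of "{x}"]]) auto
    obtain M2 where M2: "\<And>m. \<bar>qB m x\<bar> \<le> M2" by (rule unif_bvE[OF bv_form(2)[of "{x}"]]) auto
    obtain M3 where M3: "\<And>m. \<bar>qC m x\<bar> \<le> M3" by (rule unif_bvE[OF bv_form(3)[of "{x}"]]) auto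
    define M where "M = max M1 (max M2 M3)"
    have M0: "M \<ge> 0" unfolding M_def using M1[of 0] by linarith
    obtain R where R: "\<And>m. \<bar>a (m + N) / a (m + 0)\<bar> \<le> R" using ratio_bounded by blast
    have "\<bar>scaled_turan m x\<bar> \<le> R * (2 * M * C)" for m
    proof -
      have "\<bar>scaled_turan m x\<bar> = a (m + N) * \<bar>form m x (p m x) (p (Suc m) x)\<bar>" unfolding scaled_turan_form abs_mult using a_pos[of "m + N"] by simp
      also have "\<dots> \<le> a (m + N) * (2 * M * ((p m x)\<^sup>2 + (p (Suc m) x)\<^sup>2))"
        unfolding form_def using M1[of m] M2[of m] M3[of m] a_pos[of "m + N"]
        by (intro mult_left_mono quadratic_form_upper_bound) (auto simp: M_def)
      also have "\<dots> = a (m + N) / a (m + 0) * (2 * M * energy m x)"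
        unfolding energy_def by simp
      also have "\<dots> \<le> R * (2 * M * C)"
        using order_trans[OF abs_ge_self R[of m]] order_trans[OF abs_ge_zero R[of m]] C[of m] M0 energy_nonneg[of m x]
        by (intro mult_mono) auto
      finally show ?thesis .
    qed
    then show thesis by (rule that)
  qed
  obtain B1 where B1: "\<And>m. \<bar>a (Suc m) * (p (Suc m) x * p (m + Suc N) x)\<bar> \<le> B1" using prod by blast
  obtain B2 where B2: "\<And>m. \<bar>a (Suc m) * (p (Suc m) x * p (m + N) x)\<bar> \<le> B2" using prod by blast
  let ?r = "\<lambda>m. a (m + Suc N) / a (m + N)" and ?t = "\<lambda>m. a (m + Suc N) / a (m + 1)"
  let ?z1 = "\<lambda>m. (?r m)\<^sup>2 * (a (m + 0) / a (m + 1)) - 1"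
  let ?z2 = "\<lambda>m. (?t m)\<^sup>2 * (a (Suc m) * ((x - b (Suc m)) / a (Suc m) - (x - b (Suc (m + N))) / a (Suc (m + N))))"
  let ?z3 = "\<lambda>m. (?t m)\<^sup>2 * (a (Suc m) * (a (m + N) / a (Suc (m + N)) - a m / a (Suc m)))"
  have z1: "?z1 \<longlonglongrightarrow> 1\<^sup>2 * 1 - 1" by (intro tendsto_intros ratio_tendsto')
  have z2: "?z2 \<longlonglongrightarrow> 1\<^sup>2 * 0" by (intro tendsto_mult tendsto_power ratio_tendsto' beta_diff_tendsto)
  have z3: "?z3 \<longlonglongrightarrow> 1\<^sup>2 * 0" by (intro tendsto_mult tendsto_power ratio_tendsto' alpha_diff_tendsto)
  have "(\<lambda>m. \<bar>?z1 m\<bar> * BT + \<bar>?z2 m\<bar> * B1 + \<bar>?z3 m\<bar> * B2) \<longlonglongrightarrow> \<bar>1\<^sup>2 * 1 - 1\<bar> * BT + \<bar>1\<^sup>2 * 0\<bar> * B1 + \<bar>1\<^sup>2 * 0\<bar> * B2"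
    by (intro tendsto_add tendsto_mult tendsto_rabs z1 z2 z3 tendsto_const)
  then have Z: "(\<lambda>m. \<bar>?z1 m\<bar> * BT + \<bar>?z2 m\<bar> * B1 + \<bar>?z3 m\<bar> * B2) \<longlonglongrightarrow> 0" by simp
  have "norm (scaled_turan (Suc m) x - scaled_turan m x) \<le> \<bar>?z1 m\<bar> * BT + \<bar>?z2 m\<bar> * B1 + \<bar>?z3 m\<bar> * B2" for m
  proof -
    \<comment> \<open>Distributes the two factors \<open>a\<close>, one to the coefficient
      difference and one to the product of polynomials, at the price of a ratio tending to
      1.\<close>
    have split: "c\<^sup>2 * (\<beta> * P1 + \<alpha> * P2) = ((c / d)\<^sup>2 * (d * \<beta>)) * (d * P1) + ((c / d)\<^sup>2 * (d * \<alpha>)) * (d * P2)"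
      if "d \<noteq> 0" for c d \<alpha> \<beta> P1 P2 :: real
      using that by (simp add: power2_eq_square field_simps)
    have "scaled_turan (Suc m) x - scaled_turan m x = ?z1 m * scaled_turan m x + (?z2 m * (a (Suc m) * (p (Suc m) x * p (m + Suc N) x))
       + ?z3 m * (a (Suc m) * (p (Suc m) x * p (m + N) x)))"
      unfolding scaled_turan_Suc_identity using split[of "a (Suc m)"] by (simp add: power_divide del: opoly.simps)
    then have "norm (scaled_turan (Suc m) x - scaled_turan m x) \<le> \<bar>?z1 m * scaled_turan m x\<bar> + (\<bar>?z2 m * (a (Suc m) * (p (Suc m) x * p (m + Suc N) x))\<bar>
       + \<bar>?z3 m * (a (Suc m) * (p (Suc m) x * p (m + N) x))\<bar>)"
      by (smt (verit) real_norm_def)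
    also have "\<dots> \<le> \<bar>?z1 m\<bar> * BT + (\<bar>?z2 m\<bar> * B1 + \<bar>?z3 m\<bar> * B2)"
      unfolding abs_mult[of "?z1 m"] abs_mult[of "?z2 m"] abs_mult[of "?z3 m"]
      by (intro add_mono mult_left_mono BT B1 B2) auto
    finally show ?thesis by (simp only: add.assoc)
  qed
  then show ?thesis by (intro Lim_null_comparison[OF _ Z] always_eventually allI)
qed

lemma scaled_turan_tendsto:
  assumes h: "hfun N q s x > 0" and lim: "(\<lambda>k. scaled_turan (base k) x) \<longlonglongrightarrow> g"
  shows "(\<lambda>n. (a (n + N - 1))\<^sup>2 * turan a b N n x) \<longlonglongrightarrow> g"
proof -
  have "(\<lambda>m. scaled_turan m x) \<longlonglongrightarrow> g"
    using lim scaled_turan_Suc_diff_tendsto[OF h] unfolding base_def by (rule tendsto_from_residue_class[OF N_pos])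
  then have "(\<lambda>m. (a (Suc m + N - 1))\<^sup>2 * turan a b N (Suc m) x) \<longlonglongrightarrow> g"
    by (simp add: scaled_turan_def)
  then show ?thesis by (rule LIMSEQ_imp_Suc)
qed

end

section \<open>Densities from local bounds\<close>

text \<open>Two-sided bounds on all small intervals near \<open>x0\<close>, including those with
  \<open>x0\<close> as an endpoint, amount to differentiability of the distribution function. With
  \<open>e < f x0\<close> the lower bound is positive.\<close>

locale local_density = prob_space \<mu> for \<mu> :: "real measure" +
  fixes U :: "real set" and f :: "real \<Rightarrow> real"
  assumes sets_mu [measurable_cong]: "sets \<mu> = sets borel"
    and open_U: "open U" and cont: "continuous_on U f" and pos: "\<And>x. x \<in> U \<Longrightarrow> f x > 0"
    and local_bounds: "\<And>x0 e. x0 \<in> U \<Longrightarrow> 0 < e \<Longrightarrow> e < f x0 \<Longrightarrow> \<exists>d>0. \<forall>l r. x0 - d < l \<longrightarrow> l < r \<longrightarrow> r < x0 + d \<longrightarrow>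
        (f x0 - e) * (r - l) \<le> measure \<mu> {l<..r} \<and> measure \<mu> {l<..r} \<le> (f x0 + e) * (r - l)"
begin

definition F :: "real \<Rightarrow> real" where "F x = measure \<mu> {..x}"

lemma F_diff: "l \<le> r \<Longrightarrow> F r - F l = measure \<mu> {l<..r}"
proof -
  assume "l \<le> r"
  then have "{l<..r} = {..r} - {..l}" by auto
  then show ?thesis unfolding F_def using \<open>l \<le> r\<close> by (simp add: finite_measure_Diff)
qed

lemma F_deriv:
  assumes x0: "x0 \<in> U"
  shows "(F has_real_derivative f x0) (at x0)"
  unfolding has_field_derivative_iff
proof (rule tendstoI)
  fix e :: real assume e: "e > 0"
  define e' where "e' = min e (f x0) / 2"
  have e': "e' > 0" "e' < f x0" "e' < e" using e pos[OF x0] by (auto simp: e'_def min_def)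
  obtain d where d: "d > 0" and bnd: "\<And>l r. x0 - d < l \<Longrightarrow> l < r \<Longrightarrow> r < x0 + d \<Longrightarrow>
        (f x0 - e') * (r - l) \<le> measure \<mu> {l<..r} \<and> measure \<mu> {l<..r} \<le> (f x0 + e') * (r - l)"
    using local_bounds[OF x0 e'(1,2)] by blast
  have quot: "dist ((F r - F l) / (r - l)) (f x0) < e" if "x0 - d < l" "l < r" "r < x0 + d" for l r
  proof -
    have "(f x0 - e') * (r - l) \<le> F r - F l" "F r - F l \<le> (f x0 + e') * (r - l)"
      using bnd[OF that] F_diff[of l r] that by auto
    then have "f x0 - e' \<le> (F r - F l) / (r - l)" "(F r - F l) / (r - l) \<le> f x0 + e'"
      using that by (simp_all add: pos_le_divide_eq pos_divide_le_eq)
    then show ?thesis using e' by (simp add: dist_real_def abs_less_iff)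
  qed
  have "dist ((F y - F x0) / (y - x0)) (f x0) < e" if "y \<noteq> x0" "dist y x0 < d" for y
  proof (cases "x0 < y")
    case True
    then show ?thesis using that d by (intro quot) (auto simp: dist_real_def)
  next
    case False
    then have "dist ((F x0 - F y) / (x0 - y)) (f x0) < e"
      using that d by (intro quot) (auto simp: dist_real_def)
    also have "(F x0 - F y) / (x0 - y) = (F y - F x0) / (y - x0)"
      using minus_divide_divide[of "F y - F x0" "y - x0"] by (simp only: minus_diff_eq)
    finally show ?thesis .
  qed
  then show "\<forall>\<^sub>F y in at x0. dist ((F y - F x0) / (y - x0)) (f x0) < e"
    unfolding eventually_at using d by blast
qed

text \<open>Cut off to be Borel on the whole line, since \<open>f\<close> is controlled only on
  \<open>U\<close>.\<close>

definition f' :: "real \<Rightarrow> real" where "f' x = indicator U x *\<^sub>R f x"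

lemma f'_measurable [measurable]: "f' \<in> borel_measurable borel"
  unfolding f'_def[abs_def] using open_U cont by (intro borel_measurable_continuous_on_indicator) auto

lemma emeasure_Ioc:
  assumes cd: "{c..d} \<subseteq> U"
  shows "emeasure \<mu> {c<..d} = emeasure (density lborel (\<lambda>x. ennreal (f' x))) {c<..d}"
proof (cases "c \<le> d")
  case True
  have "emeasure (density lborel (\<lambda>x. ennreal (f' x))) {c<..d} = (\<integral>\<^sup>+x. ennreal (f' x) * indicator {c<..d} x \<partial>lborel)"
    by (simp add: emeasure_density)
  also have "\<dots> = (\<integral>\<^sup>+x. ennreal (f' x) * indicator {c..d} x \<partial>lborel)"
    by (intro nn_integral_cong_AE eventually_mono[OF AE_lborel_singleton[of c]]) (auto simp: indicator_def)
  also have "\<dots> = ennreal (F d - F c)"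
  proof (rule nn_integral_FTC_Icc[OF _ _ _ True])
    fix x assume "x \<in> {c..d}"
    then have "x \<in> U" using cd by auto
    then show "DERIV F x :> f' x" "0 \<le> f' x"
      using F_deriv[of x] pos[of x] by (simp_all add: f'_def less_imp_le)
  qed measurable
  also have "\<dots> = emeasure \<mu> {c<..d}" using F_diff[OF True] by (simp add: emeasure_eq_measure)
  finally show ?thesis by simp
qed simp

text \<open>The restrictions of both measures to the interval agree on all rays
  \<open>{x<..}\<close>, and these determine a finite Borel measure.\<close>

lemma emeasure_inter_Ioc:
  assumes cd: "{c..d} \<subseteq> U" and A: "A \<in> sets borel"
  shows "emeasure \<mu> (A \<inter> {c<..d}) = emeasure (density lborel (\<lambda>x. ennreal (f' x))) (A \<inter> {c<..d})"
proof -
  let ?D = "density lborel (\<lambda>x. ennreal (f' x))"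
  let ?M1 = "density \<mu> (indicator {c<..d})" and ?M2 = "density ?D (indicator {c<..d})"
  have m1: "emeasure ?M1 B = emeasure \<mu> (B \<inter> {c<..d})" if "B \<in> sets borel" for B
    using that by (subst emeasure_density) (auto simp: sets_mu indicator_inter_arith[symmetric] Int_commute mult.commute)
  have m2: "emeasure ?M2 B = emeasure ?D (B \<inter> {c<..d})" if "B \<in> sets borel" for B
    using that by (subst emeasure_density) (auto simp: indicator_inter_arith[symmetric] Int_commute mult.commute)
  have "?M1 = ?M2"
  proof (rule measure_eqI_lessThan)
    show "emeasure ?M1 {x<..} < \<infinity>" for x
      unfolding m1[OF borel_open[OF open_greaterThan]] by (simp add: emeasure_eq_measure)
    fix x
    have "{x<..} \<inter> {c<..d} = {max c x<..d}" by auto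
    moreover have "{max c x..d} \<subseteq> U" using cd by auto
    ultimately show "emeasure ?M1 {x<..} = emeasure ?M2 {x<..}"
      unfolding m1[OF borel_open[OF open_greaterThan]] m2[OF borel_open[OF open_greaterThan]]
      using emeasure_Ioc by simp
  qed (simp_all add: sets_mu)
  then show ?thesis using m1[OF A] m2[OF A] by simp
qed

lemma emeasure_exhaustion:
  assumes A: "A \<in> sets borel" and sub: "\<And>n. {c n..d n} \<subseteq> U" and inc: "incseq (\<lambda>n. {c n<..d n})"
    and cover: "A \<subseteq> (\<Union>n. {c n<..d n})"
  shows "emeasure \<mu> A = emeasure (density lborel (\<lambda>x. ennreal (f' x))) A"
proof -
  have inc': "incseq (\<lambda>n. A \<inter> {c n<..d n})" using inc by (auto simp: incseq_def)
  have un: "(\<Union>n. A \<inter> {c n<..d n}) = A" using cover by auto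
  have "emeasure \<mu> A = (SUP n. emeasure \<mu> (A \<inter> {c n<..d n}))"
    using SUP_emeasure_incseq[OF _ inc', of \<mu>] A unfolding un by (simp add: sets_mu image_subset_iff)
  also have "\<dots> = (SUP n. emeasure (density lborel (\<lambda>x. ennreal (f' x))) (A \<inter> {c n<..d n}))"
    using emeasure_inter_Ioc[OF sub A] by simp
  also have "\<dots> = emeasure (density lborel (\<lambda>x. ennreal (f' x))) A"
    using SUP_emeasure_incseq[OF _ inc', of "density lborel (\<lambda>x. ennreal (f' x))"] A
    unfolding un by (simp add: image_subset_iff)
  finally show ?thesis .
qed

text \<open>\<open>U\<close> consists of two rays; each is exhausted by intervals whose closures
  stay in \<open>U\<close>, so no bound up to the endpoints is required.\<close>

lemma emeasure_eq_set_nn_integral: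
  assumes U: "U = - {xm..xp}" and A: "A \<in> sets borel" "A \<subseteq> U" and xle: "xm \<le> xp"
  shows "emeasure \<mu> A = (\<integral>\<^sup>+x\<in>A. ennreal (f x) \<partial>lborel)"
proof -
  let ?D = "density lborel (\<lambda>x. ennreal (f' x))"
  let ?i = "\<lambda>n. 1 / real (Suc n)"
  have i: "?i n > 0" for n by simp
  have imono: "?i n \<le> ?i m" if "m \<le> n" for m n using that by (simp add: frac_le)
  have small: "\<exists>n. ?i n < e \<and> K \<le> real (Suc n)" if epos: "e > 0" for e K
  proof -
    obtain n1 where "inverse (real (Suc n1)) < e" using reals_Archimedean[OF epos] by blast
    moreover obtain n2 where "K \<le> real n2" using real_arch_simple by blast
    ultimately show ?thesis using imono[of n1 "max n1 n2"]
      by (intro exI[of _ "max n1 n2"]) (auto simp: inverse_eq_divide)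
  qed
  have R: "emeasure \<mu> (A \<inter> {xp<..}) = emeasure ?D (A \<inter> {xp<..})"
  proof (rule emeasure_exhaustion[where c = "\<lambda>n. xp + ?i n" and d = "\<lambda>n. xp + real (Suc n)"])
    show "A \<inter> {xp<..} \<in> sets borel" using A by auto
    show "{xp + ?i n..xp + real (Suc n)} \<subseteq> U" for n
    proof
      fix x assume "x \<in> {xp + ?i n..xp + real (Suc n)}"
      then have "xp + ?i n \<le> x" by simp
      then show "x \<in> U" unfolding U using i[of n] by (simp only: Compl_iff atLeastAtMost_iff) linarith
    qed
    show "incseq (\<lambda>n. {xp + ?i n<..xp + real (Suc n)})"
    proof (rule incseq_SucI)
      show "{xp + ?i n<..xp + real (Suc n)} \<subseteq> {xp + ?i (Suc n)<..xp + real (Suc (Suc n))}" for n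
        using imono[of n "Suc n"] by auto
    qed
    show "A \<inter> {xp<..} \<subseteq> (\<Union>n. {xp + ?i n<..xp + real (Suc n)})"
    proof
      fix x assume "x \<in> A \<inter> {xp<..}"
      then obtain n where "?i n < x - xp" "x - xp \<le> real (Suc n)" using small[of "x - xp" "x - xp"] by auto
      then have "x \<in> {xp + ?i n<..xp + real (Suc n)}" by auto
      then show "x \<in> (\<Union>n. {xp + ?i n<..xp + real (Suc n)})" by blast
    qed
  qed
  have L: "emeasure \<mu> (A \<inter> {..<xm}) = emeasure ?D (A \<inter> {..<xm})"
  \<comment> \<open>The intervals are open on the left, so the left end is one further out than on
    the other ray to cover the points strictly.\<close>
  proof (rule emeasure_exhaustion[where c = "\<lambda>n. xm - real (Suc (Suc n))" and d = "\<lambda>n. xm - ?i n"])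
    show "A \<inter> {..<xm} \<in> sets borel" using A by auto
    show "{xm - real (Suc (Suc n))..xm - ?i n} \<subseteq> U" for n
    proof
      fix x assume "x \<in> {xm - real (Suc (Suc n))..xm - ?i n}"
      then have "x \<le> xm - ?i n" by simp
      then show "x \<in> U" unfolding U using i[of n] by (simp only: Compl_iff atLeastAtMost_iff) linarith
    qed
    show "incseq (\<lambda>n. {xm - real (Suc (Suc n))<..xm - ?i n})"
    proof (rule incseq_SucI)
      show "{xm - real (Suc (Suc n))<..xm - ?i n} \<subseteq> {xm - real (Suc (Suc (Suc n)))<..xm - ?i (Suc n)}" for n
        using imono[of n "Suc n"] by auto
    qed
    show "A \<inter> {..<xm} \<subseteq> (\<Union>n. {xm - real (Suc (Suc n))<..xm - ?i n})"
    proof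
      fix x assume "x \<in> A \<inter> {..<xm}"
      then obtain n where "?i n < xm - x" "xm - x \<le> real (Suc n)" using small[of "xm - x" "xm - x"] by auto
      then have "x \<in> {xm - real (Suc (Suc n))<..xm - ?i n}" by auto
      then show "x \<in> (\<Union>n. {xm - real (Suc (Suc n))<..xm - ?i n})" by blast
    qed
  qed
  have split: "A = (A \<inter> {xp<..}) \<union> (A \<inter> {..<xm})" "(A \<inter> {xp<..}) \<inter> (A \<inter> {..<xm}) = {}"
    using A(2) xle unfolding U by auto
  have "emeasure M A = emeasure M (A \<inter> {xp<..}) + emeasure M (A \<inter> {..<xm})" if "sets M = sets borel" for M
    using A(1) split that by (metis (no_types, lifting) borel_open open_greaterThan open_lessThan plus_emeasure sets.Int)
  then have "emeasure \<mu> A = emeasure ?D A" using R L sets_mu by simp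
  also have "\<dots> = (\<integral>\<^sup>+x. ennreal (f' x) * indicator A x \<partial>lborel)"
    using A(1) by (simp add: emeasure_density)
  also have "\<dots> = (\<integral>\<^sup>+x\<in>A. ennreal (f x) \<partial>lborel)"
    using A(2) by (intro nn_integral_cong) (auto simp: f'_def indicator_def)
  finally show ?thesis .
qed

end

section \<open>Trapezoidal test functions\<close>

definition trapezoid :: "real \<Rightarrow> real \<Rightarrow> real \<Rightarrow> real \<Rightarrow> real" where
  "trapezoid l r e x = max 0 (min 1 (min ((x - l) / e + 1) ((r - x) / e + 1)))"

lemma trapezoid_nonneg: "trapezoid l r e x \<ge> 0" and trapezoid_le: "trapezoid l r e x \<le> 1"
  by (simp_all add: trapezoid_def)

lemma trapezoid_eq_1: "e > 0 \<Longrightarrow> l \<le> x \<Longrightarrow> x \<le> r \<Longrightarrow> trapezoid l r e x = 1"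
  by (simp add: trapezoid_def)

lemma trapezoid_eq_0:
  assumes "e > 0" "x \<le> l - e \<or> r + e \<le> x"
  shows "trapezoid l r e x = 0"
proof -
  have "(x - l) / e + 1 \<le> 0 \<or> (r - x) / e + 1 \<le> 0"
    using assms by (auto simp: field_simps)
  then show ?thesis by (auto simp: trapezoid_def)
qed

lemma trapezoid_lipschitz:
  assumes e: "e > 0"
  shows "\<bar>trapezoid l r e x - trapezoid l r e y\<bar> \<le> 1 / e * \<bar>x - y\<bar>"
proof -
  have "\<bar>((x - l) / e + 1) - ((y - l) / e + 1)\<bar> = 1 / e * \<bar>x - y\<bar>" "\<bar>((r - x) / e + 1) - ((r - y) / e + 1)\<bar> = 1 / e * \<bar>x - y\<bar>"
    using e by (simp_all add: diff_divide_distrib[symmetric] abs_minus_commute)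
  moreover have "\<bar>max 0 (min 1 (min A B)) - max 0 (min 1 (min A' B'))\<bar> \<le> D"
    if "\<bar>A - A'\<bar> = D" "\<bar>B - B'\<bar> = D" for A A' B B' D :: real
  proof -
    have "\<bar>min A B - min A' B'\<bar> \<le> D" using that by (auto simp: min_def abs_if split: if_splits)
    then have "\<bar>min 1 (min A B) - min 1 (min A' B')\<bar> \<le> D" by (auto simp: min_def abs_if split: if_splits)
    moreover have "\<bar>max 0 s - max 0 t\<bar> \<le> \<bar>s - t\<bar>" for s t :: real by (auto simp: max_def abs_if split: if_splits)
    ultimately show ?thesis using order_trans by blast
  qed
  ultimately show ?thesis unfolding trapezoid_def by blast
qed

lemma trapezoid_measurable [measurable]: "trapezoid l r e \<in> borel_measurable borel"
  unfolding trapezoid_def[abs_def] by measurable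

lemma trapezoid_integrable:
  assumes "e > 0" shows "integrable lborel (trapezoid l r e)"
proof (rule Bochner_Integration.integrable_bound)
  show "integrable lborel (indicator {l - e..r + e} :: real \<Rightarrow> real)"
    by (cases "l - e \<le> r + e") auto
  show "AE x in lborel. norm (trapezoid l r e x) \<le> norm (indicator {l - e..r + e} x :: real)"
    using trapezoid_eq_0[OF assms, of _ l r] trapezoid_nonneg[of l r e] trapezoid_le[of l r e]
    by (intro AE_I2) (auto simp: indicator_def)
qed measurable

lemma trapezoid_integral_bounds:
  assumes e: "e > 0" and lr: "l \<le> r"
  shows "r - l \<le> (\<integral>x. trapezoid l r e x \<partial>lborel)" "(\<integral>x. trapezoid l r e x \<partial>lborel) \<le> r - l + 2 * e"
proof -
  have "(\<integral>x. indicator {l..r} x \<partial>lborel) \<le> (\<integral>x. trapezoid l r e x \<partial>lborel)"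
  proof (intro integral_mono trapezoid_integrable e)
    show "integrable lborel (indicator {l..r} :: real \<Rightarrow> real)" using lr by simp
    show "indicator {l..r} x \<le> trapezoid l r e x" for x
      using trapezoid_eq_1[OF e, of l x r] trapezoid_nonneg[of l r e x] by (auto simp: indicator_def)
  qed
  then show "r - l \<le> (\<integral>x. trapezoid l r e x \<partial>lborel)" using lr by simp
  have "(\<integral>x. trapezoid l r e x \<partial>lborel) \<le> (\<integral>x. indicator {l - e..r + e} x \<partial>lborel)"
  proof (intro integral_mono trapezoid_integrable e)
    show "integrable lborel (indicator {l - e..r + e} :: real \<Rightarrow> real)" using lr e by simp
    show "trapezoid l r e x \<le> indicator {l - e..r + e} x" for x
      using trapezoid_eq_0[OF e, of x l r] trapezoid_le[of l r e x] by (auto simp: indicator_def)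
  qed
  then show "(\<integral>x. trapezoid l r e x \<partial>lborel) \<le> r - l + 2 * e" using lr e by simp
qed

section \<open>The main theorem\<close>

text \<open>The product filter expresses "k large and x near \<open>x0\<close>" as one limit, so
  that ordinary limit rules apply to locally uniform statements.\<close>

lemma uniform_limit_tendsto_prod_filter:
  fixes f :: "nat \<Rightarrow> real \<Rightarrow> real"
  assumes u: "uniform_limit K f g sequentially" and K: "eventually (\<lambda>x. x \<in> K) (nhds x0)" and c: "isCont g x0"
  shows "((\<lambda>y. f (fst y) (snd y)) \<longlongrightarrow> g x0) (sequentially \<times>\<^sub>F nhds x0)"
proof (rule tendstoI)
  fix e :: real assume "e > 0"
  then have e: "e / 2 > 0" by simp
  have "eventually (\<lambda>x. dist (g x) (g x0) < e / 2) (nhds x0)"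
    using c e unfolding isCont_def tendsto_at_iff_tendsto_nhds by (rule tendstoD)
  then have "eventually (\<lambda>x. x \<in> K \<and> dist (g x) (g x0) < e / 2) (nhds x0)" using K by (rule eventually_conj[rotated])
  moreover have "eventually (\<lambda>k. \<forall>x\<in>K. dist (f k x) (g x) < e / 2) sequentially" by (rule uniform_limitD[OF u e])
  moreover have "dist (f k x) (g x0) < e" if "\<forall>x\<in>K. dist (f k x) (g x) < e / 2" "x \<in> K \<and> dist (g x) (g x0) < e / 2" for k x
    using that dist_triangle[of "f k x" "g x0" "g x"] by fastforce
  ultimately show "\<forall>\<^sub>F y in sequentially \<times>\<^sub>F nhds x0. dist (f (fst y) (snd y)) (g x0) < e"
    unfolding eventually_prod_filter fst_conv snd_conv by blast
qed

context turan_setup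
begin

text \<open>Bounded increments at distance \<open>N\<close> force at most linear growth along
  multiples of \<open>N\<close>, so the harmonic series is a minorant. This is Carleman's
  condition.\<close>

lemma not_summable_inverse: "\<not> summable (\<lambda>n. 1 / a n)"
proof
  assume "summable (\<lambda>n. 1 / a n)"
  then have s: "summable ((\<lambda>n. 1 / a n) \<circ> (\<lambda>k. N * k))"
    using N_pos by (intro summable_reindex) (auto simp: inj_def less_imp_le[OF a_pos])
  obtain C where C: "\<And>m. \<bar>a (m + 0 + N) - a (m + 0)\<bar> \<le> C" using inc_bounded[of 0 N] by blast
  define D where "D = max (a 0) C"
  have D: "D > 0" using a_pos[of 0] by (simp add: D_def less_max_iff_disj)
  have bd: "a (N * k) \<le> D * real (Suc k)" for k
  proof (induction k)
    case (Suc k)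
    have "a (N * Suc k) \<le> a (N * k) + C" using C[of "N * k"] by (simp add: add.commute abs_le_iff)
    also have "\<dots> \<le> D * real (Suc k) + D" using Suc by (simp add: D_def)
    finally show ?case by (simp add: algebra_simps)
  qed (simp add: D_def)
  have "summable (\<lambda>k. 1 / D * (1 / real (Suc k)))"
  proof (rule summable_comparison_test[OF _ s], intro exI allI impI)
    fix k :: nat
    have "1 / (D * real (Suc k)) \<le> 1 / a (N * k)" using bd[of k] a_pos by (intro divide_left_mono) (auto simp: D)
    then show "norm (1 / D * (1 / real (Suc k))) \<le> ((\<lambda>n. 1 / a n) \<circ> (\<lambda>k. N * k)) k"
      using D by simp
  qed
  then have "summable (\<lambda>k. D * (1 / D * (1 / real (Suc k))))" by (rule summable_mult)
  then have "summable (\<lambda>k. inverse (real (Suc k)))" using D by (simp add: inverse_eq_divide)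
  then have "summable (\<lambda>k. inverse (real k))" using summable_Suc_iff[of "\<lambda>k. inverse (real k)"] by simp
  then show False using not_summable_harmonic[where 'a = real] by simp
qed

definition U :: "real set" where "U = {x. hfun N q s x > 0}"
text \<open>Defined by a pointwise limit so that the uniform limits obtained on different compact
  sets are one function.\<close>

definition g :: "real \<Rightarrow> real" where "g x = lim (\<lambda>k. scaled_turan (base k) x)"
definition dens :: "real \<Rightarrow> real" where "dens x = sqrt (hfun N q s x) / (2 * pi * \<bar>g x\<bar>)"

lemma continuous_hfun: "continuous_on S (hfun N q s)"
proof -
  have "continuous_on S (\<lambda>x. 4 * limA x * limC x - (limB x)\<^sup>2)" by (intro continuous_intros)
  then show ?thesis unfolding lim_discriminant .
qed

lemma open_U: "open U"
  unfolding U_def by (intro open_Collect_less continuous_hfun continuous_on_const)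

lemma g_uniform:
  assumes "compact K" "K \<subseteq> U"
  shows "uniform_limit K (\<lambda>k. scaled_turan (base k)) g sequentially" and "\<And>x. x \<in> K \<Longrightarrow> g x \<noteq> 0"
proof -
  obtain G where G: "uniform_limit K (\<lambda>k. scaled_turan (base k)) G sequentially" "\<And>x. x \<in> K \<Longrightarrow> G x \<noteq> 0"
    by (rule scaled_turan_base_uniform_limit[OF assms(1)]) (use assms(2) in \<open>auto simp: U_def\<close>)
  have eq: "G x = g x" if "x \<in> K" for x
    unfolding g_def using limI[OF tendsto_uniform_limitI[OF G(1) that]] by simp
  show "uniform_limit K (\<lambda>k. scaled_turan (base k)) g sequentially"
    using G(1) eq uniform_limit_cong'[of K "\<lambda>k. scaled_turan (base k)" "\<lambda>k. scaled_turan (base k)" G g sequentially] by blast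
  show "g x \<noteq> 0" if "x \<in> K" for x using G(2) eq that by auto
qed

lemma g_nonzero: "x \<in> U \<Longrightarrow> g x \<noteq> 0"
  using g_uniform(2)[of "{x}" x] by simp

lemma g_tendsto: "x \<in> U \<Longrightarrow> (\<lambda>n. (a (n + N - 1))\<^sup>2 * turan a b N n x) \<longlonglongrightarrow> g x"
  using tendsto_uniform_limitI[OF g_uniform(1)[of "{x}"], of x] by (intro scaled_turan_tendsto) (auto simp: U_def)

lemma g_isCont: assumes "x \<in> U" shows "isCont g x"
proof -
  obtain r where r: "r > 0" "cball x r \<subseteq> U" using open_U assms open_contains_cball by blast
  have "continuous_on (cball x r) g"
    by (rule uniform_limit_theorem[OF _ g_uniform(1)[OF compact_cball r(2)]]) (auto intro: scaled_turan_continuous always_eventually)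
  then show ?thesis using r(1) by (intro continuous_on_interior[of "cball x r"]) auto
qed

lemma continuous_g: "continuous_on U g"
  by (intro continuous_at_imp_continuous_on ballI g_isCont)

lemma continuous_dens: "continuous_on U dens"
  unfolding dens_def[abs_def] using g_nonzero by (intro continuous_intros continuous_hfun continuous_g) auto

lemma dens_pos: "x \<in> U \<Longrightarrow> dens x > 0"
  using g_nonzero[of x] by (simp add: dens_def U_def)

context
  fixes x0 :: real
  assumes x0: "x0 \<in> U"
begin

private definition "h0 = hfun N q s x0"
private definition "Q0 u v = limA x0 * v\<^sup>2 + limB x0 * u * v + limC x0 * u\<^sup>2"
text \<open>The root in the lower half-plane of A t^2 + B t + C, with the limiting coefficients at
  \<open>x0\<close>; so \<open>Q0 u v\<close> is A times |v - \<tau> u|^2.\<close>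

private definition "\<tau> = Complex (- limB x0 / (2 * limA x0)) (- (sqrt h0 / (2 * \<bar>limA x0\<bar>)))"

private lemma h0_pos: "h0 > 0"
  using x0 by (simp add: h0_def U_def)

private lemma h0_eq: "h0 = 4 * limA x0 * limC x0 - (limB x0)\<^sup>2"
  unfolding h0_def lim_discriminant ..

private lemma limA_nonzero: "limA x0 \<noteq> 0"
proof
  assume "limA x0 = 0"
  then have "h0 \<le> 0" unfolding h0_eq by simp
  then show False using h0_pos by simp
qed

private lemma Im_\<tau>: "Im \<tau> < 0"
  unfolding \<tau>_def using h0_pos limA_nonzero by simp

private lemma den_eq: "\<bar>limA x0\<bar> * carmona_den m \<tau> x = \<bar>Q0 (p m x) (p (Suc m) x)\<bar>"
proof -
  have gen: "A * ((v - - B / (2 * A) * u)\<^sup>2 + (- (w / (2 * \<bar>A\<bar>)) * u)\<^sup>2) = A * v\<^sup>2 + B * u * v + C * u\<^sup>2"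
    if "A \<noteq> 0" "w\<^sup>2 = 4 * A * C - B\<^sup>2" for A B C u v w :: real
  proof -
    have "A * ((v - - B / (2 * A) * u)\<^sup>2 + (- (w / (2 * \<bar>A\<bar>)) * u)\<^sup>2)
      = A * (v + B / (2 * A) * u)\<^sup>2 + A * (w\<^sup>2 / (4 * A\<^sup>2) * u\<^sup>2)"
      by (simp add: power_mult_distrib power_divide distrib_left)
    also have "\<dots> = A * v\<^sup>2 + B * u * v + C * u\<^sup>2"
      unfolding that(2) using that(1) by (simp add: field_simps power2_eq_square)
    finally show ?thesis .
  qed
  have "limA x0 * carmona_den m \<tau> x = Q0 (p m x) (p (Suc m) x)"
    unfolding carmona_den_def \<tau>_def Q0_def complex.sel
    using h0_pos by (intro gen limA_nonzero) (simp add: h0_eq)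
  then show ?thesis using carmona_den_pos[OF Im_\<tau>, of m x] by (metis abs_mult abs_of_pos)
qed

text \<open>The leading coefficient cancels between \<open>Im \<tau>\<close> and the denominator;
  what remains is the square root of \<open>hfun\<close> over 2 pi, the numerator of the claimed
  density.\<close>

private lemma density_eq:
  "- Im \<tau> / (pi * a m * carmona_den m \<tau> x) = sqrt h0 / (2 * pi * (a m * \<bar>Q0 (p m x) (p (Suc m) x)\<bar>))"
  unfolding den_eq[symmetric] \<tau>_def using limA_nonzero by (simp add: field_simps)

private lemma Q0_tendsto:
  "((\<lambda>y. a (base (fst y)) * \<bar>Q0 (p (base (fst y)) (snd y)) (p (Suc (base (fst y))) (snd y))\<bar>) \<longlongrightarrow> \<bar>g x0\<bar>)
     (sequentially \<times>\<^sub>F nhds x0)"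
proof -
  let ?F = "sequentially \<times>\<^sub>F nhds x0"
  obtain r where r: "r > 0" "cball x0 r \<subseteq> U" using open_U x0 open_contains_cball by blast
  let ?K = "cball x0 r"
  have nb: "eventually (\<lambda>x. x \<in> ?K) (nhds x0)"
    using r(1) unfolding eventually_nhds_metric by (intro exI[of _ r]) (auto simp: dist_commute)
  have scaled_turan: "((\<lambda>y. scaled_turan (base (fst y)) (snd y)) \<longlongrightarrow> g x0) ?F"
    by (rule uniform_limit_tendsto_prod_filter[OF g_uniform(1)[OF compact_cball r(2)] nb g_isCont[OF x0]])
  have cont: "isCont limA x0" "isCont limB x0" "isCont limC x0"
    using continuous_lim[of UNIV] by (auto simp: continuous_on_eq_continuous_at)
  have A: "((\<lambda>y. qA (base (fst y)) (snd y)) \<longlongrightarrow> limA x0) ?F"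
    by (rule uniform_limit_tendsto_prod_filter[OF form_uniform_limit(1)[OF bounded_cball] nb cont(1)])
  have B: "((\<lambda>y. qB (base (fst y)) (snd y)) \<longlongrightarrow> limB x0) ?F"
    by (rule uniform_limit_tendsto_prod_filter[OF form_uniform_limit(2)[OF bounded_cball] nb cont(2)])
  have C: "((\<lambda>y. qC (base (fst y)) (snd y)) \<longlongrightarrow> limC x0) ?F"
    by (rule uniform_limit_tendsto_prod_filter[OF form_uniform_limit(3)[OF bounded_cball] nb cont(3)])
  have "(\<lambda>k. a (base k + 0) / a (base k + N)) \<longlonglongrightarrow> 1"
    using filterlim_compose[OF ratio_tendsto'[of 0 N] base_filterlim[of 0]] by simp
  then have R: "((\<lambda>y. a (base (fst y) + 0) / a (base (fst y) + N)) \<longlongrightarrow> 1) ?F"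
    by (rule filterlim_compose[OF _ filterlim_fst])
  obtain c k0 where c: "c > 0"
    and k0': "\<forall>k\<ge>k0. \<forall>x\<in>?K. \<forall>u v. c * (u\<^sup>2 + v\<^sup>2) \<le> \<bar>form (base k) x u v\<bar>"
    using form_definite[OF compact_cball, of x0 r] r(2) by (auto simp: U_def subset_iff)
  define M where "M y = \<bar>limA x0 - qA (base (fst y)) (snd y)\<bar> + \<bar>limB x0 - qB (base (fst y)) (snd y)\<bar>
      + \<bar>limC x0 - qC (base (fst y)) (snd y)\<bar>" for y
  define E where "E y = a (base (fst y) + N) * (Q0 (p (base (fst y)) (snd y)) (p (Suc (base (fst y))) (snd y))
      - form (base (fst y)) (snd y) (p (base (fst y)) (snd y)) (p (Suc (base (fst y))) (snd y)))" for y
  have M0: "(M \<longlongrightarrow> \<bar>limA x0 - limA x0\<bar> + \<bar>limB x0 - limB x0\<bar> + \<bar>limC x0 - limC x0\<bar>) ?F"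
    unfolding M_def[abs_def] by (intro tendsto_add tendsto_rabs tendsto_diff tendsto_const A B C)
  have E0: "(E \<longlongrightarrow> 0) ?F"
  proof (rule Lim_null_comparison)
    have "((\<lambda>y. 2 / c * M y * \<bar>scaled_turan (base (fst y)) (snd y)\<bar>) \<longlongrightarrow>
        2 / c * (\<bar>limA x0 - limA x0\<bar> + \<bar>limB x0 - limB x0\<bar> + \<bar>limC x0 - limC x0\<bar>) * \<bar>g x0\<bar>) ?F"
      by (intro tendsto_mult tendsto_const M0 tendsto_rabs scaled_turan)
    then show "((\<lambda>y. 2 / c * M y * \<bar>scaled_turan (base (fst y)) (snd y)\<bar>) \<longlongrightarrow> 0) ?F" by simp
    have "eventually (\<lambda>y. fst y \<ge> k0) ?F"
      by (rule eventually_compose_filterlim[OF eventually_ge_at_top filterlim_fst])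
    moreover have "eventually (\<lambda>y. snd y \<in> ?K) ?F"
      by (rule eventually_compose_filterlim[OF nb filterlim_snd])
    ultimately show "\<forall>\<^sub>F y in ?F. norm (E y) \<le> 2 / c * M y * \<bar>scaled_turan (base (fst y)) (snd y)\<bar>"
    proof eventually_elim
      case (elim y)
      let ?m = "base (fst y)" and ?x = "snd y"
      let ?u = "p ?m ?x" and ?v = "p (Suc ?m) ?x"
      have eq: "Q0 ?u ?v - form ?m ?x ?u ?v = (limA x0 - qA ?m ?x) * ?v\<^sup>2 + (limB x0 - qB ?m ?x) * ?u * ?v + (limC x0 - qC ?m ?x) * ?u\<^sup>2"
        unfolding Q0_def form_def by (simp add: algebra_simps del: opoly.simps)
      have "\<bar>Q0 ?u ?v - form ?m ?x ?u ?v\<bar> \<le> 2 * M y * (?u\<^sup>2 + ?v\<^sup>2)"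
        unfolding eq by (rule quadratic_form_upper_bound) (auto simp: M_def)
      also have "\<dots> \<le> 2 * M y * (\<bar>form ?m ?x ?u ?v\<bar> / c)"
      proof (rule mult_left_mono)
        have "c * (?u\<^sup>2 + ?v\<^sup>2) \<le> \<bar>form ?m ?x ?u ?v\<bar>" using k0' elim by blast
        then show "?u\<^sup>2 + ?v\<^sup>2 \<le> \<bar>form ?m ?x ?u ?v\<bar> / c" using c by (simp add: pos_le_divide_eq mult.commute)
        show "0 \<le> 2 * M y" by (simp add: M_def)
      qed
      finally have "a (?m + N) * \<bar>Q0 ?u ?v - form ?m ?x ?u ?v\<bar> \<le> a (?m + N) * (2 * M y * (\<bar>form ?m ?x ?u ?v\<bar> / c))"
        using a_pos[of "?m + N"] by (intro mult_left_mono) auto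
      also have "\<dots> = 2 / c * M y * \<bar>scaled_turan ?m ?x\<bar>"
        unfolding scaled_turan_form abs_mult using a_pos[of "?m + N"] by simp
      finally show ?case unfolding E_def abs_mult real_norm_def using a_pos[of "?m + N"] by simp
    qed
  qed
  have "((\<lambda>y. a (base (fst y) + 0) / a (base (fst y) + N) * \<bar>scaled_turan (base (fst y)) (snd y) + E y\<bar>) \<longlongrightarrow> 1 * \<bar>g x0 + 0\<bar>) ?F"
    by (intro tendsto_mult tendsto_rabs tendsto_add R scaled_turan E0)
  moreover have "a (base (fst y) + 0) / a (base (fst y) + N) * \<bar>scaled_turan (base (fst y)) (snd y) + E y\<bar>
     = a (base (fst y)) * \<bar>Q0 (p (base (fst y)) (snd y)) (p (Suc (base (fst y))) (snd y))\<bar>" for y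
  proof -
    let ?m = "base (fst y)"
    have "scaled_turan ?m (snd y) + E y = a (?m + N) * Q0 (p ?m (snd y)) (p (Suc ?m) (snd y))"
      unfolding scaled_turan_form E_def by (simp add: algebra_simps del: opoly.simps)
    then show ?thesis using a_pos[of "?m + N"] by (simp add: abs_mult)
  qed
  ultimately show ?thesis by simp
qed

private lemma density_near:
  assumes e: "e > 0"
  obtains d k1 where "d > 0" "\<And>k x. k \<ge> k1 \<Longrightarrow> \<bar>x - x0\<bar> < d \<Longrightarrow>
     \<bar>- Im \<tau> / (pi * a (base k) * carmona_den (base k) \<tau> x) - dens x0\<bar> < e"
proof -
  let ?F = "sequentially \<times>\<^sub>F nhds x0"
  have "((\<lambda>y. - Im \<tau> / (pi * a (base (fst y)) * carmona_den (base (fst y)) \<tau> (snd y))) \<longlongrightarrow> sqrt h0 / (2 * pi * \<bar>g x0\<bar>)) ?F"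
    unfolding density_eq using g_nonzero[OF x0]
    by (intro tendsto_divide tendsto_mult tendsto_const Q0_tendsto) auto
  then have "((\<lambda>y. - Im \<tau> / (pi * a (base (fst y)) * carmona_den (base (fst y)) \<tau> (snd y))) \<longlongrightarrow> dens x0) ?F"
    by (simp add: dens_def h0_def)
  from tendstoD[OF this e] obtain P1 P2 where P: "eventually P1 sequentially" "eventually P2 (nhds x0)"
    "\<And>k x. P1 k \<Longrightarrow> P2 x \<Longrightarrow> dist (- Im \<tau> / (pi * a (base k) * carmona_den (base k) \<tau> x)) (dens x0) < e"
    unfolding eventually_prod_filter fst_conv snd_conv by blast
  obtain k1 where k1: "\<And>k. k \<ge> k1 \<Longrightarrow> P1 k" using P(1) by (auto simp: eventually_sequentially)
  obtain d where d: "d > 0" "\<And>x. dist x x0 < d \<Longrightarrow> P2 x" using P(2) by (auto simp: eventually_nhds_metric)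
  show thesis by (rule that[of d k1]) (use d k1 P(3) in \<open>auto simp: dist_real_def\<close>)
qed

text \<open>The approximating densities are within \<open>e\<close> of \<open>dens x0\<close> near
  \<open>x0\<close>. Trapezoids supported there transfer this to the weak limit, and intervals are
  squeezed between trapezoids.\<close>

lemma carmona_limit_local_bounds:
  assumes \<mu>: "\<And>n. orthonormal_upto n \<mu>" and e: "0 < e" "e < dens x0"
  shows "\<exists>d>0. \<forall>l r. x0 - d < l \<longrightarrow> l < r \<longrightarrow> r < x0 + d \<longrightarrow>
        (dens x0 - e) * (r - l) \<le> measure \<mu> {l<..r} \<and> measure \<mu> {l<..r} \<le> (dens x0 + e) * (r - l)"
proof -
  obtain d k1 where d: "d > 0" and near: "\<And>k x. k \<ge> k1 \<Longrightarrow> \<bar>x - x0\<bar> < d \<Longrightarrow>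
     \<bar>- Im \<tau> / (pi * a (base k) * carmona_den (base k) \<tau> x) - dens x0\<bar> < e"
    by (rule density_near[OF e(1)]) blast
  let ?\<nu> = "\<lambda>k. carmona_measure (base k) \<tau>" and ?\<rho> = "\<lambda>k x. - Im \<tau> / (pi * a (base k) * carmona_den (base k) \<tau> x)"
  interpret \<mu>: prob_space \<mu> using \<mu>[of 0] by (simp add: orthonormal_upto_def)
  have sets_\<mu> [measurable_cong]: "sets \<mu> = sets borel" using \<mu>[of 0] by (simp add: orthonormal_upto_def)
  have orth\<nu>: "orthonormal_upto (base k) (?\<nu> k)" for k
    unfolding orthonormal_upto_def
    using carmona_prob_space[OF Im_\<tau>] carmona_sets[OF Im_\<tau>] carmona_orthonormal[OF Im_\<tau>] by auto
  have base0: "filterlim base at_top sequentially" using base_filterlim[of 0] by simp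
  have test: "(dens x0 - e) * (r - l) \<le> (\<integral>x. trapezoid l r \<eta> x \<partial>\<mu>) \<and> (\<integral>x. trapezoid l r \<eta> x \<partial>\<mu>) \<le> (dens x0 + e) * (r - l + 2 * \<eta>)"
    if \<eta>: "\<eta> > 0" and lr: "l \<le> r" and in_d: "x0 - d \<le> l - \<eta>" "r + \<eta> \<le> x0 + d" for l r \<eta>
  proof -
    let ?\<phi> = "trapezoid l r \<eta>"
    have lim: "(\<lambda>k. \<integral>x. ?\<phi> x \<partial>?\<nu> k) \<longlonglongrightarrow> (\<integral>x. ?\<phi> x \<partial>\<mu>)"
    proof (rule integral_tendsto_of_orthonormal[OF orth\<nu> base0 \<mu> not_summable_inverse trapezoid_integrable[OF \<eta>]])
      show "0 \<le> 1 / \<eta>" using \<eta> by simp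
      show "\<bar>?\<phi> x\<bar> \<le> 1" for x using trapezoid_nonneg[of l r \<eta> x] trapezoid_le[of l r \<eta> x] by simp
      show "\<bar>?\<phi> s - ?\<phi> t\<bar> \<le> 1 / \<eta> * \<bar>s - t\<bar>" for s t by (rule trapezoid_lipschitz[OF \<eta>])
    qed
    have bnd: "(dens x0 - e) * (\<integral>x. ?\<phi> x \<partial>lborel) \<le> (\<integral>x. ?\<phi> x \<partial>?\<nu> k) \<and> (\<integral>x. ?\<phi> x \<partial>?\<nu> k) \<le> (dens x0 + e) * (\<integral>x. ?\<phi> x \<partial>lborel)"
      if k: "k \<ge> k1" for k
    proof -
      interpret \<nu>: prob_space "?\<nu> k" by (rule carmona_prob_space[OF Im_\<tau>])
      have "integrable (?\<nu> k) ?\<phi>"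
        using trapezoid_nonneg[of l r \<eta>] trapezoid_le[of l r \<eta>]
        by (intro \<nu>.integrable_const_bound[where B = 1]) (auto simp: measurable_cong_sets[OF carmona_sets[OF Im_\<tau>] refl])
      then have int: "integrable lborel (\<lambda>x. ?\<rho> k x * ?\<phi> x)"
        by (subst (asm) integrable_carmona[OF Im_\<tau> trapezoid_measurable])
      have pt: "(dens x0 - e) * ?\<phi> x \<le> ?\<rho> k x * ?\<phi> x \<and> ?\<rho> k x * ?\<phi> x \<le> (dens x0 + e) * ?\<phi> x" for x
      proof (cases "\<bar>x - x0\<bar> < d")
        case True
        then have "dens x0 - e \<le> ?\<rho> k x" "?\<rho> k x \<le> dens x0 + e"
          using near[OF k True] unfolding abs_less_iff by linarith+
        then show ?thesis using trapezoid_nonneg[of l r \<eta> x] by (intro conjI mult_right_mono)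
      next
        case False
        then have "x \<le> l - \<eta> \<or> r + \<eta> \<le> x" using in_d by auto
        then have "?\<phi> x = 0" by (rule trapezoid_eq_0[OF \<eta>])
        then show ?thesis by simp
      qed
      have I: "integrable lborel (\<lambda>x. w * ?\<phi> x)" for w by (intro integrable_mult_right trapezoid_integrable \<eta>)
      have "(\<integral>x. (dens x0 - e) * ?\<phi> x \<partial>lborel) \<le> (\<integral>x. ?\<rho> k x * ?\<phi> x \<partial>lborel)"
        "(\<integral>x. ?\<rho> k x * ?\<phi> x \<partial>lborel) \<le> (\<integral>x. (dens x0 + e) * ?\<phi> x \<partial>lborel)"
        by (intro integral_mono int I conjunct1[OF pt] conjunct2[OF pt])+
      then show ?thesis
        unfolding integral_carmona[OF Im_\<tau> trapezoid_measurable] by simp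
    qed
    have "(dens x0 - e) * (\<integral>x. ?\<phi> x \<partial>lborel) \<le> (\<integral>x. ?\<phi> x \<partial>\<mu>)"
      by (rule LIMSEQ_le_const[OF lim]) (use bnd in blast)
    moreover have "(\<integral>x. ?\<phi> x \<partial>\<mu>) \<le> (dens x0 + e) * (\<integral>x. ?\<phi> x \<partial>lborel)"
      by (rule LIMSEQ_le_const2[OF lim]) (use bnd in blast)
    moreover have "(dens x0 - e) * (r - l) \<le> (dens x0 - e) * (\<integral>x. ?\<phi> x \<partial>lborel)"
      using e trapezoid_integral_bounds(1)[OF \<eta> lr] by (intro mult_left_mono) auto
    moreover have "(dens x0 + e) * (\<integral>x. ?\<phi> x \<partial>lborel) \<le> (dens x0 + e) * (r - l + 2 * \<eta>)"
      using e trapezoid_integral_bounds(2)[OF \<eta> lr] by (intro mult_left_mono) auto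
    ultimately show ?thesis by linarith
  qed
  have meas: "measure \<mu> {l<..r} = (\<integral>x. indicator {l<..r} x \<partial>\<mu>)" for l r
    by (simp add: sets_eq_imp_space_eq[OF sets_\<mu>])
  have Iind: "integrable \<mu> (indicator {l<..r} :: real \<Rightarrow> real)" for l r
    by (intro \<mu>.integrable_const_bound[where B = 1]) (auto simp: sets_\<mu> intro!: borel_measurable_indicator split: split_indicator)
  have Itrap: "integrable \<mu> (trapezoid l r \<eta>)" for l r \<eta>
    using trapezoid_nonneg[of l r \<eta>] trapezoid_le[of l r \<eta>]
    by (intro \<mu>.integrable_const_bound[where B = 1]) (auto simp: measurable_cong_sets[OF sets_\<mu> refl])
  have fe: "dens x0 + e > 0" "dens x0 - e > 0" using e by auto
  have "(dens x0 - e) * (r - l) \<le> measure \<mu> {l<..r} \<and> measure \<mu> {l<..r} \<le> (dens x0 + e) * (r - l)"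
    if l: "x0 - d < l" and lr: "l < r" and r: "r < x0 + d" for l r
  proof
    show "measure \<mu> {l<..r} \<le> (dens x0 + e) * (r - l)"
    proof (rule field_le_epsilon)
      fix \<epsilon> :: real assume \<epsilon>: "\<epsilon> > 0"
      \<comment> \<open>Small enough to keep the outer trapezoid inside the neighbourhood and to
        make the surplus length \<open>2 * \<eta>\<close> cost at most \<epsilon>.\<close>
      define \<eta> where "\<eta> = min (\<epsilon> / (2 * (dens x0 + e))) (min (l - (x0 - d)) (x0 + d - r))"
      have \<eta>: "\<eta> > 0" "\<eta> \<le> \<epsilon> / (2 * (dens x0 + e))" "x0 - d \<le> l - \<eta>" "r + \<eta> \<le> x0 + d"
        using \<epsilon> fe l r by (auto simp: \<eta>_def min_def)
      have "measure \<mu> {l<..r} \<le> (\<integral>x. trapezoid l r \<eta> x \<partial>\<mu>)" unfolding meas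
      proof (rule integral_mono[OF Iind Itrap])
        show "indicator {l<..r} x \<le> trapezoid l r \<eta> x" for x
          using trapezoid_eq_1[OF \<eta>(1), of l x r] trapezoid_nonneg[of l r \<eta> x] by (auto simp: indicator_def)
      qed
      also have "\<dots> \<le> (dens x0 + e) * (r - l + 2 * \<eta>)" using test[of \<eta> l r] \<eta> lr by auto
      also have "\<dots> = (dens x0 + e) * (r - l) + 2 * (dens x0 + e) * \<eta>" by (simp add: algebra_simps)
      also have "2 * (dens x0 + e) * \<eta> \<le> 2 * (dens x0 + e) * (\<epsilon> / (2 * (dens x0 + e)))"
        using \<eta>(2) fe by (intro mult_left_mono) auto
      also have "\<dots> = \<epsilon>" using fe by simp
      finally show "measure \<mu> {l<..r} \<le> (dens x0 + e) * (r - l) + \<epsilon>" by simp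
    qed
    show "(dens x0 - e) * (r - l) \<le> measure \<mu> {l<..r}"
    proof (rule field_le_epsilon)
      fix \<epsilon> :: real assume \<epsilon>: "\<epsilon> > 0"
      \<comment> \<open>The inner trapezoid has plateau from \<open>l + \<eta>\<close> to
        \<open>r - \<eta>\<close> and vanishes outside the interval; the second bound keeps the
        plateau nonempty.\<close>
      define \<eta> where "\<eta> = min (\<epsilon> / (2 * (dens x0 - e))) ((r - l) / 2)"
      have \<eta>: "\<eta> > 0" "\<eta> \<le> \<epsilon> / (2 * (dens x0 - e))" "l + \<eta> \<le> r - \<eta>"
        using \<epsilon> fe lr by (auto simp: \<eta>_def min_def field_simps)
      have "(dens x0 - e) * (r - l) = (dens x0 - e) * ((r - \<eta>) - (l + \<eta>)) + 2 * (dens x0 - e) * \<eta>" by (simp add: algebra_simps)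
      also have "2 * (dens x0 - e) * \<eta> \<le> 2 * (dens x0 - e) * (\<epsilon> / (2 * (dens x0 - e)))"
        using \<eta>(2) fe by (intro mult_left_mono) auto
      also have "\<dots> = \<epsilon>" using fe by simp
      also have "(dens x0 - e) * ((r - \<eta>) - (l + \<eta>)) \<le> (\<integral>x. trapezoid (l + \<eta>) (r - \<eta>) \<eta> x \<partial>\<mu>)"
        using test[of \<eta> "l + \<eta>" "r - \<eta>"] \<eta> l r by auto
      also have "\<dots> \<le> measure \<mu> {l<..r}" unfolding meas
      proof (rule integral_mono[OF Itrap Iind])
        show "trapezoid (l + \<eta>) (r - \<eta>) \<eta> x \<le> indicator {l<..r} x" for x
          using trapezoid_eq_0[OF \<eta>(1), of x "l + \<eta>" "r - \<eta>"] trapezoid_le[of "l + \<eta>" "r - \<eta>" \<eta> x] by (auto simp: indicator_def)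
      qed
      finally show "(dens x0 - e) * (r - l) \<le> measure \<mu> {l<..r} + \<epsilon>" by simp
    qed
  qed
  then show ?thesis using d by blast
qed

end

lemma local_density_mu:
  assumes \<mu>: "\<And>n. orthonormal_upto n \<mu>"
  shows "local_density \<mu> U dens"
proof -
  interpret prob_space \<mu> using \<mu>[of 0] by (simp add: orthonormal_upto_def)
  show ?thesis
    by unfold_locales
       (use \<mu>[of 0] open_U continuous_dens dens_pos carmona_limit_local_bounds[OF _ \<mu>] in \<open>auto simp: orthonormal_upto_def\<close>)
qed

end

text \<open>\<open>hfun\<close> is even in x, so its set of roots is symmetric and
  \<open>xm = - xp\<close>; a double root at 0 is covered.\<close>

lemma hfun_pos_outside_roots:
  assumes roots: "{x. hfun N q s x = 0} = {xm, xp}" and xle: "xm \<le> xp" and c: "4 * (real N)\<^sup>2 / (4 - q\<^sup>2) > 0"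
  shows "{x. hfun N q s x > 0} = - {xm..xp}"
proof -
  define \<alpha> where "\<alpha> = 4 * (real N)\<^sup>2 / (4 - q\<^sup>2)"
  define \<beta> where "\<beta> = 4 * (\<Sum>i = 1..N - 1. \<Sum>j = 1..N - 1.
              s i * s j * chebw (int i - 1) q * chebw (int j - 1) q * chebw (int i - int j) q)"
  have h: "hfun N q s x = \<alpha> * x\<^sup>2 - \<beta>" for x by (simp add: hfun_def \<alpha>_def \<beta>_def)
  have \<alpha>: "\<alpha> > 0" using c by (simp add: \<alpha>_def)
  have z: "hfun N q s xm = 0" "hfun N q s xp = 0" using roots by auto
  then have "hfun N q s (- xm) = 0" "hfun N q s (- xp) = 0" by (simp_all add: h)
  then have "- xm \<in> {xm, xp}" "- xp \<in> {xm, xp}" unfolding roots[symmetric] by simp_all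
  then have sym: "xm = - xp" "xp \<ge> 0" using xle by auto
  have "hfun N q s x = \<alpha> * (x\<^sup>2 - xp\<^sup>2)" for x using z(2) unfolding h by (simp add: algebra_simps)
  then have "hfun N q s x > 0 \<longleftrightarrow> xp\<^sup>2 < x\<^sup>2" for x using \<alpha> by (simp add: zero_less_mult_iff)
  moreover have "xp\<^sup>2 < x\<^sup>2 \<longleftrightarrow> xp < \<bar>x\<bar>" for x
    using sym(2) abs_le_square_iff[of x xp] by (simp add: not_le[symmetric])
  ultimately have "{x. hfun N q s x > 0} = {x. xp < \<bar>x\<bar>}" by (simp only:)
  also have "\<dots> = - {- xp..xp}" by (auto simp: abs_if split: if_splits)
  finally show ?thesis unfolding sym(1)[symmetric] .
qed

theorem theorem2:
  fixes a b :: "nat \<Rightarrow> real" and \<mu> :: "real measure" and N :: nat and q :: real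
    and s :: "nat \<Rightarrow> real" and xm xp :: real
  assumes apos: "\<And>n. a n > 0"
    and prob: "prob_space \<mu>" and sets_mu: "sets \<mu> = sets borel"
    and orth: "\<And>m n. integrable \<mu> (\<lambda>x. opoly a b m x * opoly a b n x) \<and>
                 (\<integral>x. opoly a b m x * opoly a b n x \<partial>\<mu>) = (if m = n then 1 else 0)"
    and N2: "N \<ge> 2"
    and qdef: "q \<in> {2 * cos (real k * pi / real N) | k. k \<in> {1..N - 1}}"
    and var1: "finite_Nvar N (\<lambda>n. 1 / a n)"
    and var2: "finite_Nvar N (\<lambda>n. a (n + 1) - a n)"
    and var3: "finite_Nvar N (\<lambda>n. b n - q * a n)"
    and lim_inv: "(\<lambda>n. 1 / a n) \<longlonglongrightarrow> 0"
    and lim_s: "\<And>i. i < N \<Longrightarrow>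
                 (\<lambda>k. a (N * k + i + N) - a (N * k + i + N - 1)) \<longlonglongrightarrow> s i"
    and lim_b: "(\<lambda>n. b n - q * a n) \<longlonglongrightarrow> 0"
    and lim_N: "(\<lambda>n. a (n + N) - a n) \<longlonglongrightarrow> 0"
    and roots: "{x. hfun N q s x = 0} = {xm, xp}" and xle: "xm \<le> xp"
  shows "\<exists>g :: real \<Rightarrow> real.
           (\<forall>x. x \<notin> {xm..xp} \<longrightarrow>
               (\<lambda>n. (a (n + N - 1))\<^sup>2 * turan a b N n x) \<longlonglongrightarrow> g x) \<and>
           continuous_on (- {xm..xp}) g \<and>
           (\<forall>x. x \<notin> {xm..xp} \<longrightarrow> g x \<noteq> 0) \<and>
           (\<forall>A \<in> sets borel. A \<subseteq> - {xm..xp} \<longrightarrow>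
               emeasure \<mu> A =
               (\<integral>\<^sup>+ x\<in>A. ennreal (sqrt (hfun N q s x) / (2 * pi * \<bar>g x\<bar>)) \<partial>lborel))"
proof -
  obtain k where k: "1 \<le> k" "k \<le> N - 1" and q: "q = 2 * cos (real k * pi / real N)" using qdef by auto
  \<comment> \<open>The supplement of the angle of \<open>q\<close>, which produces the minus sign
    of \<open>q_eq\<close>.\<close>
  define \<phi> where "\<phi> = pi - real k * pi / real N"
  have "real k < real N" using k N2 by linarith
  then have \<phi>: "0 < \<phi>" "\<phi> < pi" using k by (auto simp: \<phi>_def field_simps)
  have sin: "sin \<phi> > 0" using \<phi> by (rule sin_gt_zero)
  have "real N * \<phi> = real (N - k) * pi" using k N2 by (simp add: \<phi>_def field_simps of_nat_diff)
  then have sinN: "sin (real N * \<phi>) = 0" by (simp only: sin_npi)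
  have q': "q = - 2 * cos \<phi>" unfolding q \<phi>_def by simp
  interpret jacobi a b by unfold_locales (rule apos)
  interpret turan_setup a b N q \<phi> s
    by unfold_locales (use N2 q' sin sinN var1 var2 var3 lim_inv lim_s lim_b lim_N in auto)
  have "4 - q\<^sup>2 = 4 * (sin \<phi>)\<^sup>2" unfolding q' by (simp add: power_mult_distrib sin_squared_eq)
  then have U_eq: "U = - {xm..xp}"
    unfolding U_def using sin N2 by (intro hfun_pos_outside_roots roots xle) simp
  interpret local_density \<mu> U dens
    by (rule local_density_mu) (use prob sets_mu orth in \<open>auto simp: orthonormal_upto_def\<close>)
  show ?thesis
  proof (intro exI[of _ g] conjI allI ballI impI)
    show "(\<lambda>n. (a (n + N - 1))\<^sup>2 * turan a b N n x) \<longlonglongrightarrow> g x" "g x \<noteq> 0" if "x \<notin> {xm..xp}" for x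
      using that g_tendsto[of x] g_nonzero[of x] by (auto simp: U_eq)
    show "continuous_on (- {xm..xp}) g" using continuous_g by (simp add: U_eq)
    show "emeasure \<mu> A = (\<integral>\<^sup>+ x\<in>A. ennreal (sqrt (hfun N q s x) / (2 * pi * \<bar>g x\<bar>)) \<partial>lborel)"
      if "A \<in> sets borel" "A \<subseteq> - {xm..xp}" for A
      using emeasure_eq_set_nn_integral[OF U_eq that(1) _ xle] that(2) by (simp add: U_eq dens_def)
  qed
qed

end
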